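(* Let $K$ be the Sierpiński carpet and let $$\beta_*:=\sup\{\beta>0:(\mathcal{E}_\beta,\mathcal{F}_\beta)\text{ is a regular Dirichlet form on }L^2(K;\nu)\}.$$ Then $$\beta_*\in\left[\frac{\log\left(8\cdot\frac76\right)}{\log3},\ \frac{\log\left(8\cdot\frac32\right)}{\log3}\right].$$
   Context: Sierpiński carpet: $p_0=(0,0)$, $p_1=(\frac12,0)$, $p_2=(1,0)$, $p_3=(1,\frac12)$, $p_4=(1,1)$, $p_5=(\frac12,1)$, $p_6=(0,1)$, $p_7=(0,\frac12)$, $f_i(x)=(x+2p_i)/3$ for $x\in\mathbb{R}^2$, $i=0,\ldots,7$; $K$ is the unique non-empty compact set with $K=\bigcup_{i=0}^7f_i(K)$, with the Euclidean metric; $\nu$ is the normalized Hausdorff measure on $K$ of dimension $\alpha=\log8/\log3$. For $\beta>0$, $$\mathcal{E}_\beta(u,u)=\int_K\int_K\frac{(u(x)-u(y))^2}{|x-y|^{\alpha+\beta}}\,\nu(dx)\,\nu(dy),\qquad \mathcal{F}_\beta=\{u\in L^2(K;\nu):\mathcal{E}_\beta(u,u)<+\infty\}.$$ *)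

theory Defs
  imports "HOL-Analysis.Analysis"
begin

section \<open>Hausdorff measure\<close>

text \<open>Intended for \<open>s > 0\<close>: with \<open>0 powr s = 0\<close>, the empty set and
  singletons contribute \<open>0\<close> to a cover.  The boundedness condition is needed because
  \<^const>\<open>diameter\<close> carries no information on unbounded sets.\<close>

definition hausdorff_premeasure :: "real \<Rightarrow> real \<Rightarrow> 'a::metric_space set \<Rightarrow> ennreal" where
  "hausdorff_premeasure s \<delta> A =
     (INF U \<in> {U :: nat \<Rightarrow> 'a set. A \<subseteq> (\<Union>i. U i) \<and> (\<forall>i. bounded (U i) \<and> diameter (U i) \<le> \<delta>)}.
        \<Sum>i. ennreal (diameter (U i) powr s))"

definition hausdorff_outer_measure :: "real \<Rightarrow> 'a::metric_space set \<Rightarrow> ennreal" where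
  "hausdorff_outer_measure s A = (SUP \<delta>\<in>{0<..}. hausdorff_premeasure s \<delta> A)"

definition hausdorff_measure :: "real \<Rightarrow> 'a::metric_space measure" where
  "hausdorff_measure s = measure_of UNIV (sets borel) (hausdorff_outer_measure s)"


section \<open>Regular Dirichlet forms\<close>

text \<open>Elements of \<open>L\<^sup>2(M)\<close> are represented by square-integrable functions; the axioms
  \<open>ae_closed\<close> and \<open>form_cong\<close> below say that the domain and the form only depend on
  classes modulo equality almost everywhere.\<close>

definition L2_functions :: "'a measure \<Rightarrow> ('a \<Rightarrow> real) set" where
  "L2_functions M = {u \<in> borel_measurable M. integrable M (\<lambda>x. (u x)\<^sup>2)}"

definition L2_norm :: "'a measure \<Rightarrow> ('a \<Rightarrow> real) \<Rightarrow> real" where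
  "L2_norm M u = sqrt (\<integral>x. (u x)\<^sup>2 \<partial>M)"

definition form_norm1 ::
  "'a measure \<Rightarrow> (('a \<Rightarrow> real) \<Rightarrow> ('a \<Rightarrow> real) \<Rightarrow> real) \<Rightarrow> ('a \<Rightarrow> real) \<Rightarrow> real" where
  "form_norm1 M E u = sqrt (E u u + (L2_norm M u)\<^sup>2)"

locale symmetric_form =
  fixes M :: "'a measure"
    and E :: "('a \<Rightarrow> real) \<Rightarrow> ('a \<Rightarrow> real) \<Rightarrow> real"
    and F :: "('a \<Rightarrow> real) set"
  assumes domain_L2: "F \<subseteq> L2_functions M"
    and ae_closed: "\<lbrakk>u \<in> F; v \<in> L2_functions M; AE x in M. u x = v x\<rbrakk> \<Longrightarrow> v \<in> F"
    and zero_mem: "(\<lambda>x. 0) \<in> F"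
    and add_mem: "\<lbrakk>u \<in> F; v \<in> F\<rbrakk> \<Longrightarrow> (\<lambda>x. u x + v x) \<in> F"
    and scale_mem: "u \<in> F \<Longrightarrow> (\<lambda>x. c * u x) \<in> F"
    and domain_dense:
      "\<lbrakk>u \<in> L2_functions M; 0 < \<epsilon>\<rbrakk> \<Longrightarrow> \<exists>v\<in>F. L2_norm M (\<lambda>x. u x - v x) < \<epsilon>"
    and form_cong: "\<lbrakk>u \<in> F; u' \<in> F; v \<in> F; AE x in M. u x = u' x\<rbrakk> \<Longrightarrow> E u v = E u' v"
    and form_sym: "\<lbrakk>u \<in> F; v \<in> F\<rbrakk> \<Longrightarrow> E u v = E v u"
    and form_add: "\<lbrakk>u \<in> F; v \<in> F; w \<in> F\<rbrakk> \<Longrightarrow> E (\<lambda>x. u x + v x) w = E u w + E v w"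
    and form_scale: "\<lbrakk>u \<in> F; v \<in> F\<rbrakk> \<Longrightarrow> E (\<lambda>x. c * u x) v = c * E u v"
    and form_nonneg: "u \<in> F \<Longrightarrow> 0 \<le> E u u"

locale dirichlet_form = symmetric_form M E F
  for M :: "'a measure" and E F +
  assumes closed_form:
      "\<lbrakk>\<And>n. U n \<in> F;
        \<And>\<epsilon>. 0 < \<epsilon> \<Longrightarrow> \<exists>N. \<forall>m\<ge>N. \<forall>n\<ge>N. form_norm1 M E (\<lambda>x. U m x - U n x) < \<epsilon>\<rbrakk>
       \<Longrightarrow> \<exists>v\<in>F. (\<lambda>n. form_norm1 M E (\<lambda>x. U n x - v x)) \<longlonglongrightarrow> 0"
    and markov_mem: "u \<in> F \<Longrightarrow> (\<lambda>x. min (max (u x) 0) 1) \<in> F"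
    and markov_le: "u \<in> F \<Longrightarrow>
       E (\<lambda>x. min (max (u x) 0) 1) (\<lambda>x. min (max (u x) 0) 1) \<le> E u u"

definition compactly_supported_continuous :: "'a::topological_space set \<Rightarrow> ('a \<Rightarrow> real) set" where
  "compactly_supported_continuous X =
     {u. continuous_on X u \<and> (\<exists>C. compact C \<and> C \<subseteq> X \<and> (\<forall>x\<in>X - C. u x = 0))}"

text \<open>The underlying topological space is \<^term>\<open>space M\<close> with the subspace topology.  The usual
  standing assumptions (a locally compact separable metric space with a Radon measure of full
  support) concern \<open>M\<close> alone and are not repeated here.\<close>

locale regular_dirichlet_form = dirichlet_form M E F
  for M :: "'a::topological_space measure" and E F +
  assumes core_dense_domain:
      "\<lbrakk>u \<in> F; 0 < \<epsilon>\<rbrakk> \<Longrightarrow>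
       \<exists>v \<in> F \<inter> compactly_supported_continuous (space M). form_norm1 M E (\<lambda>x. u x - v x) < \<epsilon>"
    and core_dense_uniform:
      "\<lbrakk>u \<in> compactly_supported_continuous (space M); 0 < \<epsilon>\<rbrakk> \<Longrightarrow>
       \<exists>v \<in> F \<inter> compactly_supported_continuous (space M). \<forall>x\<in>space M. \<bar>u x - v x\<bar> < \<epsilon>"


section \<open>The Sierpinski carpet and its non-local quadratic forms\<close>

text \<open>The product metric on \<^typ>\<open>real \<times> real\<close> is the Euclidean one.\<close>

definition carpet_point :: "nat \<Rightarrow> real \<times> real" where
  "carpet_point i =
     [(0, 0), (1/2, 0), (1, 0), (1, 1/2), (1, 1), (1/2, 1), (0, 1), (0, 1/2)] ! i"

definition carpet_map :: "nat \<Rightarrow> real \<times> real \<Rightarrow> real \<times> real" where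
  "carpet_map i x = (1/3) *\<^sub>R (x + 2 *\<^sub>R carpet_point i)"

definition sierpinski_carpet :: "(real \<times> real) set" where
  "sierpinski_carpet =
     (THE K. K \<noteq> {} \<and> compact K \<and> K = (\<Union>i\<in>{0..7}. carpet_map i ` K))"

definition carpet_dim :: real where
  "carpet_dim = ln 8 / ln 3"

definition carpet_measure :: "(real \<times> real) measure" where
  "carpet_measure =
     restrict_space (uniform_measure (hausdorff_measure carpet_dim) sierpinski_carpet)
       sierpinski_carpet"

text \<open>On the diagonal the integrand is \<open>0 / 0 = 0\<close>.\<close>

definition carpet_energy :: "real \<Rightarrow> (real \<times> real \<Rightarrow> real) \<Rightarrow> ennreal" where
  "carpet_energy \<beta> u =
     (\<integral>\<^sup>+ x. (\<integral>\<^sup>+ y. ennreal ((u x - u y)\<^sup>2 / dist x y powr (carpet_dim + \<beta>))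
        \<partial>carpet_measure) \<partial>carpet_measure)"

definition carpet_domain :: "real \<Rightarrow> (real \<times> real \<Rightarrow> real) set" where
  "carpet_domain \<beta> = {u \<in> L2_functions carpet_measure. carpet_energy \<beta> u < \<infinity>}"

text \<open>The bilinear form is obtained by polarization from its diagonal values
  \<^const>\<open>carpet_energy\<close>, which are finite on the domain.\<close>

definition carpet_form ::
  "real \<Rightarrow> (real \<times> real \<Rightarrow> real) \<Rightarrow> (real \<times> real \<Rightarrow> real) \<Rightarrow> real" where
  "carpet_form \<beta> u v =
     (enn2real (carpet_energy \<beta> (\<lambda>x. u x + v x)) -
      enn2real (carpet_energy \<beta> (\<lambda>x. u x - v x))) / 4"

text \<open>The supremum is taken in the extended reals, so that it is meaningful without knowing that
  the set is non-empty and bounded.\<close>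

definition carpet_critical_exponent :: ereal where
  "carpet_critical_exponent =
     Sup (ereal ` {\<beta>. 0 < \<beta> \<and>
       regular_dirichlet_form carpet_measure (carpet_form \<beta>) (carpet_domain \<beta>)})"

end

theory Submission
  imports Defs
begin

text \<open>Write \<open>q = 3 powr \<beta>\<close>.  The Hausdorff measure gives every cell of level \<open>n\<close> mass
  \<open>8\<^sup>-\<^sup>n\<close>, so by Jensen's inequality the squared differences of the averages of \<open>u\<close> over
  pairwise disjoint pairs of neighbouring cells add up to at most \<open>const * (8 / q)\<^sup>n\<close> times the
  energy of \<open>u\<close>.

  If the form is regular, some \<open>u\<close> of finite energy is uniformly close to the first coordinate.
  It rises by a fixed amount along each of \<open>2\<^sup>n\<close> unobstructed rows of \<open>3\<^sup>n\<close> cells, and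
  Cauchy-Schwarz gives \<open>(2/3)\<^sup>n \<le> const * (8 / q)\<^sup>n\<close> for all \<open>n\<close>, that is \<open>q \<le> 12\<close>.

  Conversely, let \<open>8 < q < 28/3\<close>.  Let \<open>\<phi>\<close> be the distribution function of the self-similar measure
  on \<open>[0, 1]\<close> with weights \<open>2/7, 3/7, 2/7\<close>.  The squared increments of \<open>\<phi>(x\<^sub>1)\<close> over the cells of
  level \<open>n\<close> add up to \<open>(6/7)\<^sup>n\<close>, so \<open>\<phi>(x\<^sub>1)\<close> and \<open>\<phi>(x\<^sub>2)\<close> have finite energy.  They separate points,
  and by the Stone-Weierstrass theorem the domain is dense in the continuous functions.  As
  \<open>q > 8\<close>, a Morrey-type estimate shows that every function in the domain has a continuous version,
  hence the form is regular.\<close>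

section \<open>Metric outer measures\<close>

text \<open>The factor (8 / q)^n is 8^(2n) / (8^n q^n): the two averages bring inverse masses, and
  at distances of order 3^-n the kernel is of order 3^(-n (\<alpha> + \<beta>)) = 8^-n q^-n. So q /
  8 is measured against the growth of resistances: 2^n parallel rows of 3^n unit resistors give
  (3/2)^n, hence 12 = 8 * 3/2; short-circuiting columns gives (7/6)^n, hence 28/3 = 8 * 7/6. For the
  lower bound, forms with exponents arbitrarily close to the end point suffice, and because 7/6 > 1
  they can be taken with q > 8, where approximation in the form norm reduces to continuous versions.
  Two features of the definitions shape the rest. \<open>measure_of\<close> yields the zero measure
  unless the Hausdorff outer measure is countably additive on the Borel sets, which is why
  Caratheodory's criterion comes first, and the normalization requires positive and finite mass of
  the carpet. The form is defined by polarization, so its bilinearity has to be derived from an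
  integral formula.\<close>

text \<open>Caratheodory's criterion.  The set \<open>X - C\<close> is exhausted by the sets \<open>Xk k\<close>, which are
  separated from \<open>C\<close>; the shells between them fall into two classes of mutually separated sets,
  so their measures are summable and \<open>f (Xk k)\<close> tends to \<open>f (X - C)\<close>.\<close>

lemma metric_outer_measure_closed:
  fixes f :: "'a::metric_space set \<Rightarrow> ennreal"
  assumes oms: "outer_measure_space (Pow UNIV) f"
    and sep: "\<And>A B d. 0 < d \<Longrightarrow> (\<And>x y. x \<in> A \<Longrightarrow> y \<in> B \<Longrightarrow> d \<le> dist x y) \<Longrightarrow> f A + f B \<le> f (A \<union> B)"
    and C: "closed C"
  shows "f (X \<inter> C) + f (X - C) \<le> f X"
proof (cases "C = {} \<or> f X = \<infinity>")
  case True
  moreover have "f {} = 0"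
    using oms by (auto simp: outer_measure_space_def positive_def)
  ultimately show ?thesis by auto
next
  case False
  then have ne: "C \<noteq> {}" and fin: "f X < \<infinity>" by (auto simp: less_top)
  have mono: "A \<subseteq> B \<Longrightarrow> f A \<le> f B" for A B
    using oms by (auto simp: outer_measure_space_def increasing_def)
  have empty: "f {} = 0"
    using oms by (auto simp: outer_measure_space_def positive_def)
  \<comment> \<open>\<open>countably_subadditive\<close> speaks of disjoint families;
    \<open>disjointed\<close> and monotonicity extend it to all sequences.\<close>
  have csa: "f (\<Union>i. A i) \<le> (\<Sum>i. f (A i))" for A :: "nat \<Rightarrow> 'a set"
  proof -
    interpret sigma_algebra UNIV "Pow (UNIV :: 'a set)" by (rule sigma_algebra_Pow)
    have "f (\<Union>i. disjointed A i) \<le> (\<Sum>i. f (disjointed A i))"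
      using oms disjoint_family_disjointed[of A]
      by (auto simp: outer_measure_space_def countably_subadditive_def)
    also have "\<dots> \<le> (\<Sum>i. f (A i))"
      by (intro suminf_le mono disjointed_subset) auto
    finally show ?thesis by (simp add: UN_disjointed_eq)
  qed
  have sub2: "f (A \<union> B) \<le> f A + f B" for A B
  proof -
    have "f (A \<union> B) = f (\<Union>i. if i = (0::nat) then A else if i = 1 then B else {})"
      by (rule arg_cong[where f = f]) (auto split: if_splits)
    also have "\<dots> \<le> (\<Sum>i::nat. f (if i = 0 then A else if i = 1 then B else {}))"
      by (rule csa)
    also have "\<dots> = (\<Sum>i\<in>{0,1::nat}. f (if i = 0 then A else if i = 1 then B else {}))"
      by (rule suminf_finite) (auto simp: empty)
    finally show ?thesis by simp
  qed
  define Xk where "Xk k = {x \<in> X. 1 / real (Suc k) \<le> infdist x C}" for k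
  define R where "R k = Xk (Suc k) - Xk k" for k
  have Xk_mono: "Xk k \<subseteq> Xk (Suc k)" for k
  proof -
    have "1 / real (Suc (Suc k)) \<le> 1 / real (Suc k)" by (intro divide_left_mono) auto
    then show ?thesis unfolding Xk_def by (auto simp del: of_nat_Suc intro: order_trans)
  qed
  have shell: "infdist x C < 1 / real (Suc k)" if "x \<in> R k" for x k
    using that by (auto simp: R_def Xk_def)
  have infdist_diff: "infdist x C \<le> infdist y C + dist x y" for x y
    by (rule infdist_triangle)
  \<comment> \<open>Points of \<open>A\<close> have distance at least 1/(k+1) from \<open>C\<close>,
    points of the shell \<open>R (Suc k)\<close> less than 1/(k+2), and the distance to
    \<open>C\<close> is 1-Lipschitz.\<close>
  have sepR: "f A + f (R (Suc k)) \<le> f (A \<union> R (Suc k))" if "A \<subseteq> Xk k" for A k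
  proof (rule sep)
    show "0 < 1 / real (Suc k) - 1 / real (Suc (Suc k))" by (simp add: divide_strict_left_mono)
    fix x y assume "x \<in> A" "y \<in> R (Suc k)"
    with that have "1 / real (Suc k) \<le> infdist x C" "infdist y C < 1 / real (Suc (Suc k))"
      using shell[of y "Suc k"] by (auto simp: Xk_def)
    with infdist_diff[of x y] show "1 / real (Suc k) - 1 / real (Suc (Suc k)) \<le> dist x y"
      by linarith
  qed
  have Xk_le: "Xk m \<subseteq> Xk n" if "m \<le> n" for m n
    using lift_Suc_mono_le[of Xk, OF Xk_mono that] .
  \<comment> \<open>Shells with indices of the same parity are separated from each other, so each of
    the two classes has total measure at most \<open>f X\<close>.\<close>
  have alt: "(\<Sum>i<n. f (R (2 * i + j))) \<le> f (\<Union>i<n. R (2 * i + j))" for n j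
  proof (induction n)
    case 0 show ?case by simp
  next
    case (Suc n)
    show ?case
    proof (cases "n = 0")
      case True then show ?thesis by (simp add: lessThan_Suc)
    next
      case False
      then obtain m where m: "2 * n + j = Suc m" by (cases "2*n+j") auto
      have "(\<Union>i<n. R (2 * i + j)) \<subseteq> Xk m"
      proof safe
        fix i x assume "i < n" "x \<in> R (2 * i + j)"
        then have "x \<in> Xk (Suc (2 * i + j))" "Suc (2*i+j) \<le> m" using m by (auto simp: R_def)
        then show "x \<in> Xk m" using Xk_le by blast
      qed
      from sepR[OF this] Suc.IH
      have "(\<Sum>i<n. f (R (2 * i + j))) + f (R (2 * n + j)) \<le> f ((\<Union>i<n. R (2 * i + j)) \<union> R (2 * n + j))"
        unfolding m using order_trans[OF add_right_mono] by blast
      then show ?thesis by (simp add: lessThan_Suc Un_commute add.commute)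
    qed
  qed
  have sum_fin: "(\<Sum>k. f (R k)) \<le> f X + f X"
  proof (rule suminf_le_const)
    fix n
    have "(\<Sum>i<n. f (R i)) \<le> (\<Sum>i<2*n. f (R i))"
      by (intro sum_mono2) auto
    also have "\<dots> = (\<Sum>i<n. f (R (2 * i + 0))) + (\<Sum>i<n. f (R (2 * i + 1)))"
      by (induction n) (auto simp: algebra_simps)
    also have "\<dots> \<le> f X + f X"
      by (intro add_mono order_trans[OF alt] mono) (auto simp: R_def Xk_def)
    finally show "(\<Sum>i<n. f (R i)) \<le> f X + f X" .
  qed simp
  have union: "X - C = Xk k \<union> (\<Union>i. R (i + k))" for k
  proof (intro equalityI subsetI)
    fix x assume x: "x \<in> X - C"
    then have "infdist x C > 0"
      using C ne by (metis DiffD2 in_closed_iff_infdist_zero infdist_nonneg order_le_less)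
    then obtain n where "1 / real (Suc n) < infdist x C"
      using nat_approx_posE by blast
    with x have n: "x \<in> Xk n" by (auto simp: Xk_def)
    show "x \<in> Xk k \<union> (\<Union>i. R (i + k))"
    proof (rule ccontr)
      assume a: "x \<notin> Xk k \<union> (\<Union>i. R (i + k))"
      have "x \<notin> Xk (i + k)" for i
        by (induction i) (use a in \<open>auto simp: R_def\<close>)
      then have "x \<notin> Xk (n + k)" .
      with n Xk_le[of n "n + k"] show False by auto
    qed
  next
    fix x assume "x \<in> Xk k \<union> (\<Union>i. R (i + k))"
    then have "\<exists>j. x \<in> Xk j" by (auto simp: R_def)
    then obtain j where "x \<in> X" "1 / real (Suc j) \<le> infdist x C"
      by (auto simp: Xk_def)
    moreover have "0 < 1 / real (Suc j)" by simp
    ultimately show "x \<in> X - C"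
      using infdist_zero[of x C] by fastforce
  qed
  have step: "f (X \<inter> C) + f (X - C) \<le> f X + (\<Sum>i. f (R (i + k)))" for k
  proof -
    have "f (X \<inter> C) + f (Xk k) \<le> f ((X \<inter> C) \<union> Xk k)"
    proof (rule sep)
      show "0 < 1 / real (Suc k)" by simp
      fix x y assume "x \<in> X \<inter> C" "y \<in> Xk k"
      then show "1 / real (Suc k) \<le> dist x y"
        using infdist_diff[of y x] infdist_zero[of x C] by (auto simp: Xk_def dist_commute)
    qed
    also have "\<dots> \<le> f X" by (rule mono) (auto simp: Xk_def)
    finally have 1: "f (X \<inter> C) + f (Xk k) \<le> f X" .
    have "f (X - C) \<le> f (Xk k) + f (\<Union>i. R (i + k))"
      by (subst union[of k]) (rule sub2)
    also have "\<dots> \<le> f (Xk k) + (\<Sum>i. f (R (i + k)))"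
      by (intro add_left_mono csa)
    finally have "f (X \<inter> C) + f (X - C) \<le> f (X \<inter> C) + (f (Xk k) + (\<Sum>i. f (R (i + k))))"
      by (rule add_left_mono)
    also have "\<dots> = (f (X \<inter> C) + f (Xk k)) + (\<Sum>i. f (R (i + k)))" by (simp add: ac_simps)
    finally show ?thesis using 1 add_right_mono order_trans by blast
  qed
  have fin_sum: "(\<Sum>k. f (R k)) < top"
    using sum_fin fin by (simp add: order_le_less_trans)
  have fR: "f (R i) < top" for i
    using fin mono[of "R i" X] by (auto simp: R_def Xk_def intro: order_le_less_trans)
  define g where "g i = enn2real (f (R i))" for i
  have fg: "f (R i) = ennreal (g i)" for i
    using fR[of i] by (simp add: g_def)
  have g0: "0 \<le> g i" for i by (simp add: g_def)
  have summ: "summable g"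
    using fin_sum g0 by (intro summable_suminf_not_top) (auto simp: fg)
  have "(\<lambda>k. \<Sum>i. g (i + k)) \<longlonglongrightarrow> 0"
    by (rule suminf_exist_split2[OF summ])
  then have "(\<lambda>k. ennreal (\<Sum>i. g (i + k))) \<longlonglongrightarrow> ennreal 0"
    by (intro tendsto_ennrealI)
  moreover have "ennreal (\<Sum>i. g (i + k)) = (\<Sum>i. f (R (i + k)))" for k
    unfolding fg by (rule suminf_ennreal2[symmetric]) (use summ g0 in \<open>auto simp: summable_iff_shift\<close>)
  ultimately have "(\<lambda>k. f X + (\<Sum>i. f (R (i + k)))) \<longlonglongrightarrow> f X + 0"
    by (intro tendsto_add tendsto_const) auto
  then show ?thesis
    by (intro LIMSEQ_le_const[where X = "\<lambda>k. f X + (\<Sum>i. f (R (i + k)))"]) (auto intro: step)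
qed

text \<open>The sets that split every set additively form a sigma-algebra on which \<open>f\<close>
  is a measure; it contains the closed sets, hence the Borel sets.\<close>

lemma metric_outer_measure_space:
  fixes f :: "'a::metric_space set \<Rightarrow> ennreal"
  assumes oms: "outer_measure_space (Pow UNIV) f"
    and sep: "\<And>A B d. 0 < d \<Longrightarrow> (\<And>x y. x \<in> A \<Longrightarrow> y \<in> B \<Longrightarrow> d \<le> dist x y) \<Longrightarrow> f A + f B \<le> f (A \<union> B)"
  shows "measure_space UNIV (sets borel) f"
proof -
  interpret sigma_algebra UNIV "Pow (UNIV :: 'a set)" by (rule sigma_algebra_Pow)
  have *: "measure_space UNIV (lambda_system UNIV (Pow UNIV) f) f"
    using caratheodory_lemma[OF oms] .
  then interpret L: sigma_algebra UNIV "lambda_system UNIV (Pow UNIV) f"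
    by (simp add: measure_space_def)
  have sub: "f A \<le> f (A \<inter> C) + f (A - C)" for A C
  proof -
    have "subadditive (Pow UNIV) f"
      using oms countably_subadditive_subadditive unfolding outer_measure_space_def by blast
    from subadditiveD[OF this, of "A \<inter> C" "A - C"] show ?thesis
      by (simp add: Int_Diff_Un Int_Diff_disjoint)
  qed
  have closed: "C \<in> lambda_system UNIV (Pow UNIV) f" if "closed C" for C
  proof -
    have "f (X \<inter> C) + f (X - C) \<le> f X" for X
      by (rule metric_outer_measure_closed[OF oms _ that]) (rule sep)
    then show ?thesis
      unfolding lambda_system_eq using sub by (auto intro!: antisym)
  qed
  have "sets borel = sigma_sets UNIV (Collect closed :: 'a set set)"
    by (subst borel_eq_closed) simp
  also have "\<dots> \<subseteq> lambda_system UNIV (Pow UNIV) f"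
    by (rule L.sigma_sets_subset) (use closed in auto)
  finally show ?thesis
    by (rule measure_down[OF *, rotated]) (use sets.sigma_algebra_axioms[of borel] in simp)
qed


section \<open>Hausdorff measure\<close>

lemma hausdorff_premeasure_le:
  assumes "A \<subseteq> (\<Union>i. U i)" "\<And>i. bounded (U i)" "\<And>i. diameter (U i) \<le> \<delta>"
  shows "hausdorff_premeasure s \<delta> A \<le> (\<Sum>i. ennreal (diameter (U i) powr s))"
  unfolding hausdorff_premeasure_def using assms by (intro INF_lower) auto

lemma hausdorff_premeasure_mono:
  "A \<subseteq> B \<Longrightarrow> hausdorff_premeasure s \<delta> A \<le> hausdorff_premeasure s \<delta> B"
  unfolding hausdorff_premeasure_def by (intro INF_superset_mono) auto

lemma hausdorff_premeasure_antimono: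
  "\<delta> \<le> \<delta>' \<Longrightarrow> hausdorff_premeasure s \<delta>' A \<le> hausdorff_premeasure s \<delta> A"
  unfolding hausdorff_premeasure_def by (intro INF_superset_mono) (auto intro: order_trans)

lemma hausdorff_premeasure_empty: "0 \<le> \<delta> \<Longrightarrow> hausdorff_premeasure s \<delta> {} = 0"
  using hausdorff_premeasure_le[of "{}" "\<lambda>_. {}" \<delta> s] by simp

text \<open>Covers of the \<open>A n\<close> that are optimal up to \<open>e * (1/2) ^ Suc n\<close>
  are merged into one sequence along \<open>prod_decode\<close>.\<close>

lemma hausdorff_premeasure_UN_le:
  fixes A :: "nat \<Rightarrow> 'a::metric_space set"
  shows "hausdorff_premeasure s \<delta> (\<Union>i. A i) \<le> (\<Sum>i. hausdorff_premeasure s \<delta> (A i))"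
proof (rule ennreal_le_epsilon)
  let ?H = "hausdorff_premeasure s \<delta>"
  fix e :: real assume e: "0 < e" and fin: "(\<Sum>n. ?H (A n)) < top"
  then have *: "?H (A n) < ?H (A n) + e * (1/2)^Suc n" for n
    by (auto simp add: less_top dest!: ennreal_suminf_lessD)
  have "\<exists>U. A n \<subseteq> (\<Union>i. U i) \<and> (\<forall>i. bounded (U i) \<and> diameter (U i) \<le> \<delta>) \<and>
      (\<Sum>i. ennreal (diameter (U i) powr s)) \<le> ?H (A n) + e * (1/2)^Suc n" for n
    using *[of n] by (subst (asm) (1) hausdorff_premeasure_def) (auto simp: INF_less_iff intro: less_imp_le)
  then obtain U where U: "\<And>n. A n \<subseteq> (\<Union>i. U n i)" "\<And>n i. bounded (U n i)" "\<And>n i. diameter (U n i) \<le> \<delta>"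
      "\<And>n. (\<Sum>i. ennreal (diameter (U n i) powr s)) \<le> ?H (A n) + e * (1/2)^Suc n"
    by metis
  define V where "V = case_prod U \<circ> prod_decode"
  have "?H (\<Union>i. A i) \<le> (\<Sum>i. ennreal (diameter (V i) powr s))"
  proof (rule hausdorff_premeasure_le)
    show "(\<Union>i. A i) \<subseteq> (\<Union>i. V i)"
      using U(1) by (auto simp add: V_def subset_eq) (metis prod.case prod_encode_inverse)
  qed (auto simp: V_def U split: prod.split)
  also have "\<dots> = (\<Sum>n. \<Sum>i. ennreal (diameter (U n i) powr s))"
  proof -
    have "(\<Sum>i. ennreal (diameter (V i) powr s)) =
        (\<Sum>i. (case_prod (\<lambda>n i. ennreal (diameter (U n i) powr s))) (prod_decode i))"
      by (simp add: V_def split_def)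
    also have "\<dots> = (\<Sum>n. \<Sum>i. ennreal (diameter (U n i) powr s))"
      by (rule suminf_ennreal_2dimen) simp
    finally show ?thesis .
  qed
  also have "\<dots> \<le> (\<Sum>n. ?H (A n) + e * (1/2) ^ Suc n)"
    by (intro suminf_le U) auto
  also have "\<dots> = (\<Sum>n. ?H (A n)) + (\<Sum>n. ennreal e * ennreal ((1/2) ^ Suc n))"
    using \<open>0 < e\<close> by (subst suminf_add[symmetric])
                     (auto simp del: ennreal_suminf_cmult simp add: ennreal_mult[symmetric])
  also have "\<dots> = (\<Sum>n. ?H (A n)) + e"
    unfolding ennreal_suminf_cmult
    by (subst suminf_ennreal_eq[OF zero_le_power power_half_series]) auto
  finally show "?H (\<Union>i. A i) \<le> (\<Sum>n. ?H (A n)) + e" .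
qed

text \<open>A set of diameter below \<open>d\<close> cannot meet both \<open>A\<close> and
  \<open>B\<close>, so every cover splits into a cover of \<open>A\<close> and one of
  \<open>B\<close> with disjoint index sets.\<close>

lemma hausdorff_premeasure_separated:
  fixes A B :: "'a::metric_space set"
  assumes s: "0 < s" and d: "0 \<le> \<delta>" "\<delta> < d" and sep: "\<And>x y. x \<in> A \<Longrightarrow> y \<in> B \<Longrightarrow> d \<le> dist x y"
  shows "hausdorff_premeasure s \<delta> A + hausdorff_premeasure s \<delta> B \<le> hausdorff_premeasure s \<delta> (A \<union> B)"
proof -
  have "hausdorff_premeasure s \<delta> A + hausdorff_premeasure s \<delta> B \<le> (\<Sum>i. ennreal (diameter (U i) powr s))"
    if U: "A \<union> B \<subseteq> (\<Union>i. U i)" "\<forall>i. bounded (U i) \<and> diameter (U i) \<le> \<delta>" for U :: "nat \<Rightarrow> 'a set"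
  proof -
    define UA where "UA i = (if U i \<inter> A = {} then {} else U i)" for i
    define UB where "UB i = (if U i \<inter> B = {} then {} else U i)" for i
    have "hausdorff_premeasure s \<delta> A \<le> (\<Sum>i. ennreal (diameter (UA i) powr s))"
      using U d by (intro hausdorff_premeasure_le) (auto simp: UA_def, blast)
    moreover have "hausdorff_premeasure s \<delta> B \<le> (\<Sum>i. ennreal (diameter (UB i) powr s))"
      using U d by (intro hausdorff_premeasure_le) (auto simp: UB_def, blast)
    ultimately have "hausdorff_premeasure s \<delta> A + hausdorff_premeasure s \<delta> B \<le>
        (\<Sum>i. ennreal (diameter (UA i) powr s)) + (\<Sum>i. ennreal (diameter (UB i) powr s))"
      by (rule add_mono)
    also have "\<dots> = (\<Sum>i. ennreal (diameter (UA i) powr s) + ennreal (diameter (UB i) powr s))"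
      by (rule suminf_add) auto
    also have "\<dots> \<le> (\<Sum>i. ennreal (diameter (U i) powr s))"
    proof (intro suminf_le)
      fix i
      have disj: "UA i = {} \<or> UB i = {}"
      proof (rule ccontr)
        assume "\<not> (UA i = {} \<or> UB i = {})"
        then obtain x y where xy: "x \<in> U i" "x \<in> A" "y \<in> U i" "y \<in> B"
          by (auto simp: UA_def UB_def split: if_splits)
        with diameter_bounded_bound[of "U i" x y] U(2)[rule_format, of i] sep[of x y] d show False by auto
      qed
      then show "ennreal (diameter (UA i) powr s) + ennreal (diameter (UB i) powr s) \<le> ennreal (diameter (U i) powr s)"
        using s by (cases "UA i = {}"; cases "UB i = {}") (auto simp: UA_def UB_def split: if_splits)
    qed auto
    finally show ?thesis .
  qed
  then show ?thesis
    by (subst (3) hausdorff_premeasure_def) (auto intro!: INF_greatest)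
qed

lemma hausdorff_premeasure_le_outer:
  "0 < \<delta> \<Longrightarrow> hausdorff_premeasure s \<delta> A \<le> hausdorff_outer_measure s A"
  unfolding hausdorff_outer_measure_def by (rule SUP_upper) auto

lemma outer_measure_space_hausdorff:
  "outer_measure_space (Pow UNIV) (hausdorff_outer_measure s :: 'a::metric_space set \<Rightarrow> ennreal)"
  unfolding outer_measure_space_def
proof (intro conjI)
  show "positive (Pow UNIV) (hausdorff_outer_measure s :: 'a set \<Rightarrow> ennreal)"
    by (auto simp: positive_def hausdorff_outer_measure_def hausdorff_premeasure_empty)
  show "increasing (Pow UNIV) (hausdorff_outer_measure s :: 'a set \<Rightarrow> ennreal)"
    by (auto simp: increasing_def hausdorff_outer_measure_def intro!: SUP_mono hausdorff_premeasure_mono)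
  have "hausdorff_outer_measure s (\<Union>i. A i) \<le> (\<Sum>i. hausdorff_outer_measure s (A i))"
    for A :: "nat \<Rightarrow> 'a set"
  proof (subst hausdorff_outer_measure_def, rule SUP_least)
    fix \<delta> :: real assume "\<delta> \<in> {0<..}"
    then have "(\<Sum>i. hausdorff_premeasure s \<delta> (A i)) \<le> (\<Sum>i. hausdorff_outer_measure s (A i))"
      by (intro suminf_le hausdorff_premeasure_le_outer) auto
    then show "hausdorff_premeasure s \<delta> (\<Union>i. A i) \<le> (\<Sum>i. hausdorff_outer_measure s (A i))"
      using hausdorff_premeasure_UN_le order_trans by blast
  qed
  then show "countably_subadditive (Pow UNIV) (hausdorff_outer_measure s :: 'a set \<Rightarrow> ennreal)"
    by (auto simp: countably_subadditive_def)
qed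

text \<open>The two measures are suprema over unrelated scales; both scales are first lowered to a
  common one below \<open>d\<close>.\<close>

lemma hausdorff_outer_measure_separated:
  fixes A B :: "'a::metric_space set"
  assumes s: "0 < s" and d: "0 < d" and sep: "\<And>x y. x \<in> A \<Longrightarrow> y \<in> B \<Longrightarrow> d \<le> dist x y"
  shows "hausdorff_outer_measure s A + hausdorff_outer_measure s B \<le> hausdorff_outer_measure s (A \<union> B)"
proof -
  let ?H = "hausdorff_premeasure s" and ?O = "hausdorff_outer_measure s"
  have "?H \<delta> A + ?H \<delta>' B \<le> ?O (A \<union> B)" if "0 < \<delta>" "0 < \<delta>'" for \<delta> \<delta>'
  proof -
    define \<epsilon> where "\<epsilon> = min (d / 2) (min \<delta> \<delta>')"
    have \<epsilon>: "0 < \<epsilon>" "\<epsilon> < d" "\<epsilon> \<le> \<delta>" "\<epsilon> \<le> \<delta>'" using that d by (auto simp: \<epsilon>_def)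
    have "?H \<delta> A + ?H \<delta>' B \<le> ?H \<epsilon> A + ?H \<epsilon> B"
      using \<epsilon> by (intro add_mono hausdorff_premeasure_antimono)
    also have "\<dots> \<le> ?H \<epsilon> (A \<union> B)"
      using \<epsilon> s sep by (intro hausdorff_premeasure_separated[where d = d]) auto
    also have "\<dots> \<le> ?O (A \<union> B)" using \<epsilon> by (intro hausdorff_premeasure_le_outer)
    finally show ?thesis .
  qed
  then have "(SUP \<delta>\<in>{0<..}. ?H \<delta> A + ?H \<delta>' B) \<le> ?O (A \<union> B)" if "0 < \<delta>'" for \<delta>'
    using that by (intro SUP_least) auto
  then have "?O A + ?H \<delta>' B \<le> ?O (A \<union> B)" if "0 < \<delta>'" for \<delta>'
    using that unfolding hausdorff_outer_measure_def[of s A]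
    by (subst (asm) ennreal_SUP_add_left) auto
  then have "(SUP \<delta>'\<in>{0<..}. ?O A + ?H \<delta>' B) \<le> ?O (A \<union> B)"
    by (intro SUP_least) auto
  then show ?thesis
    unfolding hausdorff_outer_measure_def[of s B]
    by (simp add: ennreal_SUP_add_right)
qed

text \<open>Rules out the fallback of \<open>measure_of\<close> to the zero measure.\<close>

lemma emeasure_hausdorff:
  assumes "0 < s" "A \<in> sets borel"
  shows "emeasure (hausdorff_measure s) A = hausdorff_outer_measure s A"
proof -
  have "measure_space UNIV (sets borel) (hausdorff_outer_measure s :: 'a set \<Rightarrow> ennreal)"
    by (rule metric_outer_measure_space[OF outer_measure_space_hausdorff
        hausdorff_outer_measure_separated[OF \<open>0 < s\<close>]])
  then show ?thesis
    using assms(2) sets.sigma_sets_eq[of "borel :: 'a measure"]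
    unfolding hausdorff_measure_def
    by (intro emeasure_measure_of_sigma) (auto simp: measure_space_def)
qed

lemma sets_hausdorff_measure [simp, measurable_cong]: "sets (hausdorff_measure s) = sets borel"
  unfolding hausdorff_measure_def using sets.sigma_sets_eq[of "borel :: 'a measure"] by simp

section \<open>Hausdorff measure under Lipschitz maps\<close>

lemma diameter_image_le:
  fixes f :: "'a::metric_space \<Rightarrow> 'b::metric_space"
  assumes "bounded U" "0 \<le> r" "\<And>x y. x \<in> U \<Longrightarrow> y \<in> U \<Longrightarrow> dist (f x) (f y) \<le> r * dist x y"
  shows "bounded (f ` U)" "diameter (f ` U) \<le> r * diameter U"
proof -
  have *: "dist (f x) (f y) \<le> r * diameter U" if "x \<in> U" "y \<in> U" for x y
    using assms(3)[OF that] diameter_bounded_bound[OF assms(1) that] \<open>0 \<le> r\<close>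
    by (meson mult_left_mono order_trans)
  show "diameter (f ` U) \<le> r * diameter U"
    unfolding diameter_def[of "f ` U"]
    using * assms(2) diameter_ge_0[OF assms(1)] by (auto intro!: cSUP_least)
  show "bounded (f ` U)"
  proof (cases "U = {}")
    case False
    then obtain x where "x \<in> U" by auto
    with * show ?thesis unfolding bounded_any_center[of _ "f x"] bounded_def
      by (metis (no_types, lifting) imageE)
  qed auto
qed

lemma hausdorff_outer_measure_lipschitz:
  fixes f :: "'a::metric_space \<Rightarrow> 'b::metric_space"
  assumes s: "0 < s" and r: "0 < r" and lip: "\<And>x y. dist (f x) (f y) \<le> r * dist x y"
  shows "hausdorff_outer_measure s (f ` A) \<le> ennreal (r powr s) * hausdorff_outer_measure s A"
proof (subst hausdorff_outer_measure_def, rule SUP_least)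
  fix \<delta> :: real assume "\<delta> \<in> {0<..}"
  then have \<delta>: "0 < \<delta> / r" using r by auto
  have "hausdorff_premeasure s \<delta> (f ` A) \<le> ennreal (r powr s) * (\<Sum>i. ennreal (diameter (U i) powr s))"
    if U: "A \<subseteq> (\<Union>i. U i)" "\<forall>i. bounded (U i) \<and> diameter (U i) \<le> \<delta> / r" for U
  proof -
    have f: "bounded (f ` U i)" "diameter (f ` U i) \<le> r * diameter (U i)" for i
      using diameter_image_le[of "U i" r f] U r lip by auto
    have "hausdorff_premeasure s \<delta> (f ` A) \<le> (\<Sum>i. ennreal (diameter (f ` U i) powr s))"
    proof (rule hausdorff_premeasure_le)
      show "f ` A \<subseteq> (\<Union>i. f ` U i)" using U(1) by blast
      show "diameter (f ` U i) \<le> \<delta>" for i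
        using f(2)[of i] U(2) r by (auto simp: field_simps intro: order_trans)
    qed (use f in auto)
    also have "\<dots> \<le> (\<Sum>i. ennreal (r powr s) * ennreal (diameter (U i) powr s))"
    proof (intro suminf_le)
      fix i
      have "diameter (f ` U i) powr s \<le> (r * diameter (U i)) powr s"
        using f[of i] s by (intro powr_mono2) (auto intro: diameter_ge_0)
      also have "\<dots> = r powr s * diameter (U i) powr s"
        by (rule powr_mult)
      finally show "ennreal (diameter (f ` U i) powr s) \<le> ennreal (r powr s) * ennreal (diameter (U i) powr s)"
        by (simp add: ennreal_mult[symmetric] ennreal_leI)
    qed auto
    finally show ?thesis by simp
  qed
  note * = this
  have rr: "ennreal (r powr - s) * (ennreal (r powr s) * x) = x" "ennreal (r powr s) * (ennreal (r powr - s) * x) = x" for x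
    using r by (simp_all add: mult.assoc[symmetric] ennreal_mult[symmetric] powr_add[symmetric])
  \<comment> \<open>Multiplying by the inverse constant leaves the bare premeasure on the right,
    whose infimum can then be tested cover by cover.\<close>
  have "ennreal (r powr - s) * hausdorff_premeasure s \<delta> (f ` A) \<le> hausdorff_premeasure s (\<delta> / r) A"
    unfolding hausdorff_premeasure_def[of s "\<delta> / r"]
  proof (rule INF_greatest, clarify)
    fix U :: "nat \<Rightarrow> 'a set"
    assume U: "A \<subseteq> (\<Union>i. U i)" "\<forall>i. bounded (U i) \<and> diameter (U i) \<le> \<delta> / r"
    have "ennreal (r powr - s) * hausdorff_premeasure s \<delta> (f ` A) \<le>
        ennreal (r powr - s) * (ennreal (r powr s) * (\<Sum>i. ennreal (diameter (U i) powr s)))"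
      by (intro mult_left_mono * U) auto
    then show "ennreal (r powr - s) * hausdorff_premeasure s \<delta> (f ` A) \<le> (\<Sum>i. ennreal (diameter (U i) powr s))"
      unfolding rr .
  qed
  from mult_left_mono[OF this, of "ennreal (r powr s)"]
  have "hausdorff_premeasure s \<delta> (f ` A) \<le> ennreal (r powr s) * hausdorff_premeasure s (\<delta> / r) A"
    unfolding rr by simp
  also have "\<dots> \<le> ennreal (r powr s) * hausdorff_outer_measure s A"
    using \<delta> by (intro mult_left_mono hausdorff_premeasure_le_outer) auto
  finally show "hausdorff_premeasure s \<delta> (f ` A) \<le> ennreal (r powr s) * hausdorff_outer_measure s A" .
qed


section \<open>Cells of the carpet\<close>

definition carpet_digits :: "(nat \<times> nat) set" where
  "carpet_digits = {..<3} \<times> {..<3} - {(1, 1)}"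

text \<open>The level-\<open>n\<close> cells are indexed by the integer coordinates of their lower left corners, in
  units of \<open>3\<^sup>-\<^sup>n\<close>.\<close>

fun carpet_index :: "nat \<Rightarrow> (nat \<times> nat) set" where
  "carpet_index 0 = {(0, 0)}"
| "carpet_index (Suc n) =
     (\<lambda>((a, b), (d, e)). (3 * a + d, 3 * b + e)) ` (carpet_index n \<times> carpet_digits)"

definition cell_map :: "nat \<Rightarrow> nat \<times> nat \<Rightarrow> real \<times> real \<Rightarrow> real \<times> real" where
  "cell_map n c x = ((fst x + real (fst c)) / 3 ^ n, (snd x + real (snd c)) / 3 ^ n)"

lemma finite_carpet_digits [simp]: "finite carpet_digits"
  by (simp add: carpet_digits_def)

lemma carpet_digits_eq:
  "carpet_digits = {(0,0), (1,0), (2,0), (2,1), (2,2), (1,2), (0,2), (0,1)}"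
  by (auto simp: carpet_digits_def lessThan_nat_numeral lessThan_Suc eval_nat_numeral)

lemma finite_carpet_index [simp]: "finite (carpet_index n)"
  by (induction n) auto

lemma inj_on_append_digit:
  "inj_on (\<lambda>((a, b), (d, e)). (3 * a + d, 3 * b + e)) (X \<times> carpet_digits)"
  (is "inj_on ?f _")
proof (rule inj_onI)
  have *: "a = a' \<and> b = b' \<and> d = d' \<and> e = e'"
    if "(d, e) \<in> carpet_digits" "(d', e') \<in> carpet_digits"
      "3 * a + d = 3 * a' + d'" "3 * b + e = 3 * b' + e'" for a b d e a' b' d' e' :: nat
  proof -
    have "d < 3" "e < 3" "d' < 3" "e' < 3" using that by (auto simp: carpet_digits_def)
    then have "(3 * a + d) div 3 = a" "(3 * a + d) mod 3 = d" "(3 * a' + d') div 3 = a'" "(3 * a' + d') mod 3 = d'"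
      "(3 * b + e) div 3 = b" "(3 * b + e) mod 3 = e" "(3 * b' + e') div 3 = b'" "(3 * b' + e') mod 3 = e'"
      by simp_all
    with that(3,4) show ?thesis by metis
  qed
  fix p q :: "(nat \<times> nat) \<times> (nat \<times> nat)"
  assume a: "p \<in> X \<times> carpet_digits" "q \<in> X \<times> carpet_digits"
    "?f p = ?f q"
  obtain a b d e a' b' d' e' where pq: "p = ((a, b), (d, e))" "q = ((a', b'), (d', e'))"
    by (metis surj_pair)
  show "p = q"
    using a *[of d e d' e' a a' b b'] by (simp add: pq)
qed

lemma sum_carpet_index_Suc:
  "(\<Sum>c\<in>carpet_index (Suc n). f c) =
     (\<Sum>(a, b)\<in>carpet_index n. \<Sum>(d, e)\<in>carpet_digits. f (3 * a + d, 3 * b + e))"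
proof -
  have "(\<Sum>c\<in>carpet_index (Suc n). f c) =
      (\<Sum>((a, b), (d, e))\<in>carpet_index n \<times> carpet_digits. f (3 * a + d, 3 * b + e))"
    by (simp add: sum.reindex[OF inj_on_append_digit] split_def o_def del: carpet_index.simps)
       (simp add: sum.reindex[OF inj_on_append_digit, unfolded split_def] split_def o_def)
  then show ?thesis by (simp add: sum.cartesian_product split_def)
qed

lemma card_carpet_index: "card (carpet_index n) = 8 ^ n"
proof (induction n)
  case (Suc n)
  then show ?case
    by (simp add: card_image[OF inj_on_append_digit] card_cartesian_product)
       (simp add: carpet_digits_eq)
qed simp

text \<open>Composing with a level-one map appends one ternary digit to each coordinate.\<close>

lemma cell_map_Suc:
  "cell_map n (a, b) (cell_map (Suc 0) (d, e) x) = cell_map (Suc n) (3 * a + d, 3 * b + e) x"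
  by (simp add: cell_map_def field_simps)

lemma dist_cell_map: "dist (cell_map n c x) (cell_map n c y) = dist x y / 3 ^ n"
proof -
  have "dist (cell_map n c x) (cell_map n c y) = norm (inverse (3 ^ n) *\<^sub>R (x - y))"
    by (simp add: dist_norm cell_map_def prod_eq_iff field_simps minus_prod_def)
       (simp add: diff_divide_distrib add_divide_distrib)
  then show ?thesis by (simp add: dist_norm divide_inverse)
qed

lemma inj_cell_map: "inj (cell_map n c)"
  by (rule injI) (metis dist_cell_map dist_eq_0_iff divide_eq_0_iff power_not_zero zero_neq_numeral)

lemma continuous_on_cell_map [continuous_intros]: "continuous_on S (cell_map n c)"
  unfolding cell_map_def by (intro continuous_intros) auto

text \<open>The points \<open>2 *\<^sub>R carpet_point i\<close> run counterclockwise through the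
  eight digit pairs.\<close>

lemma UN_carpet_map:
  "(\<Union>i\<in>{0..7}. carpet_map i ` A) = (\<Union>d\<in>carpet_digits. cell_map (Suc 0) d ` A)"
proof -
  have "{0..7::nat} = {0, 1, 2, 3, 4, 5, 6, 7}" by auto
  moreover have "carpet_map 0 = cell_map (Suc 0) (0,0)" "carpet_map 1 = cell_map (Suc 0) (1,0)"
    "carpet_map 2 = cell_map (Suc 0) (2,0)" "carpet_map 3 = cell_map (Suc 0) (2,1)"
    "carpet_map 4 = cell_map (Suc 0) (2,2)" "carpet_map 5 = cell_map (Suc 0) (1,2)"
    "carpet_map 6 = cell_map (Suc 0) (0,2)" "carpet_map 7 = cell_map (Suc 0) (0,1)"
    by (auto simp: fun_eq_iff carpet_map_def carpet_point_def cell_map_def scaleR_prod_def plus_prod_def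
        field_simps eval_nat_numeral)
  ultimately show ?thesis
    unfolding carpet_digits_eq by (simp only: UN_insert UN_empty)
qed


section \<open>Existence and uniqueness of the carpet\<close>

definition carpet_invariant :: "(real \<times> real) set \<Rightarrow> bool" where
  "carpet_invariant K \<longleftrightarrow> K \<noteq> {} \<and> compact K \<and> K = (\<Union>d\<in>carpet_digits. cell_map (Suc 0) d ` K)"

lemma invariant_UN_cells:
  assumes "K = (\<Union>d\<in>carpet_digits. cell_map (Suc 0) d ` K)"
  shows "K = (\<Union>c\<in>carpet_index n. cell_map n c ` K)"
proof (induction n)
  case (Suc n)
  have "K = (\<Union>c\<in>carpet_index n. cell_map n c ` (\<Union>d\<in>carpet_digits. cell_map (Suc 0) d ` K))"
    using Suc.IH assms by simp
  also have "\<dots> = (\<Union>c\<in>carpet_index (Suc n). cell_map (Suc n) c ` K)"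
    by (auto simp: image_UN image_image cell_map_Suc split: prod.splits; force simp: cell_map_Suc)
  finally show ?case .
qed (simp add: cell_map_def)

text \<open>A point of \<open>K\<close> in the cell \<open>c\<close> of level \<open>n\<close> is
  within \<open>B / 3 ^ n\<close> of the copy of \<open>L\<close> in the same cell, and that copy
  lies in \<open>L\<close>. Exchanging the roles gives uniqueness of the carpet.\<close>

lemma carpet_invariant_subset:
  assumes K: "carpet_invariant K" and L: "carpet_invariant L"
  shows "K \<subseteq> L"
proof
  fix x assume x: "x \<in> K"
  have "bounded (K \<union> L)" using K L by (auto simp: carpet_invariant_def compact_imp_bounded)
  then obtain B where B: "\<And>y z. y \<in> K \<Longrightarrow> z \<in> L \<Longrightarrow> dist y z \<le> B"
    by (metis UnI1 UnI2 bounded_two_points)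
  obtain z where z: "z \<in> L" using L by (auto simp: carpet_invariant_def)
  have le: "infdist x L \<le> B / 3 ^ n" for n
  proof -
    from x invariant_UN_cells[of K n] K obtain c y where c: "c \<in> carpet_index n" "y \<in> K" "x = cell_map n c y"
      unfolding carpet_invariant_def by (metis (no_types, lifting) UN_E imageE)
    have "cell_map n c z \<in> L"
      using invariant_UN_cells[of L n] L c(1) z by (auto simp: carpet_invariant_def)
    then have "infdist x L \<le> dist x (cell_map n c z)" by (rule infdist_le)
    also have "\<dots> = dist y z / 3 ^ n" by (simp add: c dist_cell_map)
    also have "\<dots> \<le> B / 3 ^ n" using B c z by (intro divide_right_mono) auto
    finally show ?thesis .
  qed
  have "(\<lambda>n. B * (1/3) ^ n) \<longlonglongrightarrow> B * 0"
    by (intro tendsto_intros LIMSEQ_power_zero) auto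
  then have "infdist x L \<le> 0"
    using le by (intro LIMSEQ_le_const[where X = "\<lambda>n. B * (1/3) ^ n"]) (auto simp: power_divide)
  then have "infdist x L = 0" using infdist_nonneg[of x L] by linarith
  then show "x \<in> L"
    using L in_closed_iff_infdist_zero[of L x] by (auto simp: carpet_invariant_def compact_imp_closed)
qed

text \<open>The unit square is mapped into itself, so the iterates of \<open>T\<close> decrease to
  \<open>K\<close>. That \<open>K\<close> lies in \<open>T K\<close> rests on the cell maps being
  injective and finite in number: a point missed by all images of \<open>K\<close> is missed at one
  common stage.\<close>

lemma ex_carpet_invariant: "\<exists>K. carpet_invariant K \<and> K \<subseteq> cbox (0, 0) (1, 1)"
proof -
  define T where "T A = (\<Union>d\<in>carpet_digits. cell_map (Suc 0) d ` A)" for A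
  define Q where "Q n = (T ^^ n) (cbox (0, 0) (1, 1))" for n
  have mono: "A \<subseteq> B \<Longrightarrow> T A \<subseteq> T B" for A B by (auto simp: T_def)
  have Q0: "T (cbox (0, 0) (1, 1)) \<subseteq> cbox (0, 0) (1, 1)"
    by (auto simp: T_def cell_map_def cbox_Pair_eq carpet_digits_def)
  have QS: "Q (Suc n) = T (Q n)" for n by (simp add: Q_def)
  have dec1: "Q (Suc n) \<subseteq> Q n" for n
    by (induction n) (use Q0 mono in \<open>auto simp: Q_def\<close>)
  have dec: "Q n \<subseteq> Q m" if "m \<le> n" for m n
    using decseqD[OF decseq_SucI[of Q, OF dec1] that] .
  have cpt: "compact (Q n) \<and> Q n \<noteq> {}" for n
  proof (induction n)
    case 0 show ?case using compact_cbox[of "(0, 0) :: real \<times> real"] by (simp add: Q_def) (simp add: cbox_Pair_eq)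
  next
    case (Suc n)
    then show ?case
      by (auto simp: QS T_def carpet_digits_eq intro!: compact_continuous_image compact_Un continuous_on_cell_map)
  qed
  define K where "K = (\<Inter>n. Q n)"
  have "K \<noteq> {}" unfolding K_def
    using cpt dec by (intro compact_nest) auto
  moreover have "compact K"
    unfolding K_def using cpt by (intro compact_Inter) auto
  moreover have "K = T K"
  proof
    show "T K \<subseteq> K"
    proof (unfold K_def, rule INT_greatest)
      fix n
      have "T (\<Inter>n. Q n) \<subseteq> T (Q n)" by (rule mono) auto
      then show "T (\<Inter>n. Q n) \<subseteq> Q n" using dec1[of n] by (auto simp: QS)
    qed
    show "K \<subseteq> T K"
    proof
      fix x assume x: "x \<in> K"
      show "x \<in> T K"
      proof (rule ccontr)
        assume "x \<notin> T K"
        then have "\<forall>d\<in>carpet_digits. \<exists>n. x \<notin> cell_map (Suc 0) d ` Q n"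
          unfolding T_def K_def by (auto simp: image_INT[OF inj_on_subset[OF inj_cell_map subset_UNIV]] 
              image_INT[OF inj_cell_map])
        then obtain N where N: "\<And>d. d \<in> carpet_digits \<Longrightarrow> x \<notin> cell_map (Suc 0) d ` Q (N d)" by metis
        define m where "m = Max (N ` carpet_digits)"
        have "x \<notin> cell_map (Suc 0) d ` Q m" if "d \<in> carpet_digits" for d
          using N[OF that] dec[of "N d" m] that by (auto simp: m_def)
        then have "x \<notin> Q (Suc m)" by (auto simp: QS T_def)
        with x show False by (auto simp: K_def)
      qed
    qed
  qed
  moreover have "K \<subseteq> cbox (0, 0) (1, 1)"
    unfolding K_def using Q_def[of 0] by auto
  ultimately show ?thesis by (auto simp: carpet_invariant_def T_def)
qed

lemma carpet_invariant_carpet: "carpet_invariant sierpinski_carpet"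
  and carpet_subset_unit_square: "sierpinski_carpet \<subseteq> cbox (0, 0) (1, 1)"
proof -
  obtain K where K: "carpet_invariant K" "K \<subseteq> cbox (0, 0) (1, 1)" using ex_carpet_invariant by blast
  have "sierpinski_carpet = (THE K. carpet_invariant K)"
    by (simp add: sierpinski_carpet_def carpet_invariant_def UN_carpet_map)
  also have "\<dots> = K"
    using K carpet_invariant_subset by (intro the_equality) (auto intro: antisym)
  finally show "carpet_invariant sierpinski_carpet" "sierpinski_carpet \<subseteq> cbox (0, 0) (1, 1)"
    using K by auto
qed

lemma compact_carpet: "compact sierpinski_carpet"
  and carpet_nonempty: "sierpinski_carpet \<noteq> {}"
  using carpet_invariant_carpet by (auto simp: carpet_invariant_def)

lemma carpet_borel [measurable]: "sierpinski_carpet \<in> sets borel"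
  using compact_carpet by (simp add: compact_imp_closed borel_closed)

lemma carpet_coord_bounds:
  assumes "x \<in> sierpinski_carpet"
  shows "0 \<le> fst x" "fst x \<le> 1" "0 \<le> snd x" "snd x \<le> 1"
  using assms carpet_subset_unit_square by (auto simp: cbox_Pair_eq mem_Times_iff)

section \<open>Cells as subsets of the carpet\<close>

definition carpet_cell :: "nat \<Rightarrow> nat \<times> nat \<Rightarrow> (real \<times> real) set" where
  "carpet_cell n c = cell_map n c ` sierpinski_carpet"

lemma UN_carpet_cells: "(\<Union>c\<in>carpet_index n. carpet_cell n c) = sierpinski_carpet"
  using invariant_UN_cells[of sierpinski_carpet n] carpet_invariant_carpet
  by (auto simp: carpet_invariant_def carpet_cell_def)

lemma carpet_cell_subset: "c \<in> carpet_index n \<Longrightarrow> carpet_cell n c \<subseteq> sierpinski_carpet"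
  using UN_carpet_cells by blast

lemma compact_carpet_cell: "compact (carpet_cell n c)"
  unfolding carpet_cell_def by (intro compact_continuous_image continuous_on_cell_map compact_carpet)

lemma carpet_cell_borel [measurable]: "carpet_cell n c \<in> sets borel"
  by (simp add: compact_carpet_cell compact_imp_closed borel_closed)

lemma carpet_cell_Suc_subset:
  assumes "(d, e) \<in> carpet_digits"
  shows "carpet_cell (Suc n) (3 * a + d, 3 * b + e) \<subseteq> carpet_cell n (a, b)"
proof -
  have "(d, e) \<in> carpet_index (Suc 0)" using assms by force
  then have "carpet_cell (Suc 0) (d, e) \<subseteq> sierpinski_carpet" by (rule carpet_cell_subset)
  then have "cell_map n (a, b) ` carpet_cell (Suc 0) (d, e) \<subseteq> carpet_cell n (a, b)"
    unfolding carpet_cell_def[of n] by (rule image_mono)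
  then show ?thesis by (simp add: carpet_cell_def image_image cell_map_Suc)
qed

lemma carpet_cell_coord:
  assumes "x \<in> carpet_cell n c"
  shows "real (fst c) \<le> 3 ^ n * fst x" "3 ^ n * fst x \<le> real (fst c) + 1"
    "real (snd c) \<le> 3 ^ n * snd x" "3 ^ n * snd x \<le> real (snd c) + 1"
  using assms carpet_coord_bounds by (auto simp: carpet_cell_def cell_map_def)

lemma dist_le_sum_coords: "dist x y \<le> \<bar>fst x - fst y\<bar> + \<bar>snd x - snd y\<bar>" for x y :: "real \<times> real"
  unfolding dist_prod_def using sqrt_sum_squares_le_sum_abs[of "dist (fst x) (fst y)" "dist (snd x) (snd y)"]
  by (simp add: dist_real_def)

text \<open>Distances are estimated by coordinate sums throughout, whence 2 rather than the length
  of the diagonal.\<close>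

lemma dist_carpet_le: "x \<in> sierpinski_carpet \<Longrightarrow> y \<in> sierpinski_carpet \<Longrightarrow> dist x y \<le> 2"
  using dist_le_sum_coords[of x y] carpet_coord_bounds[of x] carpet_coord_bounds[of y] by linarith

lemma dist_carpet_cell_le: "x \<in> carpet_cell n c \<Longrightarrow> y \<in> carpet_cell n c \<Longrightarrow> dist x y \<le> 2 / 3 ^ n"
  by (auto simp: carpet_cell_def dist_cell_map intro!: divide_right_mono dist_carpet_le)


section \<open>The Hausdorff measure of the carpet\<close>

lemma carpet_dim_pos: "0 < carpet_dim"
  by (simp add: carpet_dim_def)

lemma three_powr_carpet_dim: "3 powr carpet_dim = 8"
  by (simp add: carpet_dim_def powr_def)

lemma power_three_powr_carpet_dim: "(3 ^ n) powr carpet_dim = 8 ^ n"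
proof -
  have "(3 ^ n :: real) powr carpet_dim = (3 powr carpet_dim) powr real n"
    by (simp add: powr_realpow[symmetric] powr_powr mult.commute)
  then show ?thesis by (simp add: three_powr_carpet_dim powr_realpow)
qed

lemma inverse_power_three_powr_carpet_dim: "(1 / 3 ^ n) powr carpet_dim = 1 / 8 ^ n"
  by (simp add: powr_divide power_three_powr_carpet_dim)

text \<open>The dimension is chosen so that \<open>(3 ^ n) powr carpet_dim = 8 ^ n\<close>; the
  Lipschitz bound is applied to the similarity and to its inverse \<open>g\<close>.\<close>

lemma hausdorff_carpet_cell:
  "hausdorff_outer_measure carpet_dim (carpet_cell n c) =
     ennreal (1 / 8 ^ n) * hausdorff_outer_measure carpet_dim sierpinski_carpet"
proof (rule antisym)
  show "hausdorff_outer_measure carpet_dim (carpet_cell n c) \<le>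
     ennreal (1 / 8 ^ n) * hausdorff_outer_measure carpet_dim sierpinski_carpet"
    using hausdorff_outer_measure_lipschitz[OF carpet_dim_pos, of "1 / 3 ^ n" "cell_map n c" sierpinski_carpet]
    by (simp add: dist_cell_map carpet_cell_def inverse_power_three_powr_carpet_dim)
  define g :: "real \<times> real \<Rightarrow> real \<times> real"
    where "g x = (3 ^ n * fst x - real (fst c), 3 ^ n * snd x - real (snd c))" for x
  have g: "g (cell_map n c x) = x" "cell_map n c (g x) = x" for x
    by (auto simp: g_def cell_map_def)
  have "dist (g x) (g y) = 3 ^ n * dist x y" for x y
    using dist_cell_map[of n c "g x" "g y"] by (simp add: g)
  then have "hausdorff_outer_measure carpet_dim (g ` carpet_cell n c) \<le>
      ennreal (8 ^ n) * hausdorff_outer_measure carpet_dim (carpet_cell n c)"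
    using hausdorff_outer_measure_lipschitz[OF carpet_dim_pos, of "3 ^ n" g "carpet_cell n c"]
    by (simp add: power_three_powr_carpet_dim)
  moreover have "g ` carpet_cell n c = sierpinski_carpet"
    by (simp add: carpet_cell_def image_image g)
  ultimately have "ennreal (1 / 8 ^ n) * hausdorff_outer_measure carpet_dim sierpinski_carpet \<le>
      ennreal (1 / 8 ^ n) * (ennreal (8 ^ n) * hausdorff_outer_measure carpet_dim (carpet_cell n c))"
    by (intro mult_left_mono) auto
  also have "\<dots> = hausdorff_outer_measure carpet_dim (carpet_cell n c)"
    by (simp add: mult.assoc[symmetric] ennreal_mult[symmetric])
  finally show "ennreal (1 / 8 ^ n) * hausdorff_outer_measure carpet_dim sierpinski_carpet \<le>
      hausdorff_outer_measure carpet_dim (carpet_cell n c)" .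
qed

text \<open>The \<open>8 ^ n\<close> cells of level \<open>n\<close> have diameter at most
  \<open>2 / 3 ^ n\<close>, so this cover costs at most \<open>2 powr carpet_dim\<close> at every
  level.\<close>

lemma hausdorff_carpet_finite: "hausdorff_outer_measure carpet_dim sierpinski_carpet < \<infinity>"
proof -
  have "hausdorff_premeasure carpet_dim \<delta> sierpinski_carpet \<le> ennreal (2 powr carpet_dim)" if "0 < \<delta>" for \<delta>
  proof -
    obtain n where n: "(1 / 3) ^ n < \<delta> / 2"
      using real_arch_pow_inv[of "\<delta> / 2" "1 / 3"] \<open>0 < \<delta>\<close> by auto
    obtain h where h: "bij_betw h {0..<8 ^ n :: nat} (carpet_index n)"
      using ex_bij_betw_nat_finite[OF finite_carpet_index] card_carpet_index by metis
    define U where "U i = (if i < 8 ^ n then carpet_cell n (h i) else {})" for i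
    have diam: "diameter (carpet_cell n c) \<le> 2 / 3 ^ n" for c
      by (rule diameter_le) (auto simp: dist_norm[symmetric] dist_carpet_cell_le)
    have "hausdorff_premeasure carpet_dim \<delta> sierpinski_carpet \<le> (\<Sum>i. ennreal (diameter (U i) powr carpet_dim))"
    proof (rule hausdorff_premeasure_le)
      have "sierpinski_carpet = (\<Union>c\<in>h ` {0..<8 ^ n}. carpet_cell n c)"
        using UN_carpet_cells[of n] h by (simp add: bij_betw_def)
      moreover have "(\<Union>c\<in>h ` {0..<8 ^ n}. carpet_cell n c) \<subseteq> (\<Union>i. U i)"
        by (fastforce simp: U_def)
      ultimately show "sierpinski_carpet \<subseteq> (\<Union>i. U i)" by simp
      show "bounded (U i)" for i
        by (simp add: U_def compact_carpet_cell compact_imp_bounded)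
      show "diameter (U i) \<le> \<delta>" for i
        using diam[of "h i"] n \<open>0 < \<delta>\<close> by (auto simp: U_def power_divide)
    qed
    also have "\<dots> = (\<Sum>i<(8::nat) ^ n. ennreal (diameter (U i) powr carpet_dim))"
      by (rule suminf_finite) (auto simp: U_def)
    also have "\<dots> \<le> (\<Sum>i<(8::nat) ^ n. ennreal ((2 / 3 ^ n) powr carpet_dim))"
    proof (intro sum_mono ennreal_leI powr_mono2)
      fix i :: nat
      show "0 \<le> diameter (U i)"
        by (rule diameter_ge_0) (simp add: U_def compact_carpet_cell compact_imp_bounded)
      show "diameter (U i) \<le> 2 / 3 ^ n"
        using diam by (simp add: U_def)
    qed (use carpet_dim_pos in auto)
    also have "\<dots> = ennreal (8 ^ n * (2 / 3 ^ n) powr carpet_dim)"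
      by (simp add: ennreal_mult' ennreal_power[symmetric])
    also have "8 ^ n * (2 / 3 ^ n) powr carpet_dim = 2 powr carpet_dim"
      by (simp add: powr_divide power_three_powr_carpet_dim)
    finally show ?thesis .
  qed
  then have "hausdorff_outer_measure carpet_dim sierpinski_carpet \<le> ennreal (2 powr carpet_dim)"
    unfolding hausdorff_outer_measure_def by (intro SUP_least) auto
  then show ?thesis by (simp add: order_le_less_trans)
qed

section \<open>Positivity of the measure: triadic scales and counting of cells\<close>

lemma ex_triadic_interval:
  fixes d :: real
  assumes "0 < d" "d \<le> 1"
  obtains n where "1 / 3 ^ Suc n < d" "d \<le> 1 / 3 ^ n"
proof -
  define n where "n = (LEAST k. 1 / 3 ^ Suc k < d)"
  obtain k0 where "(1 / 3) ^ k0 < d"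
    using real_arch_pow_inv[of d "1 / 3"] \<open>0 < d\<close> by auto
  moreover have "(1 / 3 :: real) ^ Suc k0 \<le> (1 / 3) ^ k0" by (rule power_decreasing) auto
  ultimately have "1 / 3 ^ Suc k0 < d" by (simp add: power_divide)
  then have "1 / 3 ^ Suc n < d" unfolding n_def by (rule LeastI)
  moreover have "d \<le> 1 / 3 ^ n"
  proof (cases n)
    case (Suc j)
    then have "\<not> 1 / 3 ^ Suc j < d"
      using not_less_Least[of j "\<lambda>k. 1 / 3 ^ Suc k < d"] by (simp add: n_def)
    then show ?thesis by (simp add: Suc)
  qed (use assms in auto)
  ultimately show ?thesis by (rule that)
qed

text \<open>The error \<open>e\<close> takes care of \<open>d = 0\<close>: a cover set of diameter
  zero costs nothing but still meets cells. For positive \<open>d\<close> the factor 8 is the loss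
  from one triadic step.\<close>

lemma ex_triadic_scale:
  assumes "0 \<le> d" "d \<le> 1" "0 < e"
  shows "\<exists>k. d \<le> 1 / 3 ^ k \<and> 1 / 8 ^ k \<le> 8 * d powr carpet_dim + e"
proof (cases "d = 0")
  case True
  obtain k where "(1 / 8) ^ k < e"
    using real_arch_pow_inv[of e "1 / 8"] \<open>0 < e\<close> by auto
  then show ?thesis using True by (intro exI[of _ k]) (auto simp: power_divide)
next
  case False
  then have "0 < d" using assms by auto
  obtain k where k: "1 / 3 ^ Suc k < d" "d \<le> 1 / 3 ^ k"
    using ex_triadic_interval[OF \<open>0 < d\<close> \<open>d \<le> 1\<close>] .
  have "(1 / 3 ^ Suc k) powr carpet_dim \<le> d powr carpet_dim"
    using k(1) carpet_dim_pos by (intro powr_mono2) auto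
  then have "1 / 8 ^ k \<le> 8 * d powr carpet_dim + e"
    unfolding inverse_power_three_powr_carpet_dim using \<open>0 < e\<close> by simp
  with k(2) show ?thesis by blast
qed

lemma card_near_box: "card ({a - 4..a + 4} \<times> {b - 4..b + 4 :: nat}) \<le> 81" for a b :: nat
proof -
  have "card {a - 4..a + 4} \<le> 9" "card {b - 4..b + 4} \<le> 9" by auto
  then have "card {a - 4..a + 4} * card {b - 4..b + 4} \<le> 9 * 9" by (rule mult_le_mono)
  then show ?thesis by (simp add: card_cartesian_product)
qed

text \<open>4 = 3 + 1: the scaled distance plus the side of a cell. Truncated subtraction is
  harmless because the indices are naturals.\<close>

lemma near_cells_coord:
  assumes "x \<in> carpet_cell n c" "y \<in> carpet_cell n c'" "dist x y \<le> 3 / 3 ^ n"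
  shows "c' \<in> {fst c - 4..fst c + 4} \<times> {snd c - 4..snd c + 4}"
proof -
  have "\<bar>fst x - fst y\<bar> \<le> 3 / 3 ^ n" "\<bar>snd x - snd y\<bar> \<le> 3 / 3 ^ n"
    using assms(3) dist_fst_le[of x y] dist_snd_le[of x y] by (auto simp: dist_real_def)
  then have "\<bar>3 ^ n * (fst x - fst y)\<bar> \<le> 3" "\<bar>3 ^ n * (snd x - snd y)\<bar> \<le> 3"
    by (simp_all add: abs_mult pos_le_divide_eq mult.commute)
  then have "\<bar>real (fst c) - real (fst c')\<bar> \<le> 4" "\<bar>real (snd c) - real (snd c')\<bar> \<le> 4"
    using carpet_cell_coord[OF assms(1)] carpet_cell_coord[OF assms(2)]
    by (auto simp: abs_le_iff algebra_simps)
  then show ?thesis by (auto simp: mem_Times_iff)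
qed

text \<open>At level \<open>k\<close> all cells meeting \<open>V\<close> lie near one of them. Each
  further level multiplies the count by at most 8, since the parent of a cell meeting
  \<open>V\<close> meets \<open>V\<close> as well.\<close>

lemma card_cells_meeting:
  assumes V: "\<And>x y. x \<in> V \<Longrightarrow> y \<in> V \<Longrightarrow> dist x y \<le> 3 / 3 ^ k" and "k \<le> n"
  shows "card {c \<in> carpet_index n. carpet_cell n c \<inter> V \<noteq> {}} \<le> 81 * 8 ^ (n - k)"
  using \<open>k \<le> n\<close>
proof (induction n rule: dec_induct)
  case base
  show ?case
  proof (cases "{c \<in> carpet_index k. carpet_cell k c \<inter> V \<noteq> {}} = {}")
    case False
    then obtain c x where c: "x \<in> carpet_cell k c" "x \<in> V" by auto
    have "{c \<in> carpet_index k. carpet_cell k c \<inter> V \<noteq> {}} \<subseteq> {fst c - 4..fst c + 4} \<times> {snd c - 4..snd c + 4}"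
      using near_cells_coord[OF c(1)] V[OF c(2)] by blast
    then have "card {c \<in> carpet_index k. carpet_cell k c \<inter> V \<noteq> {}} \<le> 81"
      by (intro order_trans[OF card_mono card_near_box]) auto
    then show ?thesis by simp
  qed (metis card.empty le0)
next
  case (step n)
  let ?S = "\<lambda>n. {c \<in> carpet_index n. carpet_cell n c \<inter> V \<noteq> {}}"
  have "?S (Suc n) \<subseteq> (\<lambda>((a, b), (d, e)). (3 * a + d, 3 * b + e)) ` (?S n \<times> carpet_digits)"
  proof
    fix c assume c: "c \<in> ?S (Suc n)"
    then obtain a b d e where abde: "c = (3 * a + d, 3 * b + e)" "(a, b) \<in> carpet_index n" "(d, e) \<in> carpet_digits"
      by auto
    with c carpet_cell_Suc_subset[OF abde(3), of n a b] have "(a, b) \<in> ?S n" by auto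
    with abde show "c \<in> (\<lambda>((a, b), (d, e)). (3 * a + d, 3 * b + e)) ` (?S n \<times> carpet_digits)"
      by (intro image_eqI[of _ _ "((a, b), (d, e))"]) auto
  qed
  then have "card (?S (Suc n)) \<le> card (?S n \<times> carpet_digits)"
    by (intro surj_card_le) auto
  also have "\<dots> = card (?S n) * 8"
    by (simp add: card_cartesian_product) (simp add: carpet_digits_eq)
  also have "\<dots> \<le> 81 * 8 ^ (Suc n - k)"
    using step.IH step.hyps by (simp add: Suc_diff_le)
  finally show ?case .
qed

text \<open>Mass distribution by counting: a set of diameter about \<open>3\<^sup>-\<^sup>k\<close> meets at most \<open>81 * 8\<^sup>n\<^sup>-\<^sup>k\<close>
  of the \<open>8\<^sup>n\<close> cells of any deeper level \<open>n\<close>; compactness reduces a cover to a finite one, for which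
  a common level can be chosen.\<close>

lemma hausdorff_carpet_pos: "0 < hausdorff_outer_measure carpet_dim sierpinski_carpet"
proof -
  \<comment> \<open>1296 = 2 * 81 * 8: the errors in the choice of \<open>k\<close> add up to at
    most 1/162, so counting gives 1 \<le> 81 * 8 * S + 1/2 for a finite part S of the sum.\<close>
  have "ennreal (1 / 1296) \<le> (\<Sum>i. ennreal (diameter (U i) powr carpet_dim))"
    if U: "sierpinski_carpet \<subseteq> (\<Union>i. U i)" "\<forall>i. bounded (U i) \<and> diameter (U i) \<le> 1" for U
  proof -
    have "\<exists>k. diameter (U i) \<le> 1 / 3 ^ k \<and> 1 / 8 ^ k \<le> 8 * diameter (U i) powr carpet_dim + 1 / 162 * (1 / 2) ^ Suc i" for i
      using U by (intro ex_triadic_scale) (auto intro: diameter_ge_0)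
    then obtain k where k: "\<And>i. diameter (U i) \<le> 1 / 3 ^ k i"
        "\<And>i. 1 / 8 ^ k i \<le> 8 * diameter (U i) powr carpet_dim + 1 / 162 * (1 / 2) ^ Suc i" by metis
    \<comment> \<open>Compactness asks for open sets; enlarging \<open>U i\<close> by its own scale
      triples the diameter bound, which is the 3 in \<open>card_cells_meeting\<close>.\<close>
    define V where "V i = (\<Union>x\<in>U i. ball x (1 / 3 ^ k i))" for i
    have "U i \<subseteq> V i" for i
    proof
      fix x assume "x \<in> U i"
      moreover have "x \<in> ball x (1 / 3 ^ k i)" by simp
      ultimately show "x \<in> V i" unfolding V_def by (rule UN_I)
    qed
    then have "(\<Union>i. U i) \<subseteq> (\<Union>i. V i)" by (intro UN_mono) auto
    with U(1) have cover: "sierpinski_carpet \<subseteq> (\<Union>i\<in>UNIV. V i)" by (rule subset_trans)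
    have "open (V i)" for i
      unfolding V_def by (intro open_UN ballI open_ball)
    then obtain I where I: "finite I" "sierpinski_carpet \<subseteq> (\<Union>i\<in>I. V i)"
      using compactE_image[OF compact_carpet _ cover] by metis
    have V: "dist x y \<le> 3 / 3 ^ k i" if "x \<in> V i" "y \<in> V i" for x y i
    proof -
      from that obtain x' y' where xy: "x' \<in> U i" "y' \<in> U i" "dist x' x < 1 / 3 ^ k i" "dist y' y < 1 / 3 ^ k i"
        by (auto simp: V_def)
      have "dist x' y' \<le> 1 / 3 ^ k i"
        using diameter_bounded_bound[of "U i" x' y'] U(2)[rule_format, of i] xy k(1)[of i] by auto
      then have "dist x y < 1 / 3 ^ k i + 1 / 3 ^ k i + 1 / 3 ^ k i"
        using xy(3,4) dist_triangle[of x y x'] dist_triangle[of x' y y'] by (simp add: dist_commute)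
      then show ?thesis by simp
    qed
    define n where "n = Max (insert 0 (k ` I))"
    have kn: "k i \<le> n" if "i \<in> I" for i
      using that I by (auto simp: n_def)
    have "carpet_index n \<subseteq> (\<Union>i\<in>I. {c \<in> carpet_index n. carpet_cell n c \<inter> V i \<noteq> {}})"
    proof
      fix c assume c: "c \<in> carpet_index n"
      obtain x where "x \<in> carpet_cell n c" using carpet_nonempty by (metis carpet_cell_def ex_in_conv image_is_empty)
      with carpet_cell_subset[OF c] I c show "c \<in> (\<Union>i\<in>I. {c \<in> carpet_index n. carpet_cell n c \<inter> V i \<noteq> {}})"
        by blast
    qed
    then have "card (carpet_index n) \<le> card (\<Union>i\<in>I. {c \<in> carpet_index n. carpet_cell n c \<inter> V i \<noteq> {}})"
      using I by (intro card_mono) auto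
    also have "\<dots> \<le> (\<Sum>i\<in>I. card {c \<in> carpet_index n. carpet_cell n c \<inter> V i \<noteq> {}})"
      using I by (intro card_UN_le)
    also have "\<dots> \<le> (\<Sum>i\<in>I. 81 * 8 ^ (n - k i))"
      using V kn by (intro sum_mono card_cells_meeting) auto
    finally have "real (8 ^ n) \<le> real (\<Sum>i\<in>I. 81 * 8 ^ (n - k i))"
      unfolding card_carpet_index by (rule of_nat_mono)
    then have "8 ^ n \<le> (\<Sum>i\<in>I. 81 * 8 ^ (n - k i) :: real)"
      by simp
    also have "\<dots> = (\<Sum>i\<in>I. 8 ^ n * 81 * (1 / 8 ^ k i))"
      using kn by (intro sum.cong) (auto simp: power_diff)
    also have "\<dots> \<le> (\<Sum>i\<in>I. 8 ^ n * 81 * (8 * diameter (U i) powr carpet_dim + 1 / 162 * (1 / 2) ^ Suc i))"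
      by (intro sum_mono mult_left_mono k) auto
    also have "\<dots> = 8 ^ n * (81 * (8 * (\<Sum>i\<in>I. diameter (U i) powr carpet_dim) + 1 / 162 * (\<Sum>i\<in>I. (1 / 2) ^ Suc i)))"
      by (simp only: sum_distrib_left[symmetric] sum.distrib mult.assoc)
    finally have "1 \<le> 81 * (8 * (\<Sum>i\<in>I. diameter (U i) powr carpet_dim) + 1 / 162 * (\<Sum>i\<in>I. (1 / 2) ^ Suc i))"
      by simp
    moreover have "(\<Sum>i\<in>I. (1 / 2 :: real) ^ Suc i) \<le> 1"
      using sum_le_suminf[of "\<lambda>i. (1 / 2 :: real) ^ Suc i" I] I power_half_series
      by (auto simp: sums_iff)
    ultimately have "1 / 1296 \<le> (\<Sum>i\<in>I. diameter (U i) powr carpet_dim)"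
      by (simp add: field_simps)
    then have "ennreal (1 / 1296) \<le> ennreal (\<Sum>i\<in>I. diameter (U i) powr carpet_dim)"
      by (rule ennreal_leI)
    also have "\<dots> = (\<Sum>i\<in>I. ennreal (diameter (U i) powr carpet_dim))"
      by simp
    also have "\<dots> \<le> (\<Sum>i. ennreal (diameter (U i) powr carpet_dim))"
      using I by (intro sum_le_suminf) auto
    finally show ?thesis .
  qed
  then have "ennreal (1 / 1296) \<le> hausdorff_premeasure carpet_dim 1 sierpinski_carpet"
    unfolding hausdorff_premeasure_def by (intro INF_greatest) auto
  also have "\<dots> \<le> hausdorff_outer_measure carpet_dim sierpinski_carpet"
    by (rule hausdorff_premeasure_le_outer) simp
  finally show ?thesis by (rule less_le_trans[rotated]) simp
qed


section \<open>The normalized measure\<close>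

lemma sets_carpet_measure [measurable_cong]:
  "sets carpet_measure = sets (restrict_space borel sierpinski_carpet)"
  unfolding carpet_measure_def by (rule sets_restrict_space_cong) simp

lemma space_carpet_measure [simp]: "space carpet_measure = sierpinski_carpet"
  by (simp add: carpet_measure_def space_restrict_space)

lemma sets_carpet_measure_iff: "A \<in> sets carpet_measure \<longleftrightarrow> A \<subseteq> sierpinski_carpet \<and> A \<in> sets borel"
  by (simp add: sets_carpet_measure sets_restrict_space_iff carpet_borel conj_commute)

lemma emeasure_carpet_measure:
  assumes "A \<subseteq> sierpinski_carpet" "A \<in> sets borel"
  shows "emeasure carpet_measure A =
    hausdorff_outer_measure carpet_dim A / hausdorff_outer_measure carpet_dim sierpinski_carpet"
  using assms
  by (simp add: carpet_measure_def emeasure_restrict_space emeasure_hausdorff[OF carpet_dim_pos] Int_absorb1)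

lemma prob_space_carpet_measure: "emeasure carpet_measure sierpinski_carpet = 1"
  using hausdorff_carpet_finite hausdorff_carpet_pos
  by (subst emeasure_carpet_measure) (auto simp: ennreal_divide_self less_top)

lemma finite_measure_carpet: "finite_measure carpet_measure"
  by (rule finite_measureI) (simp add: prob_space_carpet_measure)

lemma carpet_cell_sets [measurable]: "c \<in> carpet_index n \<Longrightarrow> carpet_cell n c \<in> sets carpet_measure"
  by (simp add: sets_carpet_measure_iff carpet_cell_subset)

lemma emeasure_carpet_cell:
  assumes "c \<in> carpet_index n"
  shows "emeasure carpet_measure (carpet_cell n c) = ennreal (1 / 8 ^ n)"
  using hausdorff_carpet_finite hausdorff_carpet_pos
  by (subst emeasure_carpet_measure)
     (auto simp: carpet_cell_subset[OF assms] hausdorff_carpet_cell ennreal_times_divide[symmetric]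
        ennreal_divide_self less_top)

lemma measure_carpet_cell:
  "c \<in> carpet_index n \<Longrightarrow> measure carpet_measure (carpet_cell n c) = 1 / 8 ^ n"
  by (simp add: measure_def emeasure_carpet_cell)


section \<open>Square-integrable functions\<close>

lemma square_add_le: "(a + b)\<^sup>2 \<le> 2 * a\<^sup>2 + 2 * b\<^sup>2" for a b :: real
  using sum_squares_bound[of a b] by (simp add: power2_sum)

lemma nn_integral_square_add_le:
  fixes u v :: "'a \<Rightarrow> real"
  assumes [measurable]: "u \<in> borel_measurable M" "v \<in> borel_measurable M"
  shows "(\<integral>\<^sup>+x. ennreal ((u x + v x)\<^sup>2) \<partial>M) \<le>
    2 * (\<integral>\<^sup>+x. ennreal ((u x)\<^sup>2) \<partial>M) + 2 * (\<integral>\<^sup>+x. ennreal ((v x)\<^sup>2) \<partial>M)"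
proof -
  have "(\<integral>\<^sup>+x. ennreal ((u x + v x)\<^sup>2) \<partial>M) \<le> (\<integral>\<^sup>+x. 2 * ennreal ((u x)\<^sup>2) + 2 * ennreal ((v x)\<^sup>2) \<partial>M)"
  proof (rule nn_integral_mono)
    fix x
    have "ennreal ((u x + v x)\<^sup>2) \<le> ennreal (2 * (u x)\<^sup>2 + 2 * (v x)\<^sup>2)"
      by (rule ennreal_leI[OF square_add_le])
    then show "ennreal ((u x + v x)\<^sup>2) \<le> 2 * ennreal ((u x)\<^sup>2) + 2 * ennreal ((v x)\<^sup>2)"
      by (simp add: ennreal_mult)
  qed
  also have "\<dots> = 2 * (\<integral>\<^sup>+x. ennreal ((u x)\<^sup>2) \<partial>M) + 2 * (\<integral>\<^sup>+x. ennreal ((v x)\<^sup>2) \<partial>M)"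
    by (simp add: nn_integral_add nn_integral_cmult)
  finally show ?thesis .
qed

lemma L2_functions_iff:
  "u \<in> L2_functions M \<longleftrightarrow> u \<in> borel_measurable M \<and> (\<integral>\<^sup>+x. ennreal ((u x)\<^sup>2) \<partial>M) < \<infinity>"
  by (auto simp: L2_functions_def integrable_iff_bounded)

lemma L2_norm_square:
  "u \<in> borel_measurable M \<Longrightarrow> (L2_norm M u)\<^sup>2 = enn2real (\<integral>\<^sup>+x. ennreal ((u x)\<^sup>2) \<partial>M)"
  by (simp add: L2_norm_def integral_eq_nn_integral)

lemma L2_functions_add:
  "u \<in> L2_functions M \<Longrightarrow> v \<in> L2_functions M \<Longrightarrow> (\<lambda>x. u x + v x) \<in> L2_functions M"
  by (auto simp: L2_functions_iff ennreal_mult_less_top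
      intro!: le_less_trans[OF nn_integral_square_add_le])

lemma L2_functions_scale: "u \<in> L2_functions M \<Longrightarrow> (\<lambda>x. c * u x) \<in> L2_functions M"
  by (auto simp: L2_functions_def power_mult_distrib)

lemma L2_functions_diff:
  "u \<in> L2_functions M \<Longrightarrow> v \<in> L2_functions M \<Longrightarrow> (\<lambda>x. u x - v x) \<in> L2_functions M"
  using L2_functions_add[of u M "\<lambda>x. -1 * v x"] L2_functions_scale[of v M "-1"] by simp

lemma (in finite_measure) L2_functions_bounded:
  assumes [measurable]: "u \<in> borel_measurable M" and "\<And>x. x \<in> space M \<Longrightarrow> \<bar>u x\<bar> \<le> B"
  shows "u \<in> L2_functions M"
proof -
  have "(\<integral>\<^sup>+x. ennreal ((u x)\<^sup>2) \<partial>M) \<le> (\<integral>\<^sup>+x. ennreal (B\<^sup>2) \<partial>M)"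
    using assms(2) by (intro nn_integral_mono ennreal_leI abs_le_square_iff[THEN iffD1]) fastforce
  also have "\<dots> < \<infinity>" by (simp add: emeasure_eq_measure ennreal_mult[symmetric])
  finally show ?thesis by (simp add: L2_functions_iff)
qed

section \<open>Limits almost everywhere and dense subsets of L2\<close>

lemma nn_integral_fatou_le:
  assumes "\<And>n::nat. f n \<in> borel_measurable M" "AE x in M. (\<lambda>n. f n x) \<longlonglongrightarrow> (g x :: ennreal)"
    "\<And>n. n \<ge> N \<Longrightarrow> (\<integral>\<^sup>+x. f n x \<partial>M) \<le> C"
  shows "(\<integral>\<^sup>+x. g x \<partial>M) \<le> C"
proof -
  have "(\<integral>\<^sup>+x. g x \<partial>M) = (\<integral>\<^sup>+x. liminf (\<lambda>n. f n x) \<partial>M)"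
    using assms(2) by (intro nn_integral_cong_AE) (auto elim!: eventually_mono simp: lim_imp_Liminf)
  also have "\<dots> \<le> liminf (\<lambda>n. \<integral>\<^sup>+x. f n x \<partial>M)"
    using assms(1) by (rule nn_integral_liminf)
  also have "\<dots> \<le> C"
    using assms(3) by (intro Liminf_le) (auto simp: eventually_sequentially)
  finally show ?thesis .
qed

text \<open>The increments are summable in \<open>L\<^sup>1\<close> because \<open>\<bar>a\<bar> \<le> 2\<^sup>n a\<^sup>2 + 2\<^sup>-\<^sup>n\<close>.\<close>

lemma (in finite_measure) AE_convergent_of_fast_cauchy:
  fixes u :: "nat \<Rightarrow> 'a \<Rightarrow> real"
  assumes [measurable]: "\<And>n. u n \<in> borel_measurable M"
    and fast: "\<And>n. (\<integral>\<^sup>+x. ennreal ((u (Suc n) x - u n x)\<^sup>2) \<partial>M) \<le> ennreal ((1 / 4) ^ n)"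
  shows "AE x in M. convergent (\<lambda>n. u n x)"
proof -
  define d where "d n x = \<bar>u (Suc n) x - u n x\<bar>" for n x
  have [measurable]: "d n \<in> borel_measurable M" for n unfolding d_def by measurable
  have le: "a \<le> 2 ^ n * a\<^sup>2 + (1 / 2) ^ n" if "0 \<le> a" for a :: real and n
  proof (cases "a \<le> (1 / 2) ^ n")
    case False
    then have "1 \<le> 2 ^ n * a" by (simp add: power_divide field_simps)
    then have "a * 1 \<le> a * (2 ^ n * a)" using that by (intro mult_left_mono) auto
    moreover have "0 \<le> (1 / 2 :: real) ^ n" by simp
    ultimately have "a \<le> a * (2 ^ n * a) + (1 / 2) ^ n" by linarith
    then show ?thesis by (simp add: power2_eq_square ac_simps)
  next
    case True
    moreover have "0 \<le> 2 ^ n * a\<^sup>2" by simp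
    ultimately show ?thesis by linarith
  qed
  have int: "(\<integral>\<^sup>+x. ennreal (d n x) \<partial>M) \<le> ennreal ((1 + measure M (space M)) * (1 / 2) ^ n)" for n
  proof -
    have "(\<integral>\<^sup>+x. ennreal (d n x) \<partial>M) \<le>
        (\<integral>\<^sup>+x. ennreal (2 ^ n) * ennreal ((u (Suc n) x - u n x)\<^sup>2) + ennreal ((1 / 2) ^ n) \<partial>M)"
    proof (intro nn_integral_mono)
      fix x
      have "d n x \<le> 2 ^ n * (u (Suc n) x - u n x)\<^sup>2 + (1 / 2) ^ n"
        using le[of "d n x" n] by (simp add: d_def)
      then show "ennreal (d n x) \<le> ennreal (2 ^ n) * ennreal ((u (Suc n) x - u n x)\<^sup>2) + ennreal ((1 / 2) ^ n)"
        by (simp add: ennreal_mult[symmetric] ennreal_plus[symmetric] ennreal_leI del: ennreal_plus)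
    qed
    also have "\<dots> = ennreal (2 ^ n) * (\<integral>\<^sup>+x. ennreal ((u (Suc n) x - u n x)\<^sup>2) \<partial>M) + ennreal ((1 / 2) ^ n) * emeasure M (space M)"
      by (simp add: nn_integral_add nn_integral_cmult del: ennreal_power)
    also have "\<dots> \<le> ennreal (2 ^ n) * ennreal ((1 / 4) ^ n) + ennreal ((1 / 2) ^ n) * emeasure M (space M)"
      by (intro add_right_mono mult_left_mono fast) simp
    also have "\<dots> = ennreal (2 ^ n * (1 / 4) ^ n + (1 / 2) ^ n * measure M (space M))"
      by (subst emeasure_eq_measure) (simp add: ennreal_mult ennreal_plus)
    also have "2 ^ n * (1 / 4) ^ n + (1 / 2) ^ n * measure M (space M) = (1 + measure M (space M)) * (1 / 2 :: real) ^ n"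
      by (simp add: power_mult_distrib[symmetric] distrib_right)
    finally show ?thesis .
  qed
  have "(\<integral>\<^sup>+x. (\<Sum>n. ennreal (d n x)) \<partial>M) = (\<Sum>n. \<integral>\<^sup>+x. ennreal (d n x) \<partial>M)"
    by (rule nn_integral_suminf) simp
  also have "\<dots> \<le> (\<Sum>n. ennreal ((1 + measure M (space M)) * (1 / 2) ^ n))"
    by (intro suminf_le int) auto
  also have "\<dots> = ennreal (\<Sum>n. (1 + measure M (space M)) * (1 / 2) ^ n)"
    by (intro suminf_ennreal2 summable_mult summable_geometric) auto
  finally have "(\<integral>\<^sup>+x. (\<Sum>n. ennreal (d n x)) \<partial>M) \<noteq> \<infinity>"
    by (auto simp: top_unique)
  then have "AE x in M. (\<Sum>n. ennreal (d n x)) \<noteq> \<infinity>"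
    by (intro nn_integral_PInf_AE) auto
  then show ?thesis
  proof (rule eventually_mono)
    fix x assume "(\<Sum>n. ennreal (d n x)) \<noteq> \<infinity>"
    then have "summable (\<lambda>n. d n x)"
      by (intro summable_suminf_not_top) (auto simp: d_def)
    then have "summable (\<lambda>n. u (Suc n) x - u n x)"
      unfolding d_def by (rule summable_rabs_cancel)
    then have "convergent (\<lambda>n. \<Sum>i<n. u (Suc i) x - u i x)"
      by (simp add: summable_iff_convergent)
    then obtain l where "(\<lambda>n. u n x - u 0 x) \<longlonglongrightarrow> l"
      unfolding sum_lessThan_telescope[of "\<lambda>n. u n x"] by (auto simp: convergent_def)
    then have "(\<lambda>n. u n x - u 0 x + u 0 x) \<longlonglongrightarrow> l + u 0 x" by (intro tendsto_intros)
    then show "convergent (\<lambda>n. u n x)" by (auto simp: convergent_def)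
  qed
qed

text \<open>Indicators are approximated by regularity and Urysohn's lemma, simple functions by
  linearity, and \<open>u\<close> by simple functions of modulus at most twice that of
  \<open>u\<close>, with dominated convergence.\<close>

lemma continuous_dense_L2:
  fixes M :: "'a::euclidean_space measure"
  assumes "finite_measure M" and sets_M: "sets M = sets (restrict_space borel S)" and S: "S \<in> sets borel"
    and u: "u \<in> L2_functions M" and e: "0 < e"
  shows "\<exists>g. continuous_on UNIV g \<and> (\<integral>\<^sup>+x. ennreal ((u x - g x)\<^sup>2) \<partial>M) \<le> ennreal e"
proof -
  interpret finite_measure M by fact
  have space_M: "space M = S"
    using sets_eq_imp_space_eq[OF sets_M] by (simp add: space_restrict_space)
  have id_M: "(\<lambda>x. x) \<in> measurable M borel"
    unfolding measurable_cong_sets[OF sets_M refl] by (rule measurable_restrict_space1) simp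
  have cont_M: "g \<in> borel_measurable M" if "continuous_on UNIV g" for g :: "'a \<Rightarrow> real"
    using measurable_compose[OF id_M borel_measurable_continuous_onI[OF that]] by simp
  define approx where "approx f \<longleftrightarrow> f \<in> borel_measurable M \<and>
    (\<forall>e>0. \<exists>g. continuous_on UNIV g \<and> (\<integral>\<^sup>+x. ennreal ((f x - g x)\<^sup>2) \<partial>M) \<le> ennreal e)" for f
  have approxD: "\<exists>g. continuous_on UNIV g \<and> (\<integral>\<^sup>+x. ennreal ((f x - g x)\<^sup>2) \<partial>M) \<le> ennreal e"
    if "approx f" "0 < e" for f e
    using that by (simp add: approx_def)
  have approx_ind: "approx (indicator A)" if A: "A \<in> sets M" for A
    unfolding approx_def
  proof (intro conjI allI impI)
    show "indicator A \<in> borel_measurable M" using A by simp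
    fix e :: real assume e: "0 < e"
    \<comment> \<open>Outer regularity concerns measures on all Borel sets, whereas \<open>M\<close>
      lives on \<open>S\<close>; hence the image measure.\<close>
    define N where "N = distr M borel (\<lambda>x. x)"
    interpret N: finite_measure N unfolding N_def using id_M by (rule finite_measure_distr)
    have sets_N: "sets N = sets borel" and space_N: "space N = UNIV" by (simp_all add: N_def)
    have A': "A \<in> sets borel" using A S by (simp add: sets_M sets_restrict_space_iff)
    have *: "\<exists>U. B \<subseteq> U \<and> open U \<and> measure N U < measure N B + e / 2" if "B \<in> sets borel" for B
    proof -
      have "emeasure N B < ennreal (measure N B + e / 2)"
        using e by (simp add: N.emeasure_eq_measure ennreal_less_iff del: ennreal_plus)
      then have "(INF U \<in> {U. B \<subseteq> U \<and> open U}. emeasure N U) < ennreal (measure N B + e / 2)"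
        using N.emeasure_finite outer_regular[OF sets_N _ that] by simp
      then obtain U where "B \<subseteq> U" "open U" "emeasure N U < ennreal (measure N B + e / 2)"
        by (auto simp: INF_less_iff)
      then show ?thesis by (auto simp: N.emeasure_eq_measure ennreal_less_iff simp del: ennreal_plus)
    qed
    obtain U where U: "A \<subseteq> U" "open U" "measure N U < measure N A + e / 2" using *[OF A'] by blast
    obtain V where V: "- A \<subseteq> V" "open V" "measure N V < measure N (- A) + e / 2" using *[of "- A"] A' by auto
    \<comment> \<open>The closed set \<open>- V\<close> lies inside \<open>A\<close> and
      \<open>A\<close> inside \<open>U\<close>, so a function that is 1 on \<open>- V\<close> and 0
      off \<open>U\<close> differs from the indicator at most on
      \<open>U \<inter> V\<close>.\<close>
    obtain g where g: "continuous_on UNIV g" "\<And>x. g x \<in> closed_segment 1 0" "\<And>x. x \<in> - V \<Longrightarrow> g x = 1"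
        "\<And>x. x \<in> - U \<Longrightarrow> g x = (0 :: real)"
      using Urysohn[of "- V" "- U" 1 0] U V by (auto simp: closed_def)
    have g01: "0 \<le> g x" "g x \<le> 1" for x using g(2)[of x] by (auto simp: closed_segment_eq_real_ivl)
    have "(\<integral>\<^sup>+x. ennreal ((indicator A x - g x)\<^sup>2) \<partial>M) \<le> (\<integral>\<^sup>+x. indicator (U \<inter> V) x \<partial>M)"
    proof (rule nn_integral_mono)
      fix x
      have "(indicator A x - g x)\<^sup>2 \<le> (1 :: real)"
        using g01[of x] by (auto simp: indicator_def abs_square_le_1)
      moreover have "indicator A x - g x = 0" if "x \<notin> U \<inter> V"
        using that U V g(3)[of x] g(4)[of x] by (auto simp: indicator_def)
      ultimately show "ennreal ((indicator A x - g x)\<^sup>2) \<le> indicator (U \<inter> V) x"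
        by (cases "x \<in> U \<inter> V") (auto simp: indicator_def)
    qed
    also have "\<dots> = (\<integral>\<^sup>+x. indicator (U \<inter> V) x \<partial>N)"
      unfolding N_def by (rule nn_integral_distr[OF id_M, symmetric])
         (intro borel_measurable_indicator sets.Int, simp_all add: U V)
    also have "\<dots> = emeasure N (U \<inter> V)" using U V by (intro nn_integral_indicator) (simp add: sets_N)
    also have "\<dots> \<le> ennreal e"
    proof -
      have sets: "U \<in> sets N" "V \<in> sets N" "A \<in> sets N" using U V A' by (auto simp: sets_N)
      have "U - (U \<inter> V) = - V" using U V by auto
      moreover have "measure N (U - (U \<inter> V)) = measure N U - measure N (U \<inter> V)"
        using sets by (intro N.finite_measure_Diff) auto
      moreover have "measure N (- V) = measure N UNIV - measure N V"
        using N.finite_measure_compl[OF sets(2)] by (simp add: space_N Compl_eq_Diff_UNIV)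
      moreover have "measure N (- A) = measure N UNIV - measure N A"
        using N.finite_measure_compl[OF sets(3)] by (simp add: space_N Compl_eq_Diff_UNIV)
      ultimately have "measure N (U \<inter> V) \<le> e" using U(3) V(3) by simp
      then show ?thesis by (simp add: N.emeasure_eq_measure ennreal_leI)
    qed
    finally show "\<exists>g. continuous_on UNIV g \<and> (\<integral>\<^sup>+x. ennreal ((indicator A x - g x)\<^sup>2) \<partial>M) \<le> ennreal e"
      using g(1) by blast
  qed
  have approx_scale: "approx (\<lambda>x. f x * c)" if "approx f" for f and c :: real
    unfolding approx_def
  proof (intro conjI allI impI)
    show "(\<lambda>x. f x * c) \<in> borel_measurable M" using that by (auto simp: approx_def)
    fix e :: real assume e: "0 < e"
    \<comment> \<open>The added 1 covers \<open>c = 0\<close>.\<close>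
    have "0 < e / (c\<^sup>2 + 1)" using e by (simp add: add_nonneg_pos)
    with approxD[OF that] obtain g where g: "continuous_on UNIV g" "(\<integral>\<^sup>+x. ennreal ((f x - g x)\<^sup>2) \<partial>M) \<le> ennreal (e / (c\<^sup>2 + 1))"
      by meson
    have [measurable]: "f \<in> borel_measurable M" "g \<in> borel_measurable M"
      using that cont_M[OF g(1)] by (auto simp: approx_def)
    have "(\<integral>\<^sup>+x. ennreal ((f x * c - g x * c)\<^sup>2) \<partial>M) = (\<integral>\<^sup>+x. ennreal (c\<^sup>2) * ennreal ((f x - g x)\<^sup>2) \<partial>M)"
    proof (intro nn_integral_cong)
      fix x
      have "(f x * c - g x * c)\<^sup>2 = c\<^sup>2 * (f x - g x)\<^sup>2" by (simp add: power2_eq_square algebra_simps)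
      then show "ennreal ((f x * c - g x * c)\<^sup>2) = ennreal (c\<^sup>2) * ennreal ((f x - g x)\<^sup>2)"
        by (simp add: ennreal_mult)
    qed
    also have "\<dots> = ennreal (c\<^sup>2) * (\<integral>\<^sup>+x. ennreal ((f x - g x)\<^sup>2) \<partial>M)"
      by (rule nn_integral_cmult) measurable
    also have "\<dots> \<le> ennreal (c\<^sup>2) * ennreal (e / (c\<^sup>2 + 1))" by (intro mult_left_mono g) simp
    also have "\<dots> \<le> ennreal e"
    proof -
      have "0 < c\<^sup>2 + 1" by (simp add: add_nonneg_pos)
      then have "c\<^sup>2 * (e / (c\<^sup>2 + 1)) \<le> e"
        using e by (simp add: pos_divide_le_eq distrib_left mult.commute)
      then show ?thesis using e by (subst ennreal_mult[symmetric]) (auto intro: ennreal_leI)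
    qed
    finally show "\<exists>g. continuous_on UNIV g \<and> (\<integral>\<^sup>+x. ennreal ((f x * c - g x)\<^sup>2) \<partial>M) \<le> ennreal e"
      using g(1) by (intro exI[of _ "\<lambda>x. g x * c"]) (auto intro!: continuous_intros)
  qed
  have near: "\<exists>g. continuous_on UNIV g \<and> (\<integral>\<^sup>+x. ennreal ((f x + f' x - g x)\<^sup>2) \<partial>M) \<le> ennreal e"
    if h: "f \<in> borel_measurable M" "0 < e"
      "\<exists>g. continuous_on UNIV g \<and> (\<integral>\<^sup>+x. ennreal ((f x - g x)\<^sup>2) \<partial>M) \<le> ennreal (e / 4)"
      "f' \<in> borel_measurable M"
      "\<exists>g. continuous_on UNIV g \<and> (\<integral>\<^sup>+x. ennreal ((f' x - g x)\<^sup>2) \<partial>M) \<le> ennreal (e / 4)" for f f' e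
  proof -
    obtain g where g: "continuous_on UNIV g" "(\<integral>\<^sup>+x. ennreal ((f x - g x)\<^sup>2) \<partial>M) \<le> ennreal (e / 4)"
      using h(3) by (elim exE conjE)
    obtain g' where g': "continuous_on UNIV g'" "(\<integral>\<^sup>+x. ennreal ((f' x - g' x)\<^sup>2) \<partial>M) \<le> ennreal (e / 4)"
      using h(5) by (elim exE conjE)
    have [measurable]: "f \<in> borel_measurable M" "f' \<in> borel_measurable M" "g \<in> borel_measurable M" "g' \<in> borel_measurable M"
      using that cont_M[OF g(1)] cont_M[OF g'(1)] by auto
    have "(\<integral>\<^sup>+x. ennreal ((f x + f' x - (g x + g' x))\<^sup>2) \<partial>M) = (\<integral>\<^sup>+x. ennreal (((f x - g x) + (f' x - g' x))\<^sup>2) \<partial>M)"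
      by (simp add: algebra_simps)
    also have "\<dots> \<le> 2 * (\<integral>\<^sup>+x. ennreal ((f x - g x)\<^sup>2) \<partial>M) + 2 * (\<integral>\<^sup>+x. ennreal ((f' x - g' x)\<^sup>2) \<partial>M)"
      by (rule nn_integral_square_add_le) measurable
    also have "\<dots> \<le> 2 * ennreal (e / 4) + 2 * ennreal (e / 4)"
      by (intro add_mono mult_left_mono g g') auto
    also have "\<dots> = ennreal e"
    proof -
      have "2 * ennreal a + 2 * ennreal a = ennreal (4 * a)" if "0 \<le> a" for a
        using that by (simp add: ennreal_mult mult_2[symmetric] mult.assoc[symmetric])
      from this[of "e / 4"] show ?thesis using h(2) by simp
    qed
    finally show ?thesis
      using g g' by (intro exI[of _ "\<lambda>x. g x + g' x"]) (auto intro!: continuous_intros)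
  qed
  have approx_add: "approx (\<lambda>x. f x + f' x)" if "approx f" "approx f'" for f f'
    using that near[of f _ f'] by (auto simp: approx_def)
  have approx_0: "approx (\<lambda>x. 0)" using approx_scale[OF approx_ind[of "{}"], of 0] by simp
  have approx_sum: "approx (\<lambda>x. \<Sum>y\<in>F. f y x)" if "finite F" "\<And>y. y \<in> F \<Longrightarrow> approx (f y)" for F :: "real set" and f
    using that by (induction F) (auto intro: approx_add approx_0)
  have [measurable]: "u \<in> borel_measurable M" using u by (simp add: L2_functions_def)
  obtain s where s: "\<And>i::nat. simple_function M (s i)" "\<And>x. x \<in> space M \<Longrightarrow> (\<lambda>i. s i x) \<longlonglongrightarrow> u x"
      "\<And>i x. x \<in> space M \<Longrightarrow> dist (s i x) 0 \<le> 2 * dist (u x) 0"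
    using borel_measurable_implies_sequence_metric[OF \<open>u \<in> borel_measurable M\<close>, of 0] by blast
  have [measurable]: "s i \<in> borel_measurable M" for i using s(1) by (rule borel_measurable_simple_function)
  have approx_s: "approx (\<lambda>x. \<Sum>y\<in>s i ` space M. indicator (s i -` {y} \<inter> space M) x * y)" for i
    using s(1)[of i] by (intro approx_sum approx_scale approx_ind) (auto simp: simple_function_def)
  have s_eq: "s i x = (\<Sum>y\<in>s i ` space M. indicator (s i -` {y} \<inter> space M) x * y)" if "x \<in> space M" for i x
    using simple_function_indicator_representation_banach[OF s(1) that, of i] unfolding real_scaleR_def .
  have "(\<lambda>i. \<integral>\<^sup>+x. ennreal ((u x - s i x)\<^sup>2) \<partial>M) \<longlonglongrightarrow> (\<integral>\<^sup>+x. 0 \<partial>M)"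
  proof (rule nn_integral_dominated_convergence[where w = "\<lambda>x. ennreal (9 * (u x)\<^sup>2)"])
    show "AE x in M. ennreal ((u x - s i x)\<^sup>2) \<le> ennreal (9 * (u x)\<^sup>2)" for i
    proof (rule AE_I2, rule ennreal_leI)
      fix x assume "x \<in> space M"
      then have "\<bar>u x - s i x\<bar> \<le> \<bar>3 * u x\<bar>" using s(3)[of x i] by (auto simp: dist_real_def)
      then have "(u x - s i x)\<^sup>2 \<le> (3 * u x)\<^sup>2" by (simp add: abs_le_square_iff)
      then show "(u x - s i x)\<^sup>2 \<le> 9 * (u x)\<^sup>2" by (simp add: power_mult_distrib)
    qed
    have "(\<integral>\<^sup>+x. ennreal (9 * (u x)\<^sup>2) \<partial>M) = 9 * (\<integral>\<^sup>+x. ennreal ((u x)\<^sup>2) \<partial>M)"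
      by (simp add: ennreal_mult nn_integral_cmult)
    then show "(\<integral>\<^sup>+x. ennreal (9 * (u x)\<^sup>2) \<partial>M) < \<infinity>"
      using u by (simp add: L2_functions_iff ennreal_mult_less_top)
    show "AE x in M. (\<lambda>i. ennreal ((u x - s i x)\<^sup>2)) \<longlonglongrightarrow> 0"
    proof (rule AE_I2)
      fix x assume "x \<in> space M"
      then have "(\<lambda>i. ennreal ((u x - s i x)\<^sup>2)) \<longlonglongrightarrow> ennreal ((u x - u x)\<^sup>2)"
        by (intro tendsto_intros s)
      then show "(\<lambda>i. ennreal ((u x - s i x)\<^sup>2)) \<longlonglongrightarrow> 0" by simp
    qed
  qed measurable
  then have "eventually (\<lambda>i. (\<integral>\<^sup>+x. ennreal ((u x - s i x)\<^sup>2) \<partial>M) < ennreal (e / 4)) sequentially"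
    using e by (intro order_tendstoD) auto
  then obtain i where i: "(\<integral>\<^sup>+x. ennreal ((u x - s i x)\<^sup>2) \<partial>M) < ennreal (e / 4)"
    by (auto simp: eventually_sequentially)
  define t where "t x = (\<Sum>y\<in>s i ` space M. indicator (s i -` {y} \<inter> space M) x * y)" for x
  have t: "approx t" unfolding t_def by (rule approx_s)
  \<comment> \<open>The small summand \<open>u - t\<close> is approximated by the zero
    function.\<close>
  have "\<exists>g. continuous_on UNIV g \<and> (\<integral>\<^sup>+x. ennreal ((t x + (u x - t x) - g x)\<^sup>2) \<partial>M) \<le> ennreal e"
  proof (rule near)
    have "(\<integral>\<^sup>+x. ennreal ((u x - t x - 0)\<^sup>2) \<partial>M) = (\<integral>\<^sup>+x. ennreal ((u x - s i x)\<^sup>2) \<partial>M)"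
      by (intro nn_integral_cong) (simp only: t_def s_eq[symmetric] diff_zero)
    then show "\<exists>g. continuous_on UNIV g \<and> (\<integral>\<^sup>+x. ennreal ((u x - t x - g x)\<^sup>2) \<partial>M) \<le> ennreal (e / 4)"
      using i by (intro exI[of _ "\<lambda>_. 0"]) auto
  qed (use t e in \<open>auto simp: approx_def\<close>)
  then show ?thesis by simp
qed


section \<open>Jump-type Dirichlet forms\<close>

text \<open>The kernel stands in the denominator; where it vanishes, as a power of the distance does
  on the diagonal, the quotient is 0 by convention.\<close>

locale jump_form = finite_measure M
  for M :: "'a measure" and k :: "'a \<Rightarrow> 'a \<Rightarrow> real" +
  assumes kernel_measurable [measurable]: "case_prod k \<in> borel_measurable (M \<Otimes>\<^sub>M M)"
    and kernel_nonneg: "0 \<le> k x y"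
begin

definition energy :: "('a \<Rightarrow> real) \<Rightarrow> ennreal" where
  "energy u = (\<integral>\<^sup>+x. (\<integral>\<^sup>+y. ennreal ((u x - u y)\<^sup>2 / k x y) \<partial>M) \<partial>M)"

definition domain :: "('a \<Rightarrow> real) set" where
  "domain = {u \<in> L2_functions M. energy u < \<infinity>}"

definition form :: "('a \<Rightarrow> real) \<Rightarrow> ('a \<Rightarrow> real) \<Rightarrow> real" where
  "form u v = (enn2real (energy (\<lambda>x. u x + v x)) - enn2real (energy (\<lambda>x. u x - v x))) / 4"

text \<open>Visibly bilinear, whereas \<open>form\<close> is given by polarization;
  \<open>form_eq_bilin\<close> identifies the two on \<open>domain\<close>.\<close>

definition bilin :: "('a \<Rightarrow> real) \<Rightarrow> ('a \<Rightarrow> real) \<Rightarrow> real" where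
  "bilin u v = (\<integral>(x, y). (u x - u y) * (v x - v y) / k x y \<partial>(M \<Otimes>\<^sub>M M))"

lemma domain_measurable: "u \<in> domain \<Longrightarrow> u \<in> borel_measurable M"
  by (simp add: domain_def L2_functions_def)

lemma energy_cong_AE:
  assumes "AE x in M. u x = v x"
  shows "energy u = energy v"
  unfolding energy_def
proof (rule nn_integral_cong_AE, use assms in eventually_elim)
  case (elim x)
  from assms show ?case
    by (intro nn_integral_cong_AE) (auto elim!: eventually_mono simp: elim)
qed

lemma energy_pair:
  assumes [measurable]: "u \<in> borel_measurable M"
  shows "energy u = (\<integral>\<^sup>+(x, y). ennreal ((u x - u y)\<^sup>2 / k x y) \<partial>(M \<Otimes>\<^sub>M M))"
proof -
  have "(\<lambda>(x, y). ennreal ((u x - u y)\<^sup>2 / k x y)) \<in> borel_measurable (M \<Otimes>\<^sub>M M)" by measurable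
  from nn_integral_fst[OF this] show ?thesis by (simp add: energy_def)
qed

lemma integrable_square:
  assumes "u \<in> domain"
  shows "integrable (M \<Otimes>\<^sub>M M) (\<lambda>(x, y). (u x - u y)\<^sup>2 / k x y)"
proof -
  have [measurable]: "u \<in> borel_measurable M" using assms by (rule domain_measurable)
  have "(\<integral>\<^sup>+p. ennreal (norm (case p of (x, y) \<Rightarrow> (u x - u y)\<^sup>2 / k x y)) \<partial>(M \<Otimes>\<^sub>M M)) = energy u"
    unfolding energy_pair[OF domain_measurable[OF assms]]
    by (intro nn_integral_cong) (auto simp: kernel_nonneg)
  moreover have "energy u < \<infinity>" using assms by (simp add: domain_def)
  ultimately show ?thesis by (intro integrableI_bounded) auto
qed

lemma integrable_bilin:
  assumes "u \<in> domain" "v \<in> domain"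
  shows "integrable (M \<Otimes>\<^sub>M M) (\<lambda>(x, y). (u x - u y) * (v x - v y) / k x y)"
proof (rule Bochner_Integration.integrable_bound[OF Bochner_Integration.integrable_add[OF assms[THEN integrable_square]]])
  have [measurable]: "u \<in> borel_measurable M" "v \<in> borel_measurable M" using assms by (auto intro: domain_measurable)
  show "(\<lambda>(x, y). (u x - u y) * (v x - v y) / k x y) \<in> borel_measurable (M \<Otimes>\<^sub>M M)" by measurable
  have "\<bar>a * b\<bar> \<le> a\<^sup>2 + b\<^sup>2" for a b :: real
    using sum_squares_bound[of a b] sum_squares_bound[of a "-b"] by (auto simp: abs_if)
  then have "\<bar>a * b\<bar> / c \<le> a\<^sup>2 / c + b\<^sup>2 / c" if "0 \<le> c" for a b c :: real
    using that by (simp add: add_divide_distrib[symmetric] divide_right_mono)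
  then show "AE p in M \<Otimes>\<^sub>M M. norm (case p of (x, y) \<Rightarrow> (u x - u y) * (v x - v y) / k x y) \<le>
      norm ((case p of (x, y) \<Rightarrow> (u x - u y)\<^sup>2 / k x y) + (case p of (x, y) \<Rightarrow> (v x - v y)\<^sup>2 / k x y))"
    using kernel_nonneg by (intro AE_I2) (auto simp: abs_mult split: prod.split)
qed

lemma energy_eq_bilin:
  assumes "u \<in> domain"
  shows "energy u = ennreal (bilin u u)"
proof -
  have "ennreal (bilin u u) = (\<integral>\<^sup>+p. ennreal (case p of (x, y) \<Rightarrow> (u x - u y)\<^sup>2 / k x y) \<partial>(M \<Otimes>\<^sub>M M))"
    unfolding bilin_def power2_eq_square[symmetric]
    by (rule nn_integral_eq_integral[OF integrable_square[OF assms], symmetric]) (auto simp: kernel_nonneg)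
  also have "\<dots> = energy u"
    unfolding energy_pair[OF domain_measurable[OF assms]] by (intro nn_integral_cong) auto
  finally show ?thesis by simp
qed

lemma bilin_nonneg: "0 \<le> bilin u u"
  unfolding bilin_def power2_eq_square[symmetric]
  by (rule Bochner_Integration.integral_nonneg) (auto simp: kernel_nonneg)

lemma energy_add_le:
  assumes [measurable]: "u \<in> borel_measurable M" "v \<in> borel_measurable M"
  shows "energy (\<lambda>x. u x + v x) \<le> 2 * energy u + 2 * energy v"
proof -
  have "energy (\<lambda>x. u x + v x) \<le>
      (\<integral>\<^sup>+(x, y). 2 * ennreal ((u x - u y)\<^sup>2 / k x y) + 2 * ennreal ((v x - v y)\<^sup>2 / k x y) \<partial>(M \<Otimes>\<^sub>M M))"
    unfolding energy_pair[OF borel_measurable_add[OF assms]]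
  proof (rule nn_integral_mono, clarify)
    fix x y
    have "((u x + v x) - (u y + v y))\<^sup>2 / k x y \<le> (2 * (u x - u y)\<^sup>2 + 2 * (v x - v y)\<^sup>2) / k x y"
      using square_add_le[of "u x - u y" "v x - v y"] kernel_nonneg
      by (intro divide_right_mono) (auto simp: algebra_simps)
    then have "ennreal (((u x + v x) - (u y + v y))\<^sup>2 / k x y) \<le>
        ennreal (2 * ((u x - u y)\<^sup>2 / k x y) + 2 * ((v x - v y)\<^sup>2 / k x y))"
      by (intro ennreal_leI) (simp add: add_divide_distrib)
    then show "ennreal (((u x + v x) - (u y + v y))\<^sup>2 / k x y) \<le>
        2 * ennreal ((u x - u y)\<^sup>2 / k x y) + 2 * ennreal ((v x - v y)\<^sup>2 / k x y)"
      using kernel_nonneg[of x y] by (simp add: ennreal_mult del: times_divide_eq_right)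
  qed
  also have "\<dots> = 2 * energy u + 2 * energy v"
    unfolding energy_pair[OF assms(1)] energy_pair[OF assms(2)] case_prod_unfold
    by (subst nn_integral_add) (auto simp: nn_integral_cmult)
  finally show ?thesis .
qed

lemma energy_scale:
  assumes [measurable]: "u \<in> borel_measurable M"
  shows "energy (\<lambda>x. c * u x) = ennreal (c\<^sup>2) * energy u"
proof -
  have "ennreal ((c * u x - c * u y)\<^sup>2 / k x y) = ennreal (c\<^sup>2) * ennreal ((u x - u y)\<^sup>2 / k x y)" for x y
    using kernel_nonneg[of x y]
    by (subst ennreal_mult[symmetric]) (auto simp: right_diff_distrib[symmetric] power_mult_distrib)
  then have "energy (\<lambda>x. c * u x) = (\<integral>\<^sup>+(x, y). ennreal (c\<^sup>2) * ennreal ((u x - u y)\<^sup>2 / k x y) \<partial>(M \<Otimes>\<^sub>M M))"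
    by (subst energy_pair) auto
  also have "\<dots> = ennreal (c\<^sup>2) * energy u"
    unfolding energy_pair[OF assms] case_prod_unfold by (rule nn_integral_cmult) measurable
  finally show ?thesis .
qed

lemma energy_contraction:
  assumes "\<And>x y. x \<in> space M \<Longrightarrow> y \<in> space M \<Longrightarrow> \<bar>v x - v y\<bar> \<le> \<bar>u x - u y\<bar>"
  shows "energy v \<le> energy u"
  unfolding energy_def using assms kernel_nonneg
  by (intro nn_integral_mono ennreal_leI divide_right_mono) (auto simp: abs_le_square_iff[symmetric])

lemma zero_domain: "(\<lambda>x. 0) \<in> domain"
  by (simp add: domain_def L2_functions_def energy_def)

lemma add_domain: "u \<in> domain \<Longrightarrow> v \<in> domain \<Longrightarrow> (\<lambda>x. u x + v x) \<in> domain"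
  using energy_add_le[of u v] L2_functions_add[of u M v] domain_measurable[of u] domain_measurable[of v]
  by (auto simp: domain_def ennreal_mult_less_top intro: le_less_trans)

lemma scale_domain: "u \<in> domain \<Longrightarrow> (\<lambda>x. c * u x) \<in> domain"
  using energy_scale[of u c] L2_functions_scale[of u M c] domain_measurable[of u]
  by (auto simp: domain_def ennreal_mult_less_top)

lemma diff_domain: "u \<in> domain \<Longrightarrow> v \<in> domain \<Longrightarrow> (\<lambda>x. u x - v x) \<in> domain"
  using add_domain[of u "\<lambda>x. -1 * v x"] scale_domain[of v "-1"] by simp

lemma domain_AE_closed:
  assumes "u \<in> domain" "v \<in> L2_functions M" "AE x in M. u x = v x"
  shows "v \<in> domain"
  using assms energy_cong_AE[OF assms(3)] by (auto simp: domain_def)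

lemma form_eq_bilin:
  assumes "u \<in> domain" "v \<in> domain"
  shows "form u v = bilin u v"
proof -
  let ?N = "M \<Otimes>\<^sub>M M"
  note int = integrable_bilin[OF assms(1) assms(1)] integrable_bilin[OF assms(1) assms(2)]
    integrable_bilin[OF assms(2) assms(2)]
  have plus: "bilin (\<lambda>x. u x + v x) (\<lambda>x. u x + v x) = bilin u u + 2 * bilin u v + bilin v v"
  proof -
    have "bilin (\<lambda>x. u x + v x) (\<lambda>x. u x + v x) =
        (\<integral>p. (case p of (x, y) \<Rightarrow> (u x - u y) * (u x - u y) / k x y) +
          2 * (case p of (x, y) \<Rightarrow> (u x - u y) * (v x - v y) / k x y) +
          (case p of (x, y) \<Rightarrow> (v x - v y) * (v x - v y) / k x y) \<partial>?N)"
      unfolding bilin_def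
      by (intro Bochner_Integration.integral_cong) (auto simp: add_divide_distrib[symmetric] algebra_simps)
    then show ?thesis
      unfolding bilin_def by (simp add: int)
  qed
  have minus: "bilin (\<lambda>x. u x - v x) (\<lambda>x. u x - v x) = bilin u u - 2 * bilin u v + bilin v v"
  proof -
    have "bilin (\<lambda>x. u x - v x) (\<lambda>x. u x - v x) =
        (\<integral>p. (case p of (x, y) \<Rightarrow> (u x - u y) * (u x - u y) / k x y) -
          2 * (case p of (x, y) \<Rightarrow> (u x - u y) * (v x - v y) / k x y) +
          (case p of (x, y) \<Rightarrow> (v x - v y) * (v x - v y) / k x y) \<partial>?N)"
      unfolding bilin_def
      by (intro Bochner_Integration.integral_cong)
         (auto simp: add_divide_distrib[symmetric] diff_divide_distrib[symmetric] algebra_simps)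
    then show ?thesis
      unfolding bilin_def by (simp add: int)
  qed
  show ?thesis
    unfolding form_def energy_eq_bilin[OF add_domain[OF assms]] energy_eq_bilin[OF diff_domain[OF assms]]
    by (simp add: bilin_nonneg) (simp add: plus minus)
qed

lemma form_diag: "u \<in> domain \<Longrightarrow> ennreal (form u u) = energy u"
  by (simp add: form_eq_bilin energy_eq_bilin)

lemma form_nonneg: "u \<in> domain \<Longrightarrow> 0 \<le> form u u"
  by (simp add: form_eq_bilin bilin_nonneg)

text \<open>Carries the real-valued norm over to nonnegative extended integrals, where Fatou's lemma
  and monotonicity are at hand.\<close>

lemma form_norm1_less_iff:
  assumes "u \<in> domain" "0 < e"
  shows "form_norm1 M form u < e \<longleftrightarrow> energy u + (\<integral>\<^sup>+x. ennreal ((u x)\<^sup>2) \<partial>M) < ennreal (e\<^sup>2)"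
proof -
  have "energy u + (\<integral>\<^sup>+x. ennreal ((u x)\<^sup>2) \<partial>M) = ennreal (form u u + (L2_norm M u)\<^sup>2)"
    using assms(1) form_nonneg[OF assms(1)]
    by (simp add: form_diag L2_norm_square domain_measurable) (simp add: domain_def L2_functions_iff)
  moreover have "form_norm1 M form u < e \<longleftrightarrow> form u u + (L2_norm M u)\<^sup>2 < e\<^sup>2"
    unfolding form_norm1_def using \<open>0 < e\<close> form_nonneg[OF assms(1)]
    by (metis abs_of_pos real_sqrt_abs real_sqrt_less_iff)
  ultimately show ?thesis
    using form_nonneg[OF assms(1)] by (simp add: ennreal_less_iff del: ennreal_plus)
qed

text \<open>Fatou's lemma is applied twice, in \<open>y\<close> for almost every \<open>x\<close>
  and then in \<open>x\<close>.\<close>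

lemma energy_fatou:
  fixes w :: "nat \<Rightarrow> 'a \<Rightarrow> real"
  assumes [measurable]: "\<And>n. w n \<in> borel_measurable M"
    and lim: "AE x in M. (\<lambda>n. w n x) \<longlonglongrightarrow> v x"
    and le: "\<And>n. n \<ge> N \<Longrightarrow> energy (w n) \<le> C"
  shows "energy v \<le> C"
proof -
  define I where "I n x = (\<integral>\<^sup>+y. ennreal ((w n x - w n y)\<^sup>2 / k x y) \<partial>M)" for n x
  have I_meas: "I n \<in> borel_measurable M" for n
    unfolding I_def by measurable
  have "energy v \<le> (\<integral>\<^sup>+x. liminf (\<lambda>n. I n x) \<partial>M)"
    unfolding energy_def
  proof (rule nn_integral_mono_AE, use lim AE_space in eventually_elim)
    case (elim x)
    then have meas: "(\<lambda>y. ennreal ((w n x - w n y)\<^sup>2 / k x y)) \<in> borel_measurable M" for n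
      by measurable
    have "(\<integral>\<^sup>+y. ennreal ((v x - v y)\<^sup>2 / k x y) \<partial>M) =
        (\<integral>\<^sup>+y. liminf (\<lambda>n. ennreal ((w n x - w n y)\<^sup>2 / k x y)) \<partial>M)"
    proof (rule nn_integral_cong_AE, use lim in eventually_elim)
      case (elim y)
      with \<open>(\<lambda>n. w n x) \<longlonglongrightarrow> v x\<close>
      have "(\<lambda>n. ennreal ((w n x - w n y)\<^sup>2 / k x y)) \<longlonglongrightarrow> ennreal ((v x - v y)\<^sup>2 / k x y)"
        unfolding divide_inverse by (intro tendsto_intros)
      then show ?case by (simp add: lim_imp_Liminf)
    qed
    also have "\<dots> \<le> liminf (\<lambda>n. I n x)"
      unfolding I_def by (rule nn_integral_liminf[OF meas])
    finally show ?case .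
  qed
  also have "\<dots> \<le> liminf (\<lambda>n. \<integral>\<^sup>+x. I n x \<partial>M)"
    using I_meas by (rule nn_integral_liminf)
  also have "\<dots> \<le> C"
    using le by (intro Liminf_le) (auto simp: eventually_sequentially energy_def I_def)
  finally show ?thesis .
qed

text \<open>A fast subsequence converges almost everywhere. Lower semicontinuity of the energy and
  of the L2 norm turns the Cauchy bounds on \<open>U m x - U (r n) x\<close> into bounds on
  \<open>U m x - v x\<close>.\<close>

lemma domain_complete:
  assumes U: "\<And>n. U n \<in> domain"
    and cauchy: "\<And>e. 0 < e \<Longrightarrow> \<exists>N. \<forall>m\<ge>N. \<forall>n\<ge>N. form_norm1 M form (\<lambda>x. U m x - U n x) < e"
  shows "\<exists>v\<in>domain. (\<lambda>n. form_norm1 M form (\<lambda>x. U n x - v x)) \<longlonglongrightarrow> 0"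
proof -
  have [measurable]: "U n \<in> borel_measurable M" for n using U domain_measurable by blast
  have "\<exists>N. \<forall>m\<ge>N. \<forall>n\<ge>N. form_norm1 M form (\<lambda>x. U m x - U n x) < (1 / 2) ^ j" for j
    by (rule cauchy) simp
  then obtain N where N: "\<And>j m n. N j \<le> m \<Longrightarrow> N j \<le> n \<Longrightarrow> form_norm1 M form (\<lambda>x. U m x - U n x) < (1 / 2) ^ j"
    by metis
  have G: "energy (\<lambda>x. U m x - U n x) + (\<integral>\<^sup>+x. ennreal ((U m x - U n x)\<^sup>2) \<partial>M) < ennreal ((1 / 4) ^ j)"
    if "N j \<le> m" "N j \<le> n" for j m n
  proof -
    have "((1 / 2) ^ j)\<^sup>2 = (1 / 4 :: real) ^ j" by (simp add: power_mult[symmetric] power2_eq_square power_mult_distrib[symmetric])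
    then show ?thesis
      using N[OF that] form_norm1_less_iff[OF diff_domain[OF U U], of "(1 / 2) ^ j" m n] by simp
  qed
  have energy_le: "energy (\<lambda>x. U m x - U n x) \<le> ennreal ((1 / 4) ^ j)"
    and L2_le: "(\<integral>\<^sup>+x. ennreal ((U m x - U n x)\<^sup>2) \<partial>M) \<le> ennreal ((1 / 4) ^ j)"
    if "N j \<le> m" "N j \<le> n" for j m n
    using G[OF that] by (meson add_increasing add_increasing2 le_less_trans less_imp_le order_refl zero_le order_trans)+
  \<comment> \<open>The sum dominates all of \<open>N 0\<close>, ..., \<open>N j\<close>, so
    \<open>r n\<close> is late enough for every accuracy up to \<open>n\<close>.\<close>
  define r where "r j = (\<Sum>i\<le>j. N i)" for j
  have r: "N j \<le> r n" if "j \<le> n" for j n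
    unfolding r_def using that by (intro member_le_sum) auto
  have "AE x in M. convergent (\<lambda>n. U (r n) x)"
    by (intro AE_convergent_of_fast_cauchy L2_le r) auto
  define v where "v x = lim (\<lambda>n. U (r n) x)" for x
  have [measurable]: "v \<in> borel_measurable M" unfolding v_def by measurable
  have lim: "AE x in M. (\<lambda>n. U (r n) x) \<longlonglongrightarrow> v x"
    using \<open>AE x in M. convergent (\<lambda>n. U (r n) x)\<close> by eventually_elim (simp add: v_def convergent_LIMSEQ_iff)
  have energy_v: "energy (\<lambda>x. U m x - v x) \<le> ennreal ((1 / 4) ^ j)" if "N j \<le> m" for j m
  proof (rule energy_fatou[where w = "\<lambda>n x. U m x - U (r n) x" and N = j])
    show "AE x in M. (\<lambda>n. U m x - U (r n) x) \<longlonglongrightarrow> U m x - v x"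
      using lim by eventually_elim (intro tendsto_intros)
  qed (use that r energy_le in auto)
  have L2_v: "(\<integral>\<^sup>+x. ennreal ((U m x - v x)\<^sup>2) \<partial>M) \<le> ennreal ((1 / 4) ^ j)" if "N j \<le> m" for j m
  proof (rule nn_integral_fatou_le[where f = "\<lambda>n x. ennreal ((U m x - U (r n) x)\<^sup>2)" and N = j])
    show "AE x in M. (\<lambda>n. ennreal ((U m x - U (r n) x)\<^sup>2)) \<longlonglongrightarrow> ennreal ((U m x - v x)\<^sup>2)"
      using lim by eventually_elim (intro tendsto_intros)
  qed (use that r L2_le in auto)
  have diff: "(\<lambda>x. U m x - v x) \<in> domain" if "N 0 \<le> m" for m
    using energy_v[OF that] L2_v[OF that] by (auto simp: domain_def L2_functions_iff intro: le_less_trans)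
  \<comment> \<open>\<open>v\<close> enters the domain as a difference of two of its
    elements.\<close>
  have "(\<lambda>x. U (N 0) x - (U (N 0) x - v x)) \<in> domain"
    by (intro diff_domain U diff) simp
  then have v: "v \<in> domain" by simp
  moreover have "(\<lambda>n. form_norm1 M form (\<lambda>x. U n x - v x)) \<longlonglongrightarrow> 0"
  proof (rule LIMSEQ_I)
    fix e :: real assume "0 < e"
    then obtain j where j: "(1 / 4) ^ j < e\<^sup>2 / 2"
      using real_arch_pow_inv[of "e\<^sup>2 / 2" "1 / 4"] by auto
    have "norm (form_norm1 M form (\<lambda>x. U n x - v x) - 0) < e" if "N j \<le> n" for n
    proof -
      have "energy (\<lambda>x. U n x - v x) + (\<integral>\<^sup>+x. ennreal ((U n x - v x)\<^sup>2) \<partial>M) \<le> ennreal ((1 / 4) ^ j) + ennreal ((1 / 4) ^ j)"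
        using energy_v[OF that] L2_v[OF that] by (rule add_mono)
      also have "\<dots> = ennreal (2 * (1 / 4) ^ j)" by (subst ennreal_plus[symmetric]) auto
      also have "\<dots> < ennreal (e\<^sup>2)" using j by (intro ennreal_lessI) (auto simp: \<open>0 < e\<close>)
      finally have "form_norm1 M form (\<lambda>x. U n x - v x) < e"
        using form_norm1_less_iff[OF diff_domain[OF U v] \<open>0 < e\<close>] by blast
      moreover have "0 \<le> form_norm1 M form (\<lambda>x. U n x - v x)"
        using form_nonneg[OF diff_domain[OF U v]] by (simp add: form_norm1_def)
      ultimately show ?thesis by simp
    qed
    then show "\<exists>no. \<forall>n\<ge>no. norm (form_norm1 M form (\<lambda>x. U n x - v x) - 0) < e" by blast
  qed
  ultimately show ?thesis by blast
qed

lemma clamp_domain: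
  assumes "u \<in> domain"
  shows "(\<lambda>x. min (max (u x) 0) 1) \<in> domain"
    and "form (\<lambda>x. min (max (u x) 0) 1) (\<lambda>x. min (max (u x) 0) 1) \<le> form u u"
proof -
  let ?v = "\<lambda>x. min (max (u x) 0) 1"
  have [measurable]: "u \<in> borel_measurable M" using assms by (rule domain_measurable)
  have le: "energy ?v \<le> energy u"
    by (rule energy_contraction) (auto simp: min_def max_def)
  have "?v \<in> L2_functions M"
    by (rule L2_functions_bounded[where B = 1]) auto
  with le assms show v: "?v \<in> domain" by (auto simp: domain_def)
  show "form ?v ?v \<le> form u u"
    using le unfolding form_diag[OF assms, symmetric] form_diag[OF v, symmetric]
    by (simp add: form_nonneg assms)
qed

text \<open>Leibniz rule: the increment of the product is
  \<open>u x * (v x - v y) + v y * (u x - u y)\<close>. It provides the algebra for the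
  Stone-Weierstrass theorem.\<close>

lemma energy_mult_finite:
  assumes u: "u \<in> domain" and v: "v \<in> domain"
    and B: "\<And>x. x \<in> space M \<Longrightarrow> \<bar>u x\<bar> \<le> B" "\<And>x. x \<in> space M \<Longrightarrow> \<bar>v x\<bar> \<le> B"
  shows "(\<lambda>x. u x * v x) \<in> domain"
proof -
  have [measurable]: "u \<in> borel_measurable M" "v \<in> borel_measurable M" using u v by (auto intro: domain_measurable)
  have "energy (\<lambda>x. u x * v x) \<le>
      (\<integral>\<^sup>+(x, y). ennreal (2 * B\<^sup>2) * (ennreal ((u x - u y)\<^sup>2 / k x y) + ennreal ((v x - v y)\<^sup>2 / k x y)) \<partial>(M \<Otimes>\<^sub>M M))"
    unfolding energy_pair[OF borel_measurable_times[OF \<open>u \<in> borel_measurable M\<close> \<open>v \<in> borel_measurable M\<close>]]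
  proof (rule nn_integral_mono, clarify)
    fix x y assume "(x, y) \<in> space (M \<Otimes>\<^sub>M M)"
    then have xy: "x \<in> space M" "y \<in> space M" by (auto simp: space_pair_measure)
    have "(u x * v x - u y * v y)\<^sup>2 = (u x * (v x - v y) + v y * (u x - u y))\<^sup>2" by (simp add: algebra_simps)
    also have "\<dots> \<le> 2 * (u x * (v x - v y))\<^sup>2 + 2 * (v y * (u x - u y))\<^sup>2" by (rule square_add_le)
    also have "\<dots> \<le> 2 * (B\<^sup>2 * (v x - v y)\<^sup>2) + 2 * (B\<^sup>2 * (u x - u y)\<^sup>2)"
      unfolding power_mult_distrib
      using B(1)[OF xy(1)] B(2)[OF xy(2)]
      by (intro add_mono mult_left_mono mult_right_mono abs_le_square_iff[THEN iffD1]) auto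
    finally have "(u x * v x - u y * v y)\<^sup>2 / k x y \<le>
        (2 * (B\<^sup>2 * (v x - v y)\<^sup>2) + 2 * (B\<^sup>2 * (u x - u y)\<^sup>2)) / k x y"
      by (rule divide_right_mono) (rule kernel_nonneg)
    also have "\<dots> = 2 * B\<^sup>2 * ((u x - u y)\<^sup>2 / k x y + (v x - v y)\<^sup>2 / k x y)"
      by (simp add: add_divide_distrib algebra_simps)
    finally show "ennreal ((u x * v x - u y * v y)\<^sup>2 / k x y) \<le>
        ennreal (2 * B\<^sup>2) * (ennreal ((u x - u y)\<^sup>2 / k x y) + ennreal ((v x - v y)\<^sup>2 / k x y))"
      using kernel_nonneg[of x y]
      by (subst ennreal_plus[symmetric], simp, simp, subst ennreal_mult[symmetric]) (auto intro!: ennreal_leI)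
  qed
  also have "\<dots> = ennreal (2 * B\<^sup>2) * (energy u + energy v)"
    unfolding energy_pair[OF domain_measurable[OF u]] energy_pair[OF domain_measurable[OF v]] case_prod_unfold
    by (subst nn_integral_cmult, measurable, subst nn_integral_add) auto
  also have "\<dots> < \<infinity>"
    using u v by (simp add: domain_def ennreal_mult_less_top)
  finally have "energy (\<lambda>x. u x * v x) < \<infinity>" .
  moreover have "(\<lambda>x. u x * v x) \<in> L2_functions M"
  proof (rule L2_functions_bounded[where B = "B * B"])
    fix x assume "x \<in> space M"
    then show "\<bar>u x * v x\<bar> \<le> B * B"
      unfolding abs_mult using B by (intro mult_mono) (auto intro: order_trans[OF abs_ge_zero])
  qed measurable
  ultimately show ?thesis by (simp add: domain_def)
qed

text \<open>Density is the one axiom that depends on the kernel; the others hold for every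
  nonnegative measurable kernel.\<close>

theorem dirichlet_form_jump:
  assumes dense: "\<And>u e. u \<in> L2_functions M \<Longrightarrow> 0 < e \<Longrightarrow> \<exists>v\<in>domain. L2_norm M (\<lambda>x. u x - v x) < e"
  shows "dirichlet_form M form domain"
proof
  show "domain \<subseteq> L2_functions M" by (auto simp: domain_def)
  show "form u v = form u' v" if "u \<in> domain" "u' \<in> domain" "v \<in> domain" "AE x in M. u x = u' x" for u u' v
  proof -
    have "energy (\<lambda>x. u x + v x) = energy (\<lambda>x. u' x + v x)" "energy (\<lambda>x. u x - v x) = energy (\<lambda>x. u' x - v x)"
      using that(4) by (auto intro!: energy_cong_AE elim!: eventually_mono)
    then show ?thesis by (simp add: form_def)
  qed
  show "form u v = form v u" if "u \<in> domain" "v \<in> domain" for u v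
    using that by (simp add: form_eq_bilin bilin_def mult.commute)
  show "form (\<lambda>x. u x + v x) w = form u w + form v w" if "u \<in> domain" "v \<in> domain" "w \<in> domain" for u v w
  proof -
    have "bilin (\<lambda>x. u x + v x) w = (\<integral>p. (case p of (x, y) \<Rightarrow> (u x - u y) * (w x - w y) / k x y) +
        (case p of (x, y) \<Rightarrow> (v x - v y) * (w x - w y) / k x y) \<partial>(M \<Otimes>\<^sub>M M))"
      unfolding bilin_def
      by (intro Bochner_Integration.integral_cong) (auto simp: add_divide_distrib[symmetric] algebra_simps)
    also have "\<dots> = bilin u w + bilin v w"
      unfolding bilin_def using that by (intro Bochner_Integration.integral_add integrable_bilin)
    finally show ?thesis using that by (simp add: form_eq_bilin add_domain)
  qed
  show "form (\<lambda>x. c * u x) v = c * form u v" if "u \<in> domain" "v \<in> domain" for u v c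
  proof -
    have "bilin (\<lambda>x. c * u x) v = (\<integral>p. c * (case p of (x, y) \<Rightarrow> (u x - u y) * (v x - v y) / k x y) \<partial>(M \<Otimes>\<^sub>M M))"
      unfolding bilin_def
      by (intro Bochner_Integration.integral_cong) (auto simp: algebra_simps)
    also have "\<dots> = c * bilin u v"
      unfolding bilin_def by simp
    finally show ?thesis using that by (simp add: form_eq_bilin scale_domain)
  qed
qed (use dense in \<open>auto intro: domain_AE_closed zero_domain add_domain scale_domain form_nonneg
      domain_complete clamp_domain\<close>)

end


section \<open>Averages and the jump energy\<close>

definition (in finite_measure) mean :: "('a \<Rightarrow> real) \<Rightarrow> 'a set \<Rightarrow> real" where
  "mean u A = (\<integral>x. indicator A x * u x \<partial>M) / measure M A"

context finite_measure
begin

lemma L2_functions_integrable: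
  assumes "u \<in> L2_functions M"
  shows "integrable M u"
proof (rule Bochner_Integration.integrable_bound)
  show "integrable M (\<lambda>x. (u x)\<^sup>2 + 1)" using assms by (auto simp: L2_functions_def)
  show "u \<in> borel_measurable M" using assms by (simp add: L2_functions_def)
  have "\<bar>a\<bar> \<le> a\<^sup>2 + 1" for a :: real
    using sum_squares_bound[of "\<bar>a\<bar>" 1] abs_ge_zero[of a] by (simp del: abs_ge_zero)
  then show "AE x in M. norm (u x) \<le> norm ((u x)\<^sup>2 + 1)"
    by (intro AE_I2) (simp add: order_trans[OF _ abs_ge_self])
qed

lemma integrable_indicator_mult_L2:
  assumes "u \<in> L2_functions M" "A \<in> sets M"
  shows "integrable M (\<lambda>x. indicator A x * u x)"
  using integrable_mult_indicator[OF assms(2) L2_functions_integrable[OF assms(1)]] by simp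

lemma mean_bounds:
  assumes u: "u \<in> L2_functions M" and A: "A \<in> sets M" "0 < measure M A"
  shows "(\<And>x. x \<in> A \<Longrightarrow> u x \<le> b) \<Longrightarrow> mean u A \<le> b" and "(\<And>x. x \<in> A \<Longrightarrow> b \<le> u x) \<Longrightarrow> b \<le> mean u A"
proof -
  have const: "(\<integral>x. indicator A x * b \<partial>M) = b * measure M A"
    using A by (simp add: mult.commute)
  have int: "integrable M (\<lambda>x. indicator A x * b)"
    using A by (intro integrable_mult_left) (simp add: less_top[symmetric])
  { assume "\<And>x. x \<in> A \<Longrightarrow> u x \<le> b"
    then have "(\<integral>x. indicator A x * u x \<partial>M) \<le> (\<integral>x. indicator A x * b \<partial>M)"
      by (intro integral_mono integrable_indicator_mult_L2 u A int) (auto simp: indicator_def)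
    then show "mean u A \<le> b" using A by (simp add: mean_def const pos_divide_le_eq mult.commute) }
  { assume "\<And>x. x \<in> A \<Longrightarrow> b \<le> u x"
    then have "(\<integral>x. indicator A x * b \<partial>M) \<le> (\<integral>x. indicator A x * u x \<partial>M)"
      by (intro integral_mono integrable_indicator_mult_L2 u A int) (auto simp: indicator_def)
    then show "b \<le> mean u A" using A by (simp add: mean_def const pos_le_divide_eq mult.commute) }
qed

text \<open>The tangent line inequality \<open>(c - u)\<^sup>2 \<ge> (c - m)\<^sup>2 + 2 (c - m) (m - u)\<close> at the mean \<open>m\<close>.\<close>

lemma mean_deviation_le:
  assumes u: "u \<in> L2_functions M" and B: "B \<in> sets M" "0 < measure M B"
  shows "ennreal ((c - mean u B)\<^sup>2 * measure M B) \<le> (\<integral>\<^sup>+y. ennreal ((c - u y)\<^sup>2) * indicator B y \<partial>M)"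
proof -
  define m where "m = mean u B"
  have int: "integrable M (\<lambda>y. indicator B y * (c - u y)\<^sup>2)"
  proof -
    have "(\<lambda>y. c - u y) \<in> L2_functions M"
      using u L2_functions_bounded[of "\<lambda>_. c" "\<bar>c\<bar>"] by (intro L2_functions_diff) auto
    then have "integrable M (\<lambda>y. (c - u y)\<^sup>2)" by (simp add: L2_functions_def)
    from integrable_mult_indicator[OF B(1) this] show ?thesis by simp
  qed
  have intB: "integrable M (\<lambda>y. indicator B y :: real)"
    using B by (simp add: less_top[symmetric])
  have intu: "integrable M (\<lambda>y. indicator B y * u y)"
    by (rule integrable_indicator_mult_L2[OF u B(1)])
  have m: "(\<integral>y. indicator B y * u y \<partial>M) = m * measure M B"
    using B by (simp add: m_def mean_def)
  have "(\<integral>y. ((c - m)\<^sup>2 + 2 * (c - m) * m) * indicator B y - 2 * (c - m) * (indicator B y * u y) \<partial>M) =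
      ((c - m)\<^sup>2 + 2 * (c - m) * m) * measure M B - 2 * (c - m) * (m * measure M B)"
    using B by (subst Bochner_Integration.integral_diff) (auto intro: intB intu simp: m)
  also have "\<dots> = (c - m)\<^sup>2 * measure M B" by (simp add: algebra_simps)
  finally have "(c - m)\<^sup>2 * measure M B =
      (\<integral>y. ((c - m)\<^sup>2 + 2 * (c - m) * m) * indicator B y - 2 * (c - m) * (indicator B y * u y) \<partial>M)" by simp
  also have "\<dots> \<le> (\<integral>y. indicator B y * (c - u y)\<^sup>2 \<partial>M)"
  proof (intro integral_mono int Bochner_Integration.integrable_diff integrable_mult_right intB intu)
    fix y
    have "0 \<le> (m - u y)\<^sup>2" by simp
    then have "(c - m)\<^sup>2 + 2 * (c - m) * m - 2 * (c - m) * u y \<le> (c - u y)\<^sup>2"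
      by (simp add: power2_eq_square algebra_simps)
    then show "((c - m)\<^sup>2 + 2 * (c - m) * m) * indicator B y - 2 * (c - m) * (indicator B y * u y) \<le> indicator B y * (c - u y)\<^sup>2"
      by (simp add: indicator_def)
  qed
  finally have "ennreal ((c - m)\<^sup>2 * measure M B) \<le> ennreal (\<integral>y. indicator B y * (c - u y)\<^sup>2 \<partial>M)"
    by (rule ennreal_leI)
  also have "\<dots> = (\<integral>\<^sup>+y. ennreal (indicator B y * (c - u y)\<^sup>2) \<partial>M)"
    by (rule nn_integral_eq_integral[OF int, symmetric]) auto
  also have "\<dots> = (\<integral>\<^sup>+y. ennreal ((c - u y)\<^sup>2) * indicator B y \<partial>M)"
    by (intro nn_integral_cong) (auto simp: indicator_def)
  finally show ?thesis by (simp add: m_def)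
qed

end

context jump_form
begin

text \<open>Localizes the energy to a region of the product space, so that estimates on disjoint
  regions can be added.\<close>

definition partial_energy :: "('a \<Rightarrow> real) \<Rightarrow> ('a \<times> 'a) set \<Rightarrow> ennreal" where
  "partial_energy u W = (\<integral>\<^sup>+p. (case p of (x, y) \<Rightarrow> ennreal ((u x - u y)\<^sup>2 / k x y)) * indicator W p \<partial>(M \<Otimes>\<^sub>M M))"

text \<open>Jensen's inequality in each variable replaces the averages by point values, and the
  bound \<open>c\<close> on the kernel brings in the energy. Pairs with \<open>x = y\<close>
  contribute 0 on both sides.\<close>

lemma mean_diff_le_partial_energy:
  assumes u: "u \<in> L2_functions M" and A: "A \<in> sets M" "0 < measure M A" and B: "B \<in> sets M" "0 < measure M B"
    and le: "\<And>x y. x \<in> A \<Longrightarrow> y \<in> B \<Longrightarrow> k x y \<le> c" and pos: "\<And>x y. x \<noteq> y \<Longrightarrow> 0 < k x y" and c: "0 \<le> c"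
  shows "ennreal ((mean u A - mean u B)\<^sup>2 * measure M A * measure M B) \<le> ennreal c * partial_energy u (A \<times> B)"
proof -
  have [measurable]: "u \<in> borel_measurable M" using u by (simp add: L2_functions_def)
  note [measurable] = A(1) B(1)
  have "ennreal ((mean u A - mean u B)\<^sup>2 * measure M A * measure M B) =
      ennreal ((mean u B - mean u A)\<^sup>2 * measure M A) * ennreal (measure M B)"
    by (simp add: ennreal_mult[symmetric] power2_commute)
  also have "\<dots> \<le> (\<integral>\<^sup>+x. ennreal ((mean u B - u x)\<^sup>2) * indicator A x \<partial>M) * ennreal (measure M B)"
    by (intro mult_right_mono mean_deviation_le u A) simp
  also have "\<dots> = (\<integral>\<^sup>+x. ennreal ((u x - mean u B)\<^sup>2 * measure M B) * indicator A x \<partial>M)"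
    by (subst nn_integral_multc[symmetric], measurable)
       (intro nn_integral_cong, simp add: ennreal_mult power2_commute ac_simps)
  also have "\<dots> \<le> (\<integral>\<^sup>+x. (\<integral>\<^sup>+y. ennreal ((u x - u y)\<^sup>2) * indicator B y \<partial>M) * indicator A x \<partial>M)"
    by (intro nn_integral_mono mult_right_mono mean_deviation_le u B) simp
  also have "\<dots> = (\<integral>\<^sup>+x. (\<integral>\<^sup>+y. ennreal ((u x - u y)\<^sup>2) * indicator B y * indicator A x \<partial>M) \<partial>M)"
    by (intro nn_integral_cong nn_integral_multc[symmetric]) measurable
  also have "\<dots> \<le> (\<integral>\<^sup>+x. (\<integral>\<^sup>+y. ennreal c * (ennreal ((u x - u y)\<^sup>2 / k x y) * indicator (A \<times> B) (x, y)) \<partial>M) \<partial>M)"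
  proof (intro nn_integral_mono)
    fix x y
    show "ennreal ((u x - u y)\<^sup>2) * indicator B y * indicator A x \<le>
        ennreal c * (ennreal ((u x - u y)\<^sup>2 / k x y) * indicator (A \<times> B) (x, y))"
    proof (cases "x \<in> A \<and> y \<in> B \<and> x \<noteq> y")
      case True
      then have "0 < k x y" "k x y \<le> c" using pos le by auto
      then have "(u x - u y)\<^sup>2 \<le> c * ((u x - u y)\<^sup>2 / k x y)"
        by (simp add: pos_le_divide_eq mult.commute mult_right_mono)
      then have "ennreal ((u x - u y)\<^sup>2) \<le> ennreal c * ennreal ((u x - u y)\<^sup>2 / k x y)"
        using c kernel_nonneg by (subst ennreal_mult[symmetric]) (auto intro: ennreal_leI)
      with True show ?thesis by simp
    qed (auto simp: indicator_def)
  qed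
  also have "\<dots> = (\<integral>\<^sup>+p. ennreal c * ((case p of (x, y) \<Rightarrow> ennreal ((u x - u y)\<^sup>2 / k x y)) * indicator (A \<times> B) p) \<partial>(M \<Otimes>\<^sub>M M))"
  proof -
    have [measurable]: "A \<times> B \<in> sets (M \<Otimes>\<^sub>M M)" by (intro pair_measureI A B)
    have "(\<lambda>p. ennreal c * ((case p of (x, y) \<Rightarrow> ennreal ((u x - u y)\<^sup>2 / k x y)) * indicator (A \<times> B) p))
        \<in> borel_measurable (M \<Otimes>\<^sub>M M)" by measurable
    from nn_integral_fst[OF this] show ?thesis by simp
  qed
  also have "\<dots> = ennreal c * partial_energy u (A \<times> B)"
    unfolding partial_energy_def using pair_measureI[OF A(1) B(1)] by (intro nn_integral_cmult) measurable
  finally show ?thesis .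
qed

lemma partial_energy_le: 
  assumes "u \<in> borel_measurable M"
  shows "partial_energy u W \<le> energy u"
  unfolding partial_energy_def energy_pair[OF assms]
  by (intro nn_integral_mono) (auto simp: indicator_def)

lemma sum_partial_energy_le:
  assumes [measurable]: "u \<in> borel_measurable M" "\<And>i. i \<in> I \<Longrightarrow> W i \<in> sets (M \<Otimes>\<^sub>M M)"
    and I: "finite I" "disjoint_family_on W I"
  shows "(\<Sum>i\<in>I. partial_energy u (W i)) \<le> energy u"
proof -
  have "(\<Sum>i\<in>I. partial_energy u (W i)) =
      (\<integral>\<^sup>+p. (\<Sum>i\<in>I. (case p of (x, y) \<Rightarrow> ennreal ((u x - u y)\<^sup>2 / k x y)) * indicator (W i) p) \<partial>(M \<Otimes>\<^sub>M M))"
    unfolding partial_energy_def by (rule nn_integral_sum[symmetric]) measurable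
  also have "\<dots> = partial_energy u (\<Union>i\<in>I. W i)"
    unfolding partial_energy_def sum_distrib_left[symmetric]
    using I by (intro nn_integral_cong) (simp add: indicator_UN_disjoint)
  also have "\<dots> \<le> energy u" by (rule partial_energy_le) fact
  finally show ?thesis .
qed

end


section \<open>The non-local forms on the carpet\<close>

abbreviation carpet_kernel :: "real \<Rightarrow> real \<times> real \<Rightarrow> real \<times> real \<Rightarrow> real" where
  "carpet_kernel \<beta> x y \<equiv> dist x y powr (carpet_dim + \<beta>)"

lemma id_carpet_measurable [measurable]: "(\<lambda>x. x) \<in> measurable carpet_measure borel"
  unfolding measurable_cong_sets[OF sets_carpet_measure refl] by (rule measurable_restrict_space1) simp

lemma jump_form_carpet: "jump_form carpet_measure (carpet_kernel \<beta>)"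
proof -
  interpret finite_measure carpet_measure by (rule finite_measure_carpet)
  show ?thesis
  proof
    have "(\<lambda>p. fst p) \<in> measurable (carpet_measure \<Otimes>\<^sub>M carpet_measure) borel"
      "(\<lambda>p. snd p) \<in> measurable (carpet_measure \<Otimes>\<^sub>M carpet_measure) borel"
      by (rule measurable_compose[OF _ id_carpet_measurable], measurable)+
    note [measurable] = this
    show "(\<lambda>(x, y). carpet_kernel \<beta> x y) \<in> borel_measurable (carpet_measure \<Otimes>\<^sub>M carpet_measure)"
      unfolding case_prod_unfold by measurable
  qed simp
qed

interpretation carpet: jump_form carpet_measure "carpet_kernel \<beta>" for \<beta>
  by (rule jump_form_carpet)

lemma carpet_energy_eq: "carpet_energy \<beta> = carpet.energy \<beta>"
  by (simp add: fun_eq_iff carpet_energy_def carpet.energy_def)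

lemma carpet_domain_eq: "carpet_domain \<beta> = carpet.domain \<beta>"
  by (simp add: carpet_domain_def carpet.domain_def carpet_energy_eq)

lemma carpet_form_eq: "carpet_form \<beta> = carpet.form \<beta>"
  by (simp add: fun_eq_iff carpet_form_def carpet.form_def carpet_energy_eq)

lemma power_three_powr: "(3 ^ n :: real) powr \<beta> = (3 powr \<beta>) ^ n"
proof -
  have "(3 ^ n :: real) powr \<beta> = (3 powr \<beta>) powr real n"
    by (simp add: powr_realpow[symmetric] powr_powr mult.commute)
  then show ?thesis by (simp add: powr_realpow)
qed

text \<open>As \<open>3 powr carpet_dim = 8\<close>, the scale \<open>3 ^ n\<close> enters through
  \<open>8 ^ n * (3 powr \<beta>) ^ n\<close>.\<close>

lemma carpet_kernel_le:
  assumes "dist x y \<le> r / 3 ^ n" "0 \<le> r" "0 < \<beta>"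
  shows "carpet_kernel \<beta> x y \<le> r powr (carpet_dim + \<beta>) / (8 ^ n * (3 powr \<beta>) ^ n)"
proof -
  have "carpet_kernel \<beta> x y \<le> (r / 3 ^ n) powr (carpet_dim + \<beta>)"
    using assms carpet_dim_pos by (intro powr_mono2) auto
  then show ?thesis
    using assms by (simp add: powr_divide powr_add three_powr_carpet_dim power_three_powr)
qed

text \<open>The factors \<open>8 ^ m\<close> and \<open>8 ^ m'\<close> are inverse masses. Levels
  and distance scale are kept apart: the upper bound uses subcells one level below the distance
  scale, the continuity proof cells of consecutive levels.\<close>

lemma carpet_mean_diff_le:
  assumes u: "u \<in> L2_functions carpet_measure" and \<beta>: "0 < \<beta>" and r: "0 \<le> r"
    and c: "c \<in> carpet_index m" "c' \<in> carpet_index m'"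
    and dist: "\<And>x y. x \<in> carpet_cell m c \<Longrightarrow> y \<in> carpet_cell m' c' \<Longrightarrow> dist x y \<le> r / 3 ^ n"
  shows "ennreal ((carpet.mean u (carpet_cell m c) - carpet.mean u (carpet_cell m' c'))\<^sup>2) \<le>
    ennreal (8 ^ m * 8 ^ m' * r powr (carpet_dim + \<beta>) / (8 ^ n * (3 powr \<beta>) ^ n)) *
      carpet.partial_energy \<beta> u (carpet_cell m c \<times> carpet_cell m' c')"
proof -
  let ?d = "carpet.mean u (carpet_cell m c) - carpet.mean u (carpet_cell m' c')"
  let ?c = "r powr (carpet_dim + \<beta>) / (8 ^ n * (3 powr \<beta>) ^ n)"
  have "ennreal (?d\<^sup>2 * measure carpet_measure (carpet_cell m c) * measure carpet_measure (carpet_cell m' c')) \<le>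
      ennreal ?c * carpet.partial_energy \<beta> u (carpet_cell m c \<times> carpet_cell m' c')"
    using c dist \<beta> r
    by (intro carpet.mean_diff_le_partial_energy u carpet_cell_sets carpet_kernel_le) (auto simp: measure_carpet_cell)
  then have "ennreal (8 ^ m * 8 ^ m') * ennreal (?d\<^sup>2 * (1 / 8 ^ m) * (1 / 8 ^ m')) \<le>
      ennreal (8 ^ m * 8 ^ m') * (ennreal ?c * carpet.partial_energy \<beta> u (carpet_cell m c \<times> carpet_cell m' c'))"
    using c by (intro mult_left_mono) (auto simp: measure_carpet_cell)
  also have "ennreal (8 ^ m * 8 ^ m') * ennreal (?d\<^sup>2 * (1 / 8 ^ m) * (1 / 8 ^ m')) = ennreal (?d\<^sup>2)"
    by (subst ennreal_mult[symmetric]) auto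
  finally show ?thesis
    using r by (simp add: mult.assoc[symmetric] ennreal_mult[symmetric])
qed


section \<open>The upper bound\<close>

text \<open>The rows whose heights have only the ternary digits \<open>0\<close> and \<open>2\<close> miss all holes of the carpet.\<close>

fun full_rows :: "nat \<Rightarrow> nat set" where
  "full_rows 0 = {0}"
| "full_rows (Suc n) = (\<lambda>(b, e). 3 * b + e) ` (full_rows n \<times> {0, 2})"

lemma finite_full_rows [simp]: "finite (full_rows n)"
  by (induction n) auto

lemma card_full_rows: "card (full_rows n) = 2 ^ n"
proof (induction n)
  case (Suc n)
  have "inj_on (\<lambda>(b, e). 3 * b + e) (full_rows n \<times> {0, 2 :: nat})"
    by (auto simp: inj_on_def) presburger+
  then show ?case using Suc by (simp add: card_image card_cartesian_product)
qed simp

text \<open>A second digit 0 or 2 never completes the removed pair (1, 1), whatever the first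
  digit.\<close>

lemma full_rows_index: "a < 3 ^ n \<Longrightarrow> b \<in> full_rows n \<Longrightarrow> (a, b) \<in> carpet_index n"
proof (induction n arbitrary: a b)
  case (Suc n)
  then obtain b' e where b: "b = 3 * b' + e" "b' \<in> full_rows n" "e = 0 \<or> e = 2" by auto
  have "(a div 3, b') \<in> carpet_index n" using Suc.prems b by (intro Suc.IH) auto
  moreover have "(a mod 3, e) \<in> carpet_digits" using b(3) by (auto simp: carpet_digits_def)
  ultimately have "((a div 3, b'), (a mod 3, e)) \<in> carpet_index n \<times> carpet_digits" by simp
  moreover have "(a, b) = (\<lambda>((a, b), (d, e)). (3 * a + d, 3 * b + e)) ((a div 3, b'), (a mod 3, e))"
    by (simp add: b(1))
  ultimately show ?case unfolding carpet_index.simps by (rule image_eqI[rotated])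
qed simp

text \<open>The corner subcells \<open>(3 a, 3 b)\<close> are pairwise disjoint, unlike the cells themselves.\<close>

lemma energy_lower_bound:
  assumes u: "u \<in> carpet_domain \<beta>" and \<beta>: "0 < \<beta>" and n: "0 < n"
    and close: "\<And>x. x \<in> sierpinski_carpet \<Longrightarrow> \<bar>fst x - u x\<bar> < 1 / 8"
  shows "ennreal ((2 / 3) ^ n / 16) \<le>
    ennreal (64 * 2 powr (carpet_dim + \<beta>) * (8 / 3 powr \<beta>) ^ n) * carpet_energy \<beta> u"
proof -
  define P where "P a b = carpet_cell (Suc n) (3 * a, 3 * b)" for a b
  define m where "m a b = carpet.mean u (P a b)" for a b
  \<comment> \<open>64 = 8 * 8, because both subcells have level \<open>Suc n\<close> while their
    distance is measured on the scale \<open>3 ^ n\<close>.\<close>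
  define C where "C = 64 * 2 powr (carpet_dim + \<beta>) * (8 / 3 powr \<beta>) ^ n"
  have uL2: "u \<in> L2_functions carpet_measure" using u by (simp add: carpet_domain_def)
  then have um: "u \<in> borel_measurable carpet_measure" by (simp add: L2_functions_def)
  have idx: "(3 * a, 3 * b) \<in> carpet_index (Suc n)" if "a < 3 ^ n" "b \<in> full_rows n" for a b
  proof -
    have "((a, b), (0, 0)) \<in> carpet_index n \<times> carpet_digits"
      using full_rows_index[OF that] by (simp add: carpet_digits_def)
    then show ?thesis unfolding carpet_index.simps by (rule image_eqI[rotated]) simp
  qed
  have coord: "real (3 * a) \<le> 3 ^ Suc n * fst x" "3 ^ Suc n * fst x \<le> real (3 * a) + 1"
    "real (3 * b) \<le> 3 ^ Suc n * snd x" "3 ^ Suc n * snd x \<le> real (3 * b) + 1" if "x \<in> P a b" for x a b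
    using carpet_cell_coord[OF that[unfolded P_def]] by auto
  \<comment> \<open>In units of 3^-(n+1) the subcells lie in the squares with lower left corners (3
    a, 3 b) and side 1, which leave gaps.\<close>
  have disj: "a = a' \<and> b = b'" if "x \<in> P a b" "x \<in> P a' b'" for x a b a' b'
    using coord[OF that(1)] coord[OF that(2)] by linarith
  have step: "ennreal ((m (Suc a) b - m a b)\<^sup>2) \<le> ennreal C * carpet.partial_energy \<beta> u (P (Suc a) b \<times> P a b)"
    if "Suc a < 3 ^ n" "b \<in> full_rows n" for a b
  proof -
    have "dist x y \<le> 2 / 3 ^ n" if "x \<in> P (Suc a) b" "y \<in> P a b" for x y
    proof -
      have "\<bar>3 ^ Suc n * (fst x - fst y)\<bar> \<le> 4" "\<bar>3 ^ Suc n * (snd x - snd y)\<bar> \<le> 1"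
        using coord[OF that(1)] coord[OF that(2)] by (auto simp: abs_le_iff right_diff_distrib)
      then have "\<bar>fst x - fst y\<bar> \<le> 4 / 3 ^ Suc n" "\<bar>snd x - snd y\<bar> \<le> 1 / 3 ^ Suc n"
        by (simp_all add: abs_mult pos_le_divide_eq mult.commute)
      then have "dist x y \<le> 4 / 3 ^ Suc n + 1 / 3 ^ Suc n" using dist_le_sum_coords[of x y] by linarith
      also have "\<dots> = (5 / 3) / 3 ^ n" by (simp add: add_divide_distrib[symmetric])
      also have "\<dots> \<le> 2 / 3 ^ n" by (intro divide_right_mono) auto
      finally show ?thesis .
    qed
    then have "ennreal ((m (Suc a) b - m a b)\<^sup>2) \<le>
      ennreal (8 ^ Suc n * 8 ^ Suc n * 2 powr (carpet_dim + \<beta>) / (8 ^ n * (3 powr \<beta>) ^ n)) *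
        carpet.partial_energy \<beta> u (P (Suc a) b \<times> P a b)"
      unfolding m_def P_def using that by (intro carpet_mean_diff_le uL2 \<beta> idx) auto
    also have "8 ^ Suc n * 8 ^ Suc n * 2 powr (carpet_dim + \<beta>) / (8 ^ n * (3 powr \<beta>) ^ n) = C"
      by (simp add: C_def power_divide)
    finally show ?thesis .
  qed
  have pos: "0 < measure carpet_measure (P a b)" and sets: "P a b \<in> sets carpet_measure"
    if "a < 3 ^ n" "b \<in> full_rows n" for a b
    using idx[OF that] by (auto simp: P_def measure_carpet_cell carpet_cell_sets simp del: carpet_index.simps)
  have sub: "x \<in> sierpinski_carpet" if "x \<in> P a b" "a < 3 ^ n" "b \<in> full_rows n" for x a b
    using that carpet_cell_subset[OF idx] by (auto simp: P_def)
  have n3: "(3::real) \<le> 3 ^ n" using n power_increasing[of 1 n "3::real"] by simp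
  \<comment> \<open>Since \<open>3 ^ n\<close> is at least 3, the first subcell lies in
    \<open>fst x \<le> 1 / 9\<close> and the last in \<open>fst x \<ge> 2 / 3\<close>, so the
    averages rise by at least 2/3 - 1/9 - 2/8, which exceeds 1/4.\<close>
  have row: "(1 / 16) / 3 ^ n \<le> (\<Sum>a<3 ^ n - 1. (m (Suc a) b - m a b)\<^sup>2)" if b: "b \<in> full_rows n" for b
  proof -
    have "m 0 b \<le> 1 / 9 + 1 / 8" unfolding m_def
    proof (rule carpet.mean_bounds[OF uL2 sets pos])
      fix x assume x: "x \<in> P 0 b"
      have "9 * fst x \<le> 3 ^ Suc n * fst x"
        using n3 carpet_coord_bounds[OF sub[OF x _ b]] by (intro mult_right_mono) auto
      also have "\<dots> \<le> 1" using coord(2)[OF x] by simp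
      finally have "9 * fst x \<le> 1" .
      moreover have "u x - fst x < 1 / 8" using abs_less_iff[THEN iffD1, OF close[OF sub[OF x _ b]]] by simp
      ultimately show "u x \<le> 1 / 9 + 1 / 8" by linarith
    qed (use b in auto)
    moreover have "2 / 3 - 1 / 8 \<le> m (3 ^ n - 1) b" unfolding m_def
    proof (rule carpet.mean_bounds[OF uL2 sets pos])
      fix x assume x: "x \<in> P (3 ^ n - 1) b"
      have "real (3 * (3 ^ n - 1)) = 3 ^ Suc n - 3" by (simp add: of_nat_diff)
      then have "3 ^ Suc n * (1 - fst x) \<le> 3" using coord(1)[OF x] by (simp add: right_diff_distrib)
      moreover have "9 * (1 - fst x) \<le> 3 ^ Suc n * (1 - fst x)"
        using n3 carpet_coord_bounds[OF sub[OF x _ b]] by (intro mult_right_mono) auto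
      ultimately have "9 * (1 - fst x) \<le> 3" by (rule order_trans[rotated])
      then have "2 / 3 \<le> fst x" by (simp add: right_diff_distrib)
      moreover have "fst x - u x < 1 / 8" using abs_less_iff[THEN iffD1, OF close[OF sub[OF x _ b]]] by simp
      ultimately show "2 / 3 - 1 / 8 \<le> u x" by linarith
    qed (use b in auto)
    ultimately have "1 / 4 \<le> m (3 ^ n - 1) b - m 0 b" by simp
    then have "(1 / 4)\<^sup>2 \<le> (m (3 ^ n - 1) b - m 0 b)\<^sup>2" by (intro power_mono) auto
    also have "\<dots> = (\<Sum>a<3 ^ n - 1. m (Suc a) b - m a b)\<^sup>2"
      by (subst sum_lessThan_telescope[of "\<lambda>a. m a b"]) simp
    also have "\<dots> \<le> (\<Sum>a<3 ^ n - 1. (m (Suc a) b - m a b)\<^sup>2) * card {..<3 ^ n - 1 :: nat}"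
      by (rule sum_squared_le_sum_of_squares)
    also have "\<dots> \<le> (\<Sum>a<3 ^ n - 1. (m (Suc a) b - m a b)\<^sup>2) * 3 ^ n"
      by (intro mult_left_mono sum_nonneg) (auto simp: of_nat_diff)
    finally show ?thesis by (simp add: pos_divide_le_eq power2_eq_square)
  qed
  define I where "I = {..<3 ^ n - 1 :: nat} \<times> full_rows n"
  have "(2 / 3) ^ n / 16 = (\<Sum>b\<in>full_rows n. (1 / 16) / 3 ^ n :: real)"
    by (simp add: card_full_rows power_divide)
  also have "\<dots> \<le> (\<Sum>b\<in>full_rows n. \<Sum>a<3 ^ n - 1. (m (Suc a) b - m a b)\<^sup>2)"
    by (intro sum_mono row)
  also have "\<dots> = (\<Sum>(a, b)\<in>I. (m (Suc a) b - m a b)\<^sup>2)"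
    unfolding I_def by (subst sum.swap) (simp add: sum.cartesian_product)
  finally have "ennreal ((2 / 3) ^ n / 16) \<le> ennreal (\<Sum>(a, b)\<in>I. (m (Suc a) b - m a b)\<^sup>2)"
    by (rule ennreal_leI)
  also have "\<dots> = (\<Sum>(a, b)\<in>I. ennreal ((m (Suc a) b - m a b)\<^sup>2))"
    by (subst sum_ennreal[symmetric]) (auto simp: case_prod_unfold)
  also have "\<dots> \<le> (\<Sum>(a, b)\<in>I. ennreal C * carpet.partial_energy \<beta> u (P (Suc a) b \<times> P a b))"
    by (intro sum_mono) (auto simp: I_def intro!: step)
  also have "\<dots> = ennreal C * (\<Sum>i\<in>I. carpet.partial_energy \<beta> u (P (Suc (fst i)) (snd i) \<times> P (fst i) (snd i)))"
    by (simp add: sum_distrib_left case_prod_unfold)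
  also have "\<dots> \<le> ennreal C * carpet.energy \<beta> u"
  proof (intro mult_left_mono carpet.sum_partial_energy_le um)
    show "disjoint_family_on (\<lambda>i. P (Suc (fst i)) (snd i) \<times> P (fst i) (snd i)) I"
      unfolding disjoint_family_on_def using disj by (fastforce simp: prod_eq_iff)
    show "P (Suc (fst i)) (snd i) \<times> P (fst i) (snd i) \<in> sets (carpet_measure \<Otimes>\<^sub>M carpet_measure)" if "i \<in> I" for i
      using that by (intro pair_measureI sets) (auto simp: I_def)
  qed (auto simp: I_def)
  finally show ?thesis by (simp add: C_def carpet_energy_eq)
qed

lemma regular_carpet_form_upper:
  assumes \<beta>: "0 < \<beta>" and reg: "regular_dirichlet_form carpet_measure (carpet_form \<beta>) (carpet_domain \<beta>)"
  shows "3 powr \<beta> \<le> 12"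
proof (rule ccontr)
  assume "\<not> 3 powr \<beta> \<le> 12"
  then have q: "1 < 3 powr \<beta> / 12" by simp
  interpret regular_dirichlet_form carpet_measure "carpet_form \<beta>" "carpet_domain \<beta>" by fact
  have "fst \<in> compactly_supported_continuous (space carpet_measure)"
    using compact_carpet by (auto simp: compactly_supported_continuous_def intro!: continuous_intros)
  from core_dense_uniform[OF this, of "1 / 8"] obtain u where u: "u \<in> carpet_domain \<beta>"
    "\<And>x. x \<in> sierpinski_carpet \<Longrightarrow> \<bar>fst x - u x\<bar> < 1 / 8" by auto
  then obtain E where E: "carpet_energy \<beta> u = ennreal E" "0 \<le> E"
    by (cases "carpet_energy \<beta> u") (auto simp: carpet_domain_def)
  define C where "C = 64 * 2 powr (carpet_dim + \<beta>)"
  have "(3 powr \<beta> / 12) ^ n \<le> 16 * C * E" if "0 < n" for n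
  proof -
    have "ennreal ((2 / 3) ^ n / 16) \<le> ennreal (C * (8 / 3 powr \<beta>) ^ n * E)"
      using energy_lower_bound[OF u(1) \<beta> that u(2)] E by (simp add: C_def ennreal_mult)
    then have "(2 / 3) ^ n / 16 \<le> C * (8 / 3 powr \<beta>) ^ n * E"
      using E by (subst (asm) ennreal_le_iff) (auto simp: C_def)
    \<comment> \<open>Removing the decay on the right turns the left side into powers of (3 powr
      \<beta> / 8) * (2/3), which must stay bounded.\<close>
    then have "(3 powr \<beta> / 8) ^ n * ((2 / 3) ^ n / 16) \<le> (3 powr \<beta> / 8) ^ n * (C * (8 / 3 powr \<beta>) ^ n * E)"
      by (intro mult_left_mono) auto
    also have "\<dots> = C * E" by (simp add: power_divide)
    also have "(3 powr \<beta> / 8) ^ n * ((2 / 3) ^ n / 16) = (3 powr \<beta> / 8 * (2 / 3)) ^ n / 16"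
      by (subst power_mult_distrib) simp
    also have "3 powr \<beta> / 8 * (2 / 3) = 3 powr \<beta> / 12" by simp
    finally show ?thesis by simp
  qed
  moreover obtain n where "16 * C * E < (3 powr \<beta> / 12) ^ n" using real_arch_pow[OF q] by blast
  moreover have "(3 powr \<beta> / 12) ^ n \<le> (3 powr \<beta> / 12) ^ Suc n" using q by (intro power_increasing) auto
  ultimately show False by (meson le_less_trans less_le_trans not_less order_refl zero_less_Suc)
qed


section \<open>A self-similar coordinate function\<close>

text \<open>The weights \<open>2/7, 3/7, 2/7\<close> are the increments of the potential over the three columns when
  the lines between them are short-circuited: the columns have resistances \<open>1/3, 1/2, 1/3\<close>, whose
  sum is \<open>7/6\<close>.\<close>

definition column_weight :: "nat \<Rightarrow> real" where
  "column_weight d = (if d = 1 then 3 / 7 else 2 / 7)"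

text \<open>For \<open>k < 3 ^ n\<close> this is the mass of the \<open>k\<close>-th triadic
  interval of level \<open>n\<close>. Larger \<open>k\<close> repeat the measure with period 1, so
  that columns just beyond the unit interval still have comparable mass.\<close>

fun column_mass :: "nat \<Rightarrow> nat \<Rightarrow> real" where
  "column_mass 0 k = 1"
| "column_mass (Suc n) k = column_mass n (k div 3) * column_weight (k mod 3)"

definition column_cdf :: "nat \<Rightarrow> nat \<Rightarrow> real" where
  "column_cdf n k = (\<Sum>j<k. column_mass n j)"

text \<open>Approaches \<open>x\<close> from the left by triadic points of all levels;
  \<open>column_cdf_add_level\<close> makes their values consistent.\<close>

definition shorted_potential :: "real \<Rightarrow> real" where
  "shorted_potential x = Sup {column_cdf n k | n k. real k \<le> 3 ^ n * x}"

lemma column_mass_pos: "0 < column_mass n k"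
  by (induction n arbitrary: k) (auto simp: column_weight_def)

lemma column_mass_le: "column_mass n k \<le> (3 / 7) ^ n"
proof (induction n arbitrary: k)
  case (Suc n)
  have "column_mass n (k div 3) * column_weight (k mod 3) \<le> (3 / 7) ^ n * (3 / 7)"
    using Suc by (intro mult_mono) (auto simp: column_weight_def)
  then show ?case by simp
qed simp

lemma column_weight_ratio: "column_weight d \<le> 3 / 2 * column_weight d'"
  by (simp add: column_weight_def)

text \<open>Neighbours with the same parent differ by a ratio of weights. Across a border of parents
  the last digits are 2 and 0, whose weights agree, so the ratio is that of the parents and the
  constant does not grow with the level.\<close>

lemma column_mass_Suc_ratio:
  "column_mass n (Suc k) \<le> 3 / 2 * column_mass n k \<and> column_mass n k \<le> 3 / 2 * column_mass n (Suc k)"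
proof (induction n arbitrary: k)
  case (Suc n)
  show ?case
  proof (cases "k mod 3 = 2")
    case True
    then have "Suc k div 3 = Suc (k div 3)" "Suc k mod 3 = 0" by presburger+
    then show ?thesis using Suc.IH[of "k div 3"] by (simp add: True column_weight_def)
  next
    case False
    then have "Suc k div 3 = k div 3" by presburger
    moreover have "column_mass n (k div 3) * column_weight d \<le> 3 / 2 * (column_mass n (k div 3) * column_weight d')" for d d'
      using mult_left_mono[OF column_weight_ratio, of "column_mass n (k div 3)" d d'] column_mass_pos[of n "k div 3"]
      by (simp add: ac_simps)
    ultimately show ?thesis by simp
  qed
qed simp

lemma column_mass_add_ratio:
  "column_mass n (k + i) \<le> (3 / 2) ^ i * column_mass n k" "column_mass n k \<le> (3 / 2) ^ i * column_mass n (k + i)"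
proof (induction i)
  case (Suc i)
  { case 1
    have "column_mass n (k + Suc i) \<le> 3 / 2 * column_mass n (k + i)"
      using column_mass_Suc_ratio[of n "k + i"] by simp
    also have "\<dots> \<le> 3 / 2 * ((3 / 2) ^ i * column_mass n k)" using Suc.IH(1) by (intro mult_left_mono) auto
    finally show ?case by simp }
  { case 2
    have "column_mass n k \<le> (3 / 2) ^ i * column_mass n (k + i)" by (rule Suc.IH(2))
    also have "\<dots> \<le> (3 / 2) ^ i * (3 / 2 * column_mass n (k + Suc i))"
      using column_mass_Suc_ratio[of n "k + i"] by (intro mult_left_mono) auto
    finally show ?case by simp }
qed auto

lemma column_mass_near:
  assumes "j \<le> k + 3" "k \<le> j + 3"
  shows "column_mass n j \<le> 27 / 8 * column_mass n k"
proof (cases "k \<le> j")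
  case True
  then obtain i where i: "j = k + i" "i \<le> 3" using assms by (metis add_le_cancel_left le_Suc_ex)
  have "column_mass n j \<le> (3 / 2) ^ i * column_mass n k" using column_mass_add_ratio(1) by (simp add: i)
  also have "\<dots> \<le> (3 / 2) ^ 3 * column_mass n k"
    using i column_mass_pos[of n k] by (intro mult_right_mono power_increasing) auto
  finally show ?thesis by (simp add: power3_eq_cube)
next
  case False
  then obtain i where i: "k = j + i" "i \<le> 3" using assms by (metis add_le_cancel_left le_Suc_ex nat_le_linear)
  have "column_mass n j \<le> (3 / 2) ^ i * column_mass n k" using column_mass_add_ratio(2) by (simp add: i)
  also have "\<dots> \<le> (3 / 2) ^ 3 * column_mass n k"
    using i column_mass_pos[of n k] by (intro mult_right_mono power_increasing) auto
  finally show ?thesis by (simp add: power3_eq_cube)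
qed

section \<open>The distribution function of the column measure\<close>

lemma column_cdf_mono: "k \<le> l \<Longrightarrow> column_cdf n k \<le> column_cdf n l"
  unfolding column_cdf_def by (intro sum_mono2) (auto intro: less_imp_le[OF column_mass_pos])

text \<open>The three weights add up to 1, so refinement preserves the values at the old division
  points.\<close>

lemma column_cdf_Suc_level: "column_cdf (Suc n) (3 * k) = column_cdf n k"
proof (induction k)
  case (Suc k)
  have "3 * Suc k = Suc (Suc (Suc (3 * k)))" by simp
  then have "column_cdf (Suc n) (3 * Suc k) = column_cdf (Suc n) (3 * k) +
      column_mass (Suc n) (3 * k) + column_mass (Suc n) (Suc (3 * k)) + column_mass (Suc n) (Suc (Suc (3 * k)))"
    by (simp only: column_cdf_def sum.lessThan_Suc)
  also have "\<dots> = column_cdf n k + column_mass n k"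
  proof -
    have "Suc (3 * k) div 3 = k" "Suc (Suc (3 * k)) div 3 = k" "Suc (3 * k) mod 3 = 1" "Suc (Suc (3 * k)) mod 3 = 2"
      by presburger+
    then show ?thesis by (simp add: Suc column_weight_def)
  qed
  finally show ?case by (simp add: column_cdf_def)
qed (simp add: column_cdf_def)

lemma column_cdf_add_level: "column_cdf (n + m) (3 ^ m * k) = column_cdf n k"
proof (induction m)
  case (Suc m)
  then show ?case using column_cdf_Suc_level[of "n + m" "3 ^ m * k"] by (simp add: mult.assoc)
qed simp

text \<open>Both division points are rewritten at the common level \<open>n + m\<close>.\<close>

lemma column_cdf_le:
  assumes "real k \<le> 3 ^ n * x" "3 ^ m * x \<le> real l"
  shows "column_cdf n k \<le> column_cdf m l"
proof -
  have "3 ^ m * real k \<le> 3 ^ m * (3 ^ n * x)" using assms(1) by (rule mult_left_mono) simp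
  also have "\<dots> = 3 ^ n * (3 ^ m * x)" by (rule mult.left_commute)
  also have "\<dots> \<le> 3 ^ n * real l" using assms(2) by (rule mult_left_mono) simp
  finally have "3 ^ m * real k \<le> 3 ^ n * real l" .
  then have "real (3 ^ m * k) \<le> real (3 ^ n * l)" by simp
  then have "3 ^ m * k \<le> 3 ^ n * l" by (simp only: of_nat_le_iff)
  then have "column_cdf (n + m) (3 ^ m * k) \<le> column_cdf (m + n) (3 ^ n * l)"
    by (simp add: add.commute column_cdf_mono)
  then show ?thesis by (simp only: column_cdf_add_level)
qed

lemma shorted_potential_le:
  assumes "0 \<le> x" "3 ^ m * x \<le> real l"
  shows "shorted_potential x \<le> column_cdf m l"
  unfolding shorted_potential_def
proof (rule cSup_least)
  show "{column_cdf n k |n k. real k \<le> 3 ^ n * x} \<noteq> {}"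
    using assms(1) by (auto intro!: exI[of _ 0])
qed (use assms(2) in \<open>auto intro: column_cdf_le\<close>)

lemma shorted_potential_ge:
  assumes "real k \<le> 3 ^ n * x"
  shows "column_cdf n k \<le> shorted_potential x"
  unfolding shorted_potential_def
proof (rule cSup_upper)
  show "bdd_above {column_cdf n k |n k. real k \<le> 3 ^ n * x}"
  proof -
    obtain l where "x \<le> real l" using real_arch_simple by blast
    then show ?thesis
      using column_cdf_le[of _ _ x 0 l] by (auto intro!: bdd_aboveI[of _ "column_cdf 0 l"])
  qed
qed (use assms in auto)

lemma shorted_potential_diff_le:
  assumes xy: "0 \<le> x" "0 \<le> y" and a: "real a \<le> 3 ^ n * x" "3 ^ n * x \<le> real a + 1"
    and near: "\<bar>x - y\<bar> \<le> 3 / 3 ^ n"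
  shows "\<bar>shorted_potential x - shorted_potential y\<bar> \<le> 24 * column_mass n a"
proof -
  have "\<bar>3 ^ n * (x - y)\<bar> \<le> 3" using near by (simp add: abs_mult pos_le_divide_eq mult.commute)
  then have y: "3 ^ n * y \<le> real (a + 4)" "real a - 3 \<le> 3 ^ n * y"
    using a by (auto simp: abs_le_iff right_diff_distrib)
  have y': "real (a - 3) \<le> 3 ^ n * y"
    using y xy by (cases "3 \<le> a") (auto simp: of_nat_diff)
  \<comment> \<open>Both points lie between the division points \<open>a - 3\<close> and
    \<open>a + 4\<close>. At most seven columns, each of mass at most 27/8 times that of column
    \<open>a\<close>, give 189/8 < 24. For \<open>a < 3\<close> the truncated subtraction puts the
    left end at 0.\<close>
  have "column_cdf n (a + 4) - column_cdf n (a - 3) = (\<Sum>j\<in>{a - 3..<a + 4}. column_mass n j)"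
    unfolding column_cdf_def by (subst sum_diff[symmetric]) (auto intro!: sum.cong)
  also have "\<dots> \<le> (\<Sum>j\<in>{a - 3..<a + 4}. 27 / 8 * column_mass n a)"
    by (intro sum_mono column_mass_near) auto
  also have "\<dots> \<le> 7 * (27 / 8 * column_mass n a)"
    using column_mass_pos[of n a] by (simp add: of_nat_diff)
  also have "\<dots> \<le> 24 * column_mass n a" using column_mass_pos[of n a] by simp
  finally have "column_cdf n (a + 4) - column_cdf n (a - 3) \<le> 24 * column_mass n a" .
  moreover have "shorted_potential x \<le> column_cdf n (a + 4)" "shorted_potential y \<le> column_cdf n (a + 4)"
    using a y xy by (auto intro!: shorted_potential_le)
  moreover have "column_cdf n (a - 3) \<le> shorted_potential x" "column_cdf n (a - 3) \<le> shorted_potential y"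
    using a y' by (auto intro!: shorted_potential_ge intro: order_trans[rotated])
  ultimately show ?thesis by linarith
qed

lemma continuous_on_shorted_potential: "continuous_on {0..} shorted_potential"
  unfolding continuous_on_iff
proof (intro ballI allI impI)
  fix x e :: real assume x: "x \<in> {0..}" and e: "0 < e"
  obtain n where n: "(3 / 7) ^ n < e / 24" using real_arch_pow_inv[of "e / 24" "3 / 7"] e by auto
  define a where "a = nat \<lfloor>3 ^ n * x\<rfloor>"
  have a: "real a \<le> 3 ^ n * x" "3 ^ n * x \<le> real a + 1"
    using x by (auto simp: a_def)
  have "dist (shorted_potential y) (shorted_potential x) < e" if "y \<in> {0..}" "dist y x < 3 / 3 ^ n" for y
  proof -
    have "\<bar>shorted_potential x - shorted_potential y\<bar> \<le> 24 * column_mass n a"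
      using x a that by (intro shorted_potential_diff_le) (auto simp: dist_real_def)
    also have "\<dots> \<le> 24 * (3 / 7) ^ n" using column_mass_le by simp
    also have "\<dots> < e" using n by simp
    finally show ?thesis by (simp add: dist_real_def abs_minus_commute)
  qed
  then show "\<exists>d>0. \<forall>y\<in>{0..}. dist y x < d \<longrightarrow> dist (shorted_potential y) (shorted_potential x) < e"
    by (intro exI[of _ "3 / 3 ^ n"]) auto
qed

text \<open>A whole column of a fine level fits between \<open>x\<close> and \<open>y\<close>, and
  every column has positive mass. This makes the two potentials separate points.\<close>

lemma shorted_potential_strict_mono:
  assumes "0 \<le> x" "x < y"
  shows "shorted_potential x < shorted_potential y"
proof -
  obtain n where "(1 / 3) ^ n < (y - x) / 2" using real_arch_pow_inv[of "(y - x) / 2" "1 / 3"] assms by auto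
  then have n: "2 \<le> 3 ^ n * (y - x)" by (simp add: power_divide field_simps)
  define k where "k = nat \<lceil>3 ^ n * x\<rceil>"
  have k: "3 ^ n * x \<le> real k" "real k < 3 ^ n * x + 1"
    using assms by (auto simp: k_def) linarith
  have "shorted_potential x \<le> column_cdf n k" using assms k by (intro shorted_potential_le) auto
  also have "\<dots> < column_cdf n (Suc k)" using column_mass_pos[of n k] by (simp add: column_cdf_def)
  also have "\<dots> \<le> shorted_potential y"
    using k n by (intro shorted_potential_ge) (simp add: right_diff_distrib)
  finally show ?thesis .
qed

text \<open>The columns 0, 1, 2 contain three, two and three cells, so one level contributes the
  factor 6 * 4/49 + 2 * 9/49 = 6/7, the least possible for weights of sum 1.\<close>

lemma sum_column_mass_fst: "(\<Sum>c\<in>carpet_index n. (column_mass n (fst c))\<^sup>2) = (6 / 7) ^ n"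
proof (induction n)
  case (Suc n)
  have "(\<Sum>c\<in>carpet_index (Suc n). (column_mass (Suc n) (fst c))\<^sup>2) =
      (\<Sum>(a, b)\<in>carpet_index n. \<Sum>(d, e)\<in>carpet_digits. (column_mass (Suc n) (3 * a + d))\<^sup>2)"
    unfolding sum_carpet_index_Suc by simp
  also have "\<dots> = (\<Sum>(a, b)\<in>carpet_index n. (column_mass n a)\<^sup>2 * (6 / 7))"
  proof (intro sum.cong refl, clarify)
    fix a b :: nat
    have "(\<Sum>(d, e)\<in>carpet_digits. (column_mass (Suc n) (3 * a + d))\<^sup>2) =
        (\<Sum>(d, e)\<in>carpet_digits. (column_mass n a)\<^sup>2 * (column_weight d)\<^sup>2)"
      by (intro sum.cong) (auto simp: carpet_digits_def power_mult_distrib)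
    also have "\<dots> = (column_mass n a)\<^sup>2 * (6 / 7)"
      by (simp add: carpet_digits_eq column_weight_def power2_eq_square)
    finally show "(\<Sum>(d, e)\<in>carpet_digits. (column_mass (Suc n) (3 * a + d))\<^sup>2) = (column_mass n a)\<^sup>2 * (6 / 7)" .
  qed
  also have "\<dots> = (6 / 7) * (\<Sum>c\<in>carpet_index n. (column_mass n (fst c))\<^sup>2)"
    by (simp add: sum_distrib_left case_prod_unfold mult.commute)
  finally show ?case using Suc by simp
qed simp

text \<open>Reflection in the diagonal carries the first coordinate's estimate over to the
  second.\<close>

lemma swap_carpet_index: "prod.swap ` carpet_index n = carpet_index n"
proof -
  have "prod.swap ` carpet_index n \<subseteq> carpet_index n" for n
  proof (induction n)
    case (Suc n)
    show ?case
    proof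
      fix p assume "p \<in> prod.swap ` carpet_index (Suc n)"
      then obtain a b a' b' d e where *: "p = (a, b)" "b = 3 * b' + d" "a = 3 * a' + e"
          "(b', a') \<in> carpet_index n" "(d, e) \<in> carpet_digits"
        by auto
      then have "((a', b'), (e, d)) \<in> carpet_index n \<times> carpet_digits"
        using Suc.IH by (auto simp: carpet_digits_def)
      then show "p \<in> carpet_index (Suc n)"
        unfolding carpet_index.simps by (rule image_eqI[rotated]) (simp add: *)
    qed
  qed simp
  note sub = this
  show ?thesis
  proof
    have "prod.swap ` prod.swap ` carpet_index n \<subseteq> prod.swap ` carpet_index n" by (intro image_mono sub)
    then show "carpet_index n \<subseteq> prod.swap ` carpet_index n" by (simp add: image_image)
  qed (rule sub)
qed

lemma sum_column_mass_snd: "(\<Sum>c\<in>carpet_index n. (column_mass n (snd c))\<^sup>2) = (6 / 7) ^ n"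
proof -
  have "(\<Sum>c\<in>carpet_index n. (column_mass n (snd c))\<^sup>2) = (\<Sum>c\<in>prod.swap ` carpet_index n. (column_mass n (fst c))\<^sup>2)"
    by (subst sum.reindex) auto
  then show ?thesis by (simp add: swap_carpet_index sum_column_mass_fst)
qed


section \<open>Functions of finite energy\<close>

text \<open>At most 81 cells of level \<open>n\<close>, those near the cell of \<open>x\<close>,
  cover the set.\<close>

lemma emeasure_near_le:
  assumes "x \<in> carpet_cell n c"
  shows "emeasure carpet_measure {y \<in> sierpinski_carpet. dist x y \<le> 3 / 3 ^ n} \<le> ennreal (81 / 8 ^ n)"
proof -
  let ?B = "{fst c - 4..fst c + 4} \<times> {snd c - 4..snd c + 4}"
  let ?S = "?B \<inter> carpet_index n"
  have "{y \<in> sierpinski_carpet. dist x y \<le> 3 / 3 ^ n} \<subseteq> (\<Union>c'\<in>?S. carpet_cell n c')"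
  proof clarify
    fix y1 y2 assume y: "(y1, y2) \<in> sierpinski_carpet" "dist x (y1, y2) \<le> 3 / 3 ^ n"
    then obtain c' where c': "c' \<in> carpet_index n" "(y1, y2) \<in> carpet_cell n c'"
      using UN_carpet_cells[of n] by blast
    with near_cells_coord[OF assms c'(2) y(2)] show "(y1, y2) \<in> (\<Union>c'\<in>?S. carpet_cell n c')" by blast
  qed
  then have "emeasure carpet_measure {y \<in> sierpinski_carpet. dist x y \<le> 3 / 3 ^ n} \<le>
      emeasure carpet_measure (\<Union>c'\<in>?S. carpet_cell n c')"
    by (intro emeasure_mono sets.finite_UN) (auto intro: carpet_cell_sets)
  also have "\<dots> \<le> (\<Sum>c'\<in>?S. emeasure carpet_measure (carpet_cell n c'))"
    by (intro emeasure_subadditive_finite) (auto intro: carpet_cell_sets)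
  also have "\<dots> = of_nat (card ?S) * ennreal (1 / 8 ^ n)"
    by (simp add: emeasure_carpet_cell)
  also have "\<dots> \<le> of_nat 81 * ennreal (1 / 8 ^ n)"
    by (intro mult_right_mono of_nat_mono order_trans[OF card_mono card_near_box]) auto
  also have "\<dots> = ennreal (81 * (1 / 8 ^ n))"
    by (subst ennreal_mult) (auto simp: ennreal_of_nat_eq_real_of_nat)
  finally show ?thesis by simp
qed

text \<open>The integration is split according to the triadic scale of the distance.\<close>

lemma carpet_energy_finite:
  fixes w :: "nat \<Rightarrow> nat \<times> nat \<Rightarrow> real"
  assumes \<beta>: "0 < \<beta>"
    and osc: "\<And>n c x y. c \<in> carpet_index n \<Longrightarrow> x \<in> carpet_cell n c \<Longrightarrow> y \<in> sierpinski_carpet \<Longrightarrow>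
      dist x y \<le> 3 / 3 ^ n \<Longrightarrow> \<bar>u x - u y\<bar> \<le> w n c"
    and sum: "\<And>n. (\<Sum>c\<in>carpet_index n. (w n c)\<^sup>2) \<le> A * \<theta> ^ n"
    and \<theta>: "0 \<le> \<theta>" "3 powr \<beta> * \<theta> < 8"
  shows "carpet_energy \<beta> u < \<infinity>"
proof -
  define s where "s = carpet_dim + \<beta>"
  have s: "0 < s" using \<beta> carpet_dim_pos by (simp add: s_def)
  \<comment> \<open>At distances of scale \<open>n\<close> the numerator is at most
    \<open>(w n c)\<^sup>2\<close> and the denominator at least \<open>(1 / 3 ^ n) powr s\<close>.
    Points shared by several cells are counted repeatedly, which only enlarges the majorant.\<close>
  define T where "T n c x = ennreal ((3 ^ n) powr s * (w n c)\<^sup>2) * indicator (carpet_cell n c) x" for n c x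
  define near where "near n x = {y \<in> sierpinski_carpet. dist x y \<le> 3 / 3 ^ n}" for n :: nat and x
  have near_sets: "near n x \<in> sets carpet_measure" for n x
  proof -
    have "near n x = sierpinski_carpet \<inter> cball x (3 / 3 ^ n)" by (auto simp: near_def)
    then show ?thesis by (simp add: sets_carpet_measure_iff)
  qed
  have pointwise: "ennreal ((u x - u y)\<^sup>2 / dist x y powr s) \<le>
      (\<Sum>n. (\<Sum>c\<in>carpet_index n. T n c x) * indicator (near n x) y)"
    if x: "x \<in> sierpinski_carpet" and y: "y \<in> sierpinski_carpet" for x y
  proof (cases "x = y")
    case False
    have "dist x y / 3 \<le> 1" using dist_carpet_le[OF x y] by simp
    \<comment> \<open>Distances in the carpet may exceed 1; division by 3 brings them into the
      triadic range and yields \<open>1 / 3 ^ n < dist x y\<close> and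
      \<open>dist x y \<le> 3 / 3 ^ n\<close>.\<close>
    define d where "d = dist x y / 3"
    have d: "0 < d" "d \<le> 1" using False \<open>dist x y / 3 \<le> 1\<close> by (auto simp: d_def)
    obtain n where n: "1 / 3 ^ Suc n < d" "d \<le> 1 / 3 ^ n" using ex_triadic_interval[OF d] .
    obtain c where c: "c \<in> carpet_index n" "x \<in> carpet_cell n c"
      using x UN_carpet_cells[of n] by blast
    have dist: "1 / 3 ^ n < dist x y" "dist x y \<le> 3 / 3 ^ n" using n by (auto simp: d_def field_simps)
    have "(u x - u y)\<^sup>2 \<le> (w n c)\<^sup>2"
      using osc[OF c y dist(2)] by (intro abs_le_square_iff[THEN iffD1]) auto
    then have "(u x - u y)\<^sup>2 / dist x y powr s \<le> (w n c)\<^sup>2 / (1 / 3 ^ n) powr s"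
      using dist(1) s by (intro frac_le powr_mono2) auto
    also have "\<dots> = (3 ^ n) powr s * (w n c)\<^sup>2" by (simp add: powr_divide)
    finally have "ennreal ((u x - u y)\<^sup>2 / dist x y powr s) \<le> T n c x * indicator (near n x) y"
      using c y dist by (simp add: T_def near_def ennreal_leI)
    also have "\<dots> \<le> (\<Sum>c\<in>carpet_index n. T n c x) * indicator (near n x) y"
      using c by (intro mult_right_mono member_le_sum) auto
    also have "\<dots> \<le> (\<Sum>n. (\<Sum>c\<in>carpet_index n. T n c x) * indicator (near n x) y)"
    proof -
      define f where "f n = (\<Sum>c\<in>carpet_index n. T n c x) * indicator (near n x) y" for n
      have "sum f {n} \<le> suminf f" by (rule sum_le_suminf) auto
      then show ?thesis unfolding f_def[symmetric] by simp
    qed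
    finally show ?thesis .
  qed simp
  have "carpet_energy \<beta> u \<le>
      (\<integral>\<^sup>+x. (\<integral>\<^sup>+y. (\<Sum>n. (\<Sum>c\<in>carpet_index n. T n c x) * indicator (near n x) y) \<partial>carpet_measure) \<partial>carpet_measure)"
    unfolding carpet_energy_def s_def[symmetric] by (intro nn_integral_mono pointwise) auto
  also have "\<dots> = (\<integral>\<^sup>+x. (\<Sum>n. (\<Sum>c\<in>carpet_index n. T n c x) * emeasure carpet_measure (near n x)) \<partial>carpet_measure)"
    using near_sets by (subst nn_integral_suminf) (auto simp: nn_integral_cmult_indicator)
  also have "\<dots> \<le> (\<integral>\<^sup>+x. (\<Sum>n. (\<Sum>c\<in>carpet_index n. T n c x) * ennreal (81 / 8 ^ n)) \<partial>carpet_measure)"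
  proof (intro nn_integral_mono suminf_le)
    fix x n
    have "T n c x * emeasure carpet_measure (near n x) \<le> T n c x * ennreal (81 / 8 ^ n)" for c
      using emeasure_near_le[of x n c] by (auto simp: T_def near_def indicator_def intro: mult_left_mono)
    then show "(\<Sum>c\<in>carpet_index n. T n c x) * emeasure carpet_measure (near n x) \<le>
        (\<Sum>c\<in>carpet_index n. T n c x) * ennreal (81 / 8 ^ n)"
      by (simp add: sum_distrib_right sum_mono)
  qed auto
  also have "\<dots> = (\<Sum>n. (\<Sum>c\<in>carpet_index n. ennreal ((3 ^ n) powr s * (w n c)\<^sup>2) * ennreal (1 / 8 ^ n)) * ennreal (81 / 8 ^ n))"
  proof -
    have meas: "T n c \<in> borel_measurable carpet_measure" if "c \<in> carpet_index n" for n c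
      unfolding T_def using carpet_cell_sets[OF that] by measurable
    have "(\<integral>\<^sup>+x. T n c x \<partial>carpet_measure) = ennreal ((3 ^ n) powr s * (w n c)\<^sup>2) * ennreal (1 / 8 ^ n)"
      if "c \<in> carpet_index n" for n c
      unfolding T_def using carpet_cell_sets[OF that] that
      by (simp add: nn_integral_cmult_indicator emeasure_carpet_cell)
    then show ?thesis
      using meas by (subst nn_integral_suminf) (auto simp: nn_integral_multc nn_integral_sum cong: sum.cong)
  qed
  also have "\<dots> \<le> (\<Sum>n. ennreal (81 * A * (3 powr \<beta> * \<theta> / 8) ^ n))"
  proof (intro suminf_le)
    fix n
    have "(\<Sum>c\<in>carpet_index n. ennreal ((3 ^ n) powr s * (w n c)\<^sup>2) * ennreal (1 / 8 ^ n)) * ennreal (81 / 8 ^ n) =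
        ennreal (\<Sum>c\<in>carpet_index n. (3 ^ n) powr s * (w n c)\<^sup>2 * (1 / 8 ^ n)) * ennreal (81 / 8 ^ n)"
      by (simp add: ennreal_mult[symmetric] sum_nonneg)
    also have "\<dots> = ennreal ((\<Sum>c\<in>carpet_index n. (3 ^ n) powr s * (w n c)\<^sup>2 * (1 / 8 ^ n)) * (81 / 8 ^ n))"
      by (rule ennreal_mult[symmetric]) (auto intro!: sum_nonneg)
    \<comment> \<open>\<open>(3 ^ n) powr s\<close> is \<open>8 ^ n * (3 powr \<beta>) ^ n\<close>,
      while the masses of the cell and of the ball bring \<open>1 / 8 ^ n\<close> each.\<close>
    also have "(\<Sum>c\<in>carpet_index n. (3 ^ n) powr s * (w n c)\<^sup>2 * (1 / 8 ^ n)) * (81 / 8 ^ n) =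
        81 * (3 powr \<beta> / 8) ^ n * (\<Sum>c\<in>carpet_index n. (w n c)\<^sup>2)"
      unfolding sum_distrib_left sum_distrib_right
      by (intro sum.cong refl)
         (simp add: s_def powr_add power_three_powr three_powr_carpet_dim power_divide)
    also have "ennreal (81 * (3 powr \<beta> / 8) ^ n * (\<Sum>c\<in>carpet_index n. (w n c)\<^sup>2)) \<le>
        ennreal (81 * (3 powr \<beta> / 8) ^ n * (A * \<theta> ^ n))"
      by (intro ennreal_leI mult_left_mono sum) auto
    also have "81 * (3 powr \<beta> / 8) ^ n * (A * \<theta> ^ n) = 81 * A * (3 powr \<beta> * \<theta> / 8) ^ n"
      by (simp add: power_divide power_mult_distrib)
    finally show "(\<Sum>c\<in>carpet_index n. ennreal ((3 ^ n) powr s * (w n c)\<^sup>2) * ennreal (1 / 8 ^ n)) * ennreal (81 / 8 ^ n) \<le>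
        ennreal (81 * A * (3 powr \<beta> * \<theta> / 8) ^ n)" .
  qed auto
  also have "\<dots> < \<infinity>"
  proof -
    have "0 \<le> A"
      using order_trans[OF sum_nonneg sum[of 0]] by simp
    moreover have "summable (\<lambda>n. 81 * A * (3 powr \<beta> * \<theta> / 8) ^ n)"
      using \<theta> by (intro summable_mult summable_geometric) auto
    ultimately show ?thesis using \<theta> by (subst suminf_ennreal2) auto
  qed
  finally show ?thesis .
qed

lemma continuous_borel_measurable_carpet:
  "continuous_on sierpinski_carpet u \<Longrightarrow> (u :: _ \<Rightarrow> real) \<in> borel_measurable carpet_measure"
  unfolding measurable_cong_sets[OF sets_carpet_measure refl] by (rule borel_measurable_continuous_on_restrict)

lemma continuous_bounded_carpet:
  assumes "continuous_on sierpinski_carpet (u :: _ \<Rightarrow> real)"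
  obtains B where "\<And>x. x \<in> sierpinski_carpet \<Longrightarrow> \<bar>u x\<bar> \<le> B"
  using compact_imp_bounded[OF compact_continuous_image[OF assms compact_carpet]]
  by (auto simp: bounded_iff)

lemma continuous_L2_carpet:
  assumes "continuous_on sierpinski_carpet u"
  shows "u \<in> L2_functions carpet_measure"
proof -
  obtain B where "\<And>x. x \<in> sierpinski_carpet \<Longrightarrow> \<bar>u x\<bar> \<le> B"
    using continuous_bounded_carpet[OF assms] by blast
  then show ?thesis
    using continuous_borel_measurable_carpet[OF assms] by (intro carpet.L2_functions_bounded) auto
qed

text \<open>With \<open>\<theta> = 6 / 7\<close> the condition
  \<open>3 powr \<beta> * \<theta> < 8\<close> of \<open>carpet_energy_finite\<close> is the bound
  28/3.\<close>

lemma shorted_potential_domain: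
  assumes \<beta>: "0 < \<beta>" "3 powr \<beta> < 28 / 3"
  shows "(\<lambda>x. shorted_potential (fst x)) \<in> carpet_domain \<beta>" "(\<lambda>x. shorted_potential (snd x)) \<in> carpet_domain \<beta>"
    and "continuous_on sierpinski_carpet (\<lambda>x. shorted_potential (fst x))"
    "continuous_on sierpinski_carpet (\<lambda>x. shorted_potential (snd x))"
proof -
  show c: "continuous_on sierpinski_carpet (\<lambda>x. shorted_potential (fst x))"
    "continuous_on sierpinski_carpet (\<lambda>x. shorted_potential (snd x))"
    using carpet_coord_bounds
    by (auto intro!: continuous_on_compose2[OF continuous_on_shorted_potential] continuous_intros)
  have "carpet_energy \<beta> (\<lambda>x. shorted_potential (fst x)) < \<infinity>"
  proof (rule carpet_energy_finite[where w = "\<lambda>n c. 24 * column_mass n (fst c)" and \<theta> = "6 / 7"])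
    fix n c x y assume *: "c \<in> carpet_index n" "x \<in> carpet_cell n c" "y \<in> sierpinski_carpet" "dist x y \<le> 3 / 3 ^ n"
    then have "x \<in> sierpinski_carpet" using carpet_cell_subset by blast
    with * show "\<bar>shorted_potential (fst x) - shorted_potential (fst y)\<bar> \<le> 24 * column_mass n (fst c)"
      using carpet_coord_bounds[of x] carpet_coord_bounds[of y] carpet_cell_coord[OF *(2)] dist_fst_le[of x y]
      by (intro shorted_potential_diff_le) (auto simp: dist_real_def)
  next
    show "(\<Sum>c\<in>carpet_index n. (24 * column_mass n (fst c))\<^sup>2) \<le> 576 * (6 / 7) ^ n" for n
      using sum_column_mass_fst[of n] by (simp add: power_mult_distrib sum_distrib_left[symmetric])
  qed (use \<beta> in auto)
  moreover have "carpet_energy \<beta> (\<lambda>x. shorted_potential (snd x)) < \<infinity>"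
  proof (rule carpet_energy_finite[where w = "\<lambda>n c. 24 * column_mass n (snd c)" and \<theta> = "6 / 7"])
    fix n c x y assume *: "c \<in> carpet_index n" "x \<in> carpet_cell n c" "y \<in> sierpinski_carpet" "dist x y \<le> 3 / 3 ^ n"
    then have "x \<in> sierpinski_carpet" using carpet_cell_subset by blast
    with * show "\<bar>shorted_potential (snd x) - shorted_potential (snd y)\<bar> \<le> 24 * column_mass n (snd c)"
      using carpet_coord_bounds[of x] carpet_coord_bounds[of y] carpet_cell_coord[OF *(2)] dist_snd_le[of x y]
      by (intro shorted_potential_diff_le) (auto simp: dist_real_def)
  next
    show "(\<Sum>c\<in>carpet_index n. (24 * column_mass n (snd c))\<^sup>2) \<le> 576 * (6 / 7) ^ n" for n
      using sum_column_mass_snd[of n] by (simp add: power_mult_distrib sum_distrib_left[symmetric])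
  qed (use \<beta> in auto)
  ultimately show "(\<lambda>x. shorted_potential (fst x)) \<in> carpet_domain \<beta>" "(\<lambda>x. shorted_potential (snd x)) \<in> carpet_domain \<beta>"
    using c by (auto simp: carpet_domain_def continuous_L2_carpet)
qed


section \<open>Continuous versions\<close>

lemma geometric_tail_bound:
  fixes a :: "nat \<Rightarrow> real"
  assumes step: "\<And>n. \<bar>a n - a (Suc n)\<bar> \<le> C * r ^ n" and lim: "a \<longlonglongrightarrow> l" and r: "0 \<le> r" "r < 1" and C: "0 \<le> C"
  shows "\<bar>a n - l\<bar> \<le> C * r ^ n / (1 - r)"
proof -
  have bound: "\<bar>a n - a (n + k)\<bar> \<le> C * r ^ n * (1 - r ^ k) / (1 - r)" for k
  proof (induction k)
    case (Suc k)
    have "\<bar>a n - a (n + Suc k)\<bar> \<le> \<bar>a n - a (n + k)\<bar> + \<bar>a (n + k) - a (Suc (n + k))\<bar>" by simp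
    also have "\<dots> \<le> C * r ^ n * (1 - r ^ k) / (1 - r) + C * r ^ (n + k)"
      using Suc step by (intro add_mono)
    also have "\<dots> = C * r ^ n * (1 - r ^ Suc k) / (1 - r)"
      using r by (simp add: field_simps power_add)
    finally show ?case .
  qed simp
  have "(\<lambda>k. \<bar>a n - a (k + n)\<bar>) \<longlonglongrightarrow> \<bar>a n - l\<bar>"
    by (intro tendsto_intros LIMSEQ_ignore_initial_segment lim)
  moreover have "\<bar>a n - a (k + n)\<bar> \<le> C * r ^ n / (1 - r)" for k
  proof -
    have "C * r ^ n * (1 - r ^ k) \<le> C * r ^ n * 1" using r C by (intro mult_left_mono) auto
    then have "C * r ^ n * (1 - r ^ k) / (1 - r) \<le> C * r ^ n / (1 - r)" using r by (intro divide_right_mono) auto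
    with bound[of k] show ?thesis by (simp add: add.commute)
  qed
  ultimately show ?thesis by (intro LIMSEQ_le_const2) auto
qed

context jump_form
begin

lemma AE_density_finite:
  assumes "u \<in> domain"
  shows "AE x in M. (\<integral>\<^sup>+y. ennreal ((u x - u y)\<^sup>2 / k x y) \<partial>M) < \<infinity>"
proof -
  have [measurable]: "u \<in> borel_measurable M" using assms by (rule domain_measurable)
  have "AE x in M. (\<integral>\<^sup>+y. ennreal ((u x - u y)\<^sup>2 / k x y) \<partial>M) \<noteq> \<infinity>"
  proof (rule nn_integral_PInf_AE)
    show "(\<lambda>x. \<integral>\<^sup>+y. ennreal ((u x - u y)\<^sup>2 / k x y) \<partial>M) \<in> borel_measurable M" by measurable
    show "(\<integral>\<^sup>+x. (\<integral>\<^sup>+y. ennreal ((u x - u y)\<^sup>2 / k x y) \<partial>M) \<partial>M) \<noteq> \<infinity>"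
      using assms by (auto simp: domain_def energy_def)
  qed
  then show ?thesis by eventually_elim (simp add: less_top)
qed

text \<open>Jensen's inequality with \<open>x\<close> fixed. Where the inner energy integral is
  finite, it forces the averages over cells shrinking to \<open>x\<close> to converge to
  \<open>u x\<close>, in place of Lebesgue differentiation.\<close>

lemma deviation_le_density:
  assumes u: "u \<in> L2_functions M" and B: "B \<in> sets M" "0 < measure M B" and x: "x \<in> space M"
    and le: "\<And>y. y \<in> B \<Longrightarrow> k x y \<le> c" and pos: "\<And>y. x \<noteq> y \<Longrightarrow> 0 < k x y" and c: "0 \<le> c"
  shows "ennreal ((u x - mean u B)\<^sup>2 * measure M B) \<le> ennreal c * (\<integral>\<^sup>+y. ennreal ((u x - u y)\<^sup>2 / k x y) \<partial>M)"
proof -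
  have [measurable]: "u \<in> borel_measurable M" using u by (simp add: L2_functions_def)
  have "ennreal ((u x - mean u B)\<^sup>2 * measure M B) \<le> (\<integral>\<^sup>+y. ennreal ((u x - u y)\<^sup>2) * indicator B y \<partial>M)"
    by (rule mean_deviation_le[OF u B])
  also have "\<dots> \<le> (\<integral>\<^sup>+y. ennreal c * ennreal ((u x - u y)\<^sup>2 / k x y) \<partial>M)"
  proof (intro nn_integral_mono)
    fix y
    show "ennreal ((u x - u y)\<^sup>2) * indicator B y \<le> ennreal c * ennreal ((u x - u y)\<^sup>2 / k x y)"
    proof (cases "y \<in> B \<and> x \<noteq> y")
      case True
      then have "0 < k x y" "k x y \<le> c" using pos le by auto
      then have "(u x - u y)\<^sup>2 \<le> c * ((u x - u y)\<^sup>2 / k x y)"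
        by (simp add: pos_le_divide_eq mult.commute mult_right_mono)
      then have "ennreal ((u x - u y)\<^sup>2) \<le> ennreal c * ennreal ((u x - u y)\<^sup>2 / k x y)"
        using c kernel_nonneg by (subst ennreal_mult[symmetric]) (auto intro: ennreal_leI)
      with True show ?thesis by simp
    qed (auto simp: indicator_def)
  qed
  also have "\<dots> = ennreal c * (\<integral>\<^sup>+y. ennreal ((u x - u y)\<^sup>2 / k x y) \<partial>M)"
    using x by (intro nn_integral_cmult) measurable
  finally show ?thesis .
qed

end

text \<open>A Morrey-type embedding: for \<open>\<beta>\<close> larger than the dimension, that is \<open>3 powr \<beta> > 8\<close>, the
  averages over cells of level \<open>n\<close> and \<open>n + 1\<close> near a point differ by at most \<open>C r\<^sup>n\<close> with
  \<open>r\<^sup>2 = 8 / 3 powr \<beta> < 1\<close>.\<close>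

lemma carpet_continuous_version:
  assumes \<beta>: "0 < \<beta>" "8 < 3 powr \<beta>" and u: "u \<in> carpet_domain \<beta>"
  shows "\<exists>v. continuous_on sierpinski_carpet v \<and> (AE x in carpet_measure. u x = v x)"
proof -
  define s where "s = carpet_dim + \<beta>"
  define r where "r = sqrt (8 / 3 powr \<beta>)"
  have r: "0 \<le> r" "r < 1" "r\<^sup>2 = 8 / 3 powr \<beta>" using \<beta> by (auto simp: r_def)
  have ud: "u \<in> carpet.domain \<beta>" using u unfolding carpet_domain_eq .
  have uL2: "u \<in> L2_functions carpet_measure" using u by (simp add: carpet_domain_def)
  then have um: "u \<in> borel_measurable carpet_measure" by (simp add: L2_functions_def)
  obtain E where E: "carpet.energy \<beta> u = ennreal E" "0 \<le> E"
    using ud by (cases "carpet.energy \<beta> u") (auto simp: carpet.domain_def)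
  \<comment> \<open>5 = 2 + 1 + 2 adds two cell diameters and the distance of the points; the 8
    allows the second cell to be one level deeper.\<close>
  define C where "C = sqrt (8 * 5 powr s * E)"
  have C: "0 \<le> C" "C\<^sup>2 = 8 * 5 powr s * E" using E by (auto simp: C_def)
  have "\<forall>x n. \<exists>c. x \<in> sierpinski_carpet \<longrightarrow> c \<in> carpet_index n \<and> x \<in> carpet_cell n c"
    using UN_carpet_cells by blast
  then obtain c where c: "\<And>x n. x \<in> sierpinski_carpet \<Longrightarrow> c x n \<in> carpet_index n"
      "\<And>x n. x \<in> sierpinski_carpet \<Longrightarrow> x \<in> carpet_cell n (c x n)" by metis
  define A where "A n x = carpet.mean u (carpet_cell n (c x n))" for n x
  \<comment> \<open>One estimate for two uses: one point at consecutive levels, and two nearby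
    points at the same level.\<close>
  have close: "\<bar>A n x - A m y\<bar> \<le> C * r ^ n"
    if x: "x \<in> sierpinski_carpet" and y: "y \<in> sierpinski_carpet" and xy: "dist x y \<le> 1 / 3 ^ n" and m: "m = n \<or> m = Suc n"
    for x y n m
  proof -
    have "ennreal ((A n x - A m y)\<^sup>2) \<le>
        ennreal (8 ^ n * 8 ^ m * 5 powr (carpet_dim + \<beta>) / (8 ^ n * (3 powr \<beta>) ^ n)) *
          carpet.partial_energy \<beta> u (carpet_cell n (c x n) \<times> carpet_cell m (c y m))"
      unfolding A_def
    proof (rule carpet_mean_diff_le[OF uL2 \<beta>(1)])
      fix x' y' assume "x' \<in> carpet_cell n (c x n)" "y' \<in> carpet_cell m (c y m)"
      then have "dist x' x \<le> 2 / 3 ^ n" "dist y y' \<le> 2 / 3 ^ m"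
        using dist_carpet_cell_le c x y by blast+
      moreover have "2 / 3 ^ m \<le> (2 / 3 ^ n :: real)"
        using m by (intro divide_left_mono power_increasing) auto
      ultimately have "dist x' y' \<le> 2 / 3 ^ n + 1 / 3 ^ n + 2 / 3 ^ n"
        using xy dist_triangle[of x' y' x] dist_triangle[of x y' y] by linarith
      then show "dist x' y' \<le> 5 / 3 ^ n" by simp
    qed (use c x y in auto)
    also have "\<dots> \<le> ennreal (8 * 5 powr s * (8 / 3 powr \<beta>) ^ n) * ennreal E"
      unfolding E(1)[symmetric]
      using m by (intro mult_mono carpet.partial_energy_le um ennreal_leI)
         (auto simp: s_def power_divide intro!: divide_right_mono)
    also have "\<dots> = ennreal ((C * r ^ n)\<^sup>2)"
    proof -
      have "8 * 5 powr s * (8 / 3 powr \<beta>) ^ n * E = (C * r ^ n)\<^sup>2"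
        unfolding r(3)[symmetric] power_mult_distrib C(2) by (simp add: power_mult[symmetric] ac_simps)
      moreover have "0 \<le> 8 * 5 powr s * (8 / 3 powr \<beta>) ^ n" by simp
      ultimately show ?thesis using E(2) by (metis ennreal_mult)
    qed
    finally have "(A n x - A m y)\<^sup>2 \<le> (C * r ^ n)\<^sup>2" by (subst (asm) ennreal_le_iff) auto
    then show ?thesis using C r by (simp add: abs_le_square_iff[symmetric] abs_mult)
  qed
  \<comment> \<open>On this set of full measure \<open>u\<close> is the limit of its averages; the
    continuous version extends \<open>u\<close> from here.\<close>
  define G where "G = {x \<in> sierpinski_carpet. (\<integral>\<^sup>+y. ennreal ((u x - u y)\<^sup>2 / carpet_kernel \<beta> x y) \<partial>carpet_measure) < \<infinity>}"
  have AE_G: "AE x in carpet_measure. x \<in> G"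
    using carpet.AE_density_finite[OF ud] AE_space by eventually_elim (simp add: G_def)
  have lim: "(\<lambda>n. A n x) \<longlonglongrightarrow> u x" if "x \<in> G" for x
  proof -
    have x: "x \<in> sierpinski_carpet" using that by (simp add: G_def)
    have fin: "(\<integral>\<^sup>+y. ennreal ((u x - u y)\<^sup>2 / carpet_kernel \<beta> x y) \<partial>carpet_measure) < \<infinity>"
      using that unfolding G_def by blast
    obtain g where g: "(\<integral>\<^sup>+y. ennreal ((u x - u y)\<^sup>2 / carpet_kernel \<beta> x y) \<partial>carpet_measure) = ennreal g" "0 \<le> g"
      using fin by (cases "\<integral>\<^sup>+y. ennreal ((u x - u y)\<^sup>2 / carpet_kernel \<beta> x y) \<partial>carpet_measure") auto
    \<comment> \<open>The mass of the cell cancels the \<open>8 ^ n\<close> of the kernel bound, and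
      \<open>(1 / 3 powr \<beta>) ^ n\<close> remains.\<close>
    have le: "(u x - A n x)\<^sup>2 \<le> 2 powr s * g * (1 / 3 powr \<beta>) ^ n" for n
    proof -
      have "ennreal ((u x - A n x)\<^sup>2 * measure carpet_measure (carpet_cell n (c x n))) \<le>
          ennreal (2 powr (carpet_dim + \<beta>) / (8 ^ n * (3 powr \<beta>) ^ n)) * ennreal g"
        unfolding A_def g(1)[symmetric]
      proof (rule carpet.deviation_le_density[OF uL2])
        show "carpet_kernel \<beta> x y \<le> 2 powr (carpet_dim + \<beta>) / (8 ^ n * (3 powr \<beta>) ^ n)"
          if "y \<in> carpet_cell n (c x n)" for y
          using dist_carpet_cell_le[OF c(2)[OF x] that] \<beta> by (intro carpet_kernel_le) auto
      qed (use c x in \<open>auto simp: measure_carpet_cell carpet_cell_sets\<close>)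
      then have "(u x - A n x)\<^sup>2 * (1 / 8 ^ n) \<le> 2 powr (carpet_dim + \<beta>) / (8 ^ n * (3 powr \<beta>) ^ n) * g"
        using g c x by (simp add: measure_carpet_cell ennreal_mult[symmetric] del: times_divide_eq_left times_divide_eq_right)
      then have "8 ^ n * ((u x - A n x)\<^sup>2 * (1 / 8 ^ n)) \<le> 8 ^ n * (2 powr (carpet_dim + \<beta>) / (8 ^ n * (3 powr \<beta>) ^ n) * g)"
        by (intro mult_left_mono) auto
      then show ?thesis by (simp add: s_def power_divide)
    qed
    have "(\<lambda>n. 2 powr s * g * (1 / 3 powr \<beta>) ^ n) \<longlonglongrightarrow> 2 powr s * g * 0"
      using \<beta> by (intro tendsto_intros LIMSEQ_power_zero) auto
    then have "(\<lambda>n. (u x - A n x)\<^sup>2) \<longlonglongrightarrow> 0"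
      by (intro tendsto_sandwich[where f = "\<lambda>_. 0" and g = "\<lambda>n. (u x - A n x)\<^sup>2"
            and h = "\<lambda>n. 2 powr s * g * (1 / 3 powr \<beta>) ^ n"])
         (use le in \<open>simp_all add: always_eventually del: power_one_over\<close>)
    then have "(\<lambda>n. u x - A n x) \<longlonglongrightarrow> 0" by simp
    then have "(\<lambda>n. u x - (u x - A n x)) \<longlonglongrightarrow> u x - 0" by (intro tendsto_intros)
    then show ?thesis by simp
  qed
  have tail: "\<bar>A n x - u x\<bar> \<le> C * r ^ n / (1 - r)" if "x \<in> G" for n x
    using that by (intro geometric_tail_bound lim close C r) (auto simp: G_def)
  have hoelder: "\<bar>u x - u y\<bar> \<le> C * (2 / (1 - r) + 1) * r ^ n" if "x \<in> G" "y \<in> G" "dist x y \<le> 1 / 3 ^ n" for x y n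
  proof -
    have "\<bar>u x - u y\<bar> \<le> \<bar>A n x - u x\<bar> + \<bar>A n x - A n y\<bar> + \<bar>A n y - u y\<bar>" by linarith
    also have "\<dots> \<le> C * r ^ n / (1 - r) + C * r ^ n + C * r ^ n / (1 - r)"
      using that by (intro add_mono tail close) (auto simp: G_def)
    also have "\<dots> = C * (2 / (1 - r) + 1) * r ^ n" by (simp add: algebra_simps)
    finally show ?thesis .
  qed
  have "uniformly_continuous_on G u"
    unfolding uniformly_continuous_on_def
  proof (intro allI impI)
    fix e :: real assume e: "0 < e"
    have "(\<lambda>n. C * (2 / (1 - r) + 1) * r ^ n) \<longlonglongrightarrow> C * (2 / (1 - r) + 1) * 0"
      using r by (intro tendsto_intros LIMSEQ_power_zero) auto
    then have "eventually (\<lambda>n. C * (2 / (1 - r) + 1) * r ^ n < e) sequentially"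
      using e by (intro order_tendstoD) auto
    then obtain n where n: "C * (2 / (1 - r) + 1) * r ^ n < e" by (auto simp: eventually_sequentially)
    have "dist (u y) (u x) < e" if "x \<in> G" "y \<in> G" "dist y x < 1 / 3 ^ n" for x y
      using hoelder[of y x n] that n by (simp add: dist_real_def)
    then show "\<exists>d>0. \<forall>x\<in>G. \<forall>y\<in>G. dist y x < d \<longrightarrow> dist (u y) (u x) < e"
      by (intro exI[of _ "1 / 3 ^ n"]) auto
  qed
  then obtain v where v: "uniformly_continuous_on (closure G) v" "\<And>x. x \<in> G \<Longrightarrow> u x = v x"
    using uniformly_continuous_on_extension_on_closure[of G u] by metis
  have "sierpinski_carpet \<subseteq> closure G"
  proof
    fix x assume x: "x \<in> sierpinski_carpet"
    show "x \<in> closure G"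
      unfolding closure_approachable
    proof (intro allI impI)
      fix e :: real assume "0 < e"
      then obtain n where n: "(1 / 3) ^ n < e / 2" using real_arch_pow_inv[of "e / 2" "1 / 3"] by auto
      \<comment> \<open>A cell has positive measure and so cannot avoid \<open>G\<close>.\<close>
      have "\<exists>y. y \<in> carpet_cell n (c x n) \<and> y \<in> G"
      proof (rule ccontr)
        assume "\<nexists>y. y \<in> carpet_cell n (c x n) \<and> y \<in> G"
        with AE_G have "AE y in carpet_measure. y \<notin> carpet_cell n (c x n)" by (auto elim!: eventually_mono)
        then have "emeasure carpet_measure (carpet_cell n (c x n)) = 0"
          using c(1)[OF x] carpet_cell_subset[OF c(1)[OF x]]
          by (subst (asm) AE_iff_measurable[where N = "carpet_cell n (c x n)"]) (auto intro: carpet_cell_sets)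
        then show False using emeasure_carpet_cell[OF c(1)[OF x]] by simp
      qed
      then obtain y where y: "y \<in> carpet_cell n (c x n)" "y \<in> G" by auto
      have "dist y x \<le> 2 / 3 ^ n" by (rule dist_carpet_cell_le[OF y(1) c(2)[OF x]])
      also have "\<dots> < e" using n by (simp add: power_divide)
      finally show "\<exists>y\<in>G. dist y x < e" using y by blast
    qed
  qed
  then have "continuous_on sierpinski_carpet v"
    using uniformly_continuous_imp_continuous[OF v(1)] continuous_on_subset by blast
  moreover have "AE x in carpet_measure. u x = v x"
    using AE_G by eventually_elim (rule v(2))
  ultimately show ?thesis by blast
qed


section \<open>The lower bound\<close>

text \<open>The algebra consists of all continuous functions of finite energy. Compactness makes
  them bounded, so products stay inside; constants have zero energy.\<close>

lemma continuous_domain_dense: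
  assumes \<beta>: "0 < \<beta>" "3 powr \<beta> < 28 / 3" and f: "continuous_on sierpinski_carpet f" and e: "0 < e"
  shows "\<exists>g\<in>carpet_domain \<beta>. continuous_on sierpinski_carpet g \<and> (\<forall>x\<in>sierpinski_carpet. \<bar>f x - g x\<bar> < e)"
proof -
  let ?R = "{g \<in> carpet_domain \<beta>. continuous_on sierpinski_carpet g}"
  have "function_ring_on ?R sierpinski_carpet"
  proof
    show "compact sierpinski_carpet" by (rule compact_carpet)
    show "(\<lambda>x. f x + g x) \<in> ?R" if "f \<in> ?R" "g \<in> ?R" for f g
      using that by (auto simp: carpet_domain_eq intro: carpet.add_domain continuous_intros)
    show "(\<lambda>x. f x * g x) \<in> ?R" if fg: "f \<in> ?R" "g \<in> ?R" for f g
    proof -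
      obtain B1 where B1: "\<And>x. x \<in> sierpinski_carpet \<Longrightarrow> \<bar>f x\<bar> \<le> B1"
        using continuous_bounded_carpet fg(1) by blast
      obtain B2 where B2: "\<And>x. x \<in> sierpinski_carpet \<Longrightarrow> \<bar>g x\<bar> \<le> B2"
        using continuous_bounded_carpet fg(2) by blast
      have "(\<lambda>x. f x * g x) \<in> carpet.domain \<beta>"
        using fg B1 B2 by (intro carpet.energy_mult_finite[where B = "max B1 B2"])
          (auto simp: carpet_domain_eq le_max_iff_disj)
      then show ?thesis using fg by (auto simp: carpet_domain_eq intro: continuous_intros)
    qed
    show "(\<lambda>_. c) \<in> ?R" for c :: real
      by (auto simp: carpet_domain_def carpet_energy_def intro!: continuous_L2_carpet)
    show "\<exists>f\<in>?R. f x \<noteq> f y" if "x \<in> sierpinski_carpet" "y \<in> sierpinski_carpet" "x \<noteq> y" for x y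
    proof -
      have inj: "shorted_potential a \<noteq> shorted_potential b" if "0 \<le> a" "0 \<le> b" "a \<noteq> b" for a b
        using shorted_potential_strict_mono[of a b] shorted_potential_strict_mono[of b a] that
        by (metis less_irrefl linorder_neqE_linordered_idom)
      consider "fst x \<noteq> fst y" | "snd x \<noteq> snd y" using \<open>x \<noteq> y\<close> by (auto simp: prod_eq_iff)
      then show ?thesis
      proof cases
        case 1
        then show ?thesis
          using inj[of "fst x" "fst y"] carpet_coord_bounds(1) that(1,2) shorted_potential_domain[OF \<beta>]
          by (intro bexI[of _ "\<lambda>x. shorted_potential (fst x)"]) simp_all
      next
        case 2
        then show ?thesis
          using inj[of "snd x" "snd y"] carpet_coord_bounds(3) that(1,2) shorted_potential_domain[OF \<beta>]
          by (intro bexI[of _ "\<lambda>x. shorted_potential (snd x)"]) simp_all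
      qed
    qed
  qed auto
  from function_ring_on.Stone_Weierstrass_basic[OF this f e] show ?thesis by blast
qed

lemma carpet_domain_dense_L2:
  assumes \<beta>: "0 < \<beta>" "3 powr \<beta> < 28 / 3" and u: "u \<in> L2_functions carpet_measure" and e: "0 < e"
  shows "\<exists>v\<in>carpet_domain \<beta>. L2_norm carpet_measure (\<lambda>x. u x - v x) < e"
proof -
  \<comment> \<open>Two errors of e^2/16 add up to e^2/4, as the square of a sum is at most twice
    the sum of squares.\<close>
  have e16: "0 < e\<^sup>2 / 16" using e by simp
  obtain g where g: "continuous_on UNIV g" "(\<integral>\<^sup>+x. ennreal ((u x - g x)\<^sup>2) \<partial>carpet_measure) \<le> ennreal (e\<^sup>2 / 16)"
    using continuous_dense_L2[OF finite_measure_carpet sets_carpet_measure carpet_borel u e16] by blast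
  have gc: "continuous_on sierpinski_carpet g" using g(1) continuous_on_subset by blast
  obtain v where v: "v \<in> carpet_domain \<beta>" "continuous_on sierpinski_carpet v"
      "\<And>x. x \<in> sierpinski_carpet \<Longrightarrow> \<bar>g x - v x\<bar> < e / 4"
    using continuous_domain_dense[OF \<beta> gc, of "e / 4"] e by auto
  have [measurable]: "u \<in> borel_measurable carpet_measure" "g \<in> borel_measurable carpet_measure"
      "v \<in> borel_measurable carpet_measure"
    using u gc v(2) by (auto simp: L2_functions_def continuous_borel_measurable_carpet)
  have "(\<integral>\<^sup>+x. ennreal ((g x - v x)\<^sup>2) \<partial>carpet_measure) \<le> (\<integral>\<^sup>+x. ennreal (e\<^sup>2 / 16) \<partial>carpet_measure)"
  proof (intro nn_integral_mono ennreal_leI)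
    fix x assume "x \<in> space carpet_measure"
    then have "\<bar>g x - v x\<bar> \<le> \<bar>e / 4\<bar>" using v(3)[of x] e by simp
    then have "(g x - v x)\<^sup>2 \<le> (e / 4)\<^sup>2" by (rule abs_le_square_iff[THEN iffD1])
    then show "(g x - v x)\<^sup>2 \<le> e\<^sup>2 / 16" by (simp add: power_divide)
  qed
  also have "\<dots> = ennreal (e\<^sup>2 / 16)" by (simp add: prob_space_carpet_measure)
  finally have gv: "(\<integral>\<^sup>+x. ennreal ((g x - v x)\<^sup>2) \<partial>carpet_measure) \<le> ennreal (e\<^sup>2 / 16)" .
  have "(\<integral>\<^sup>+x. ennreal ((u x - v x)\<^sup>2) \<partial>carpet_measure) = (\<integral>\<^sup>+x. ennreal (((u x - g x) + (g x - v x))\<^sup>2) \<partial>carpet_measure)"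
    by simp
  also have "\<dots> \<le> 2 * (\<integral>\<^sup>+x. ennreal ((u x - g x)\<^sup>2) \<partial>carpet_measure) + 2 * (\<integral>\<^sup>+x. ennreal ((g x - v x)\<^sup>2) \<partial>carpet_measure)"
    by (rule nn_integral_square_add_le) measurable
  also have "\<dots> \<le> 2 * ennreal (e\<^sup>2 / 16) + 2 * ennreal (e\<^sup>2 / 16)"
    by (intro add_mono mult_left_mono g gv) auto
  also have "\<dots> = ennreal (e\<^sup>2 / 4)"
  proof -
    have "2 * ennreal a + 2 * ennreal a = ennreal (4 * a)" if "0 \<le> a" for a
      using that by (simp add: ennreal_mult mult_2[symmetric] mult.assoc[symmetric])
    from this[of "e\<^sup>2 / 16"] show ?thesis by simp
  qed
  finally have "enn2real (\<integral>\<^sup>+x. ennreal ((u x - v x)\<^sup>2) \<partial>carpet_measure) \<le> e\<^sup>2 / 4"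
    by (intro enn2real_leI) auto
  then have "(L2_norm carpet_measure (\<lambda>x. u x - v x))\<^sup>2 \<le> e\<^sup>2 / 4"
    by (subst L2_norm_square) auto
  also have "\<dots> < e\<^sup>2" using e by simp
  finally have "L2_norm carpet_measure (\<lambda>x. u x - v x) < e"
    using e by (simp add: power2_less_imp_less)
  with v(1) show ?thesis by blast
qed

text \<open>The carpet is compact, so the core consists of the continuous functions in the domain. A
  continuous version has distance zero in the form norm, hence approximation in that norm is
  exact.\<close>

lemma regular_carpet_form_lower:
  assumes \<beta>: "0 < \<beta>" "8 < 3 powr \<beta>" "3 powr \<beta> < 28 / 3"
  shows "regular_dirichlet_form carpet_measure (carpet_form \<beta>) (carpet_domain \<beta>)"
proof (rule regular_dirichlet_form.intro)
  show "dirichlet_form carpet_measure (carpet_form \<beta>) (carpet_domain \<beta>)"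
    unfolding carpet_form_eq carpet_domain_eq
    by (rule carpet.dirichlet_form_jump) (use carpet_domain_dense_L2[OF \<beta>(1,3)] in \<open>simp add: carpet_domain_eq\<close>)
  have core: "v \<in> compactly_supported_continuous (space carpet_measure) \<longleftrightarrow> continuous_on sierpinski_carpet v" for v
    using compact_carpet by (auto simp: compactly_supported_continuous_def)
  show "regular_dirichlet_form_axioms carpet_measure (carpet_form \<beta>) (carpet_domain \<beta>)"
  proof
    fix u and e :: real assume u: "u \<in> carpet_domain \<beta>" and e: "0 < e"
    obtain v where v: "continuous_on sierpinski_carpet v" "AE x in carpet_measure. u x = v x"
      using carpet_continuous_version[OF \<beta>(1,2) u] by blast
    have ud: "u \<in> carpet.domain \<beta>" using u by (simp add: carpet_domain_eq)
    then have vd: "v \<in> carpet.domain \<beta>"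
      by (rule carpet.domain_AE_closed) (use v in \<open>auto intro: continuous_L2_carpet\<close>)
    have "carpet.energy \<beta> (\<lambda>x. u x - v x) = carpet.energy \<beta> (\<lambda>x. 0)"
      using v(2) by (intro carpet.energy_cong_AE) (auto elim!: eventually_mono)
    also have "\<dots> = 0" by (simp add: carpet.energy_def)
    finally have "carpet.energy \<beta> (\<lambda>x. u x - v x) = 0" .
    moreover have "(\<integral>\<^sup>+x. ennreal ((u x - v x)\<^sup>2) \<partial>carpet_measure) = (\<integral>\<^sup>+x. 0 \<partial>carpet_measure)"
      using v(2) by (intro nn_integral_cong_AE) (auto elim!: eventually_mono)
    ultimately have "form_norm1 carpet_measure (carpet_form \<beta>) (\<lambda>x. u x - v x) < e"
      unfolding carpet_form_eq using carpet.form_norm1_less_iff[OF carpet.diff_domain[OF ud vd] e] e by simp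
    then show "\<exists>v\<in>carpet_domain \<beta> \<inter> compactly_supported_continuous (space carpet_measure).
        form_norm1 carpet_measure (carpet_form \<beta>) (\<lambda>x. u x - v x) < e"
      using vd v(1) unfolding carpet_domain_eq[symmetric] core[symmetric] by blast
  next
    fix u and e :: real assume "u \<in> compactly_supported_continuous (space carpet_measure)" and e: "0 < e"
    then show "\<exists>v\<in>carpet_domain \<beta> \<inter> compactly_supported_continuous (space carpet_measure).
        \<forall>x\<in>space carpet_measure. \<bar>u x - v x\<bar> < e"
      using continuous_domain_dense[OF \<beta>(1,3) _ e, of u] unfolding core[symmetric] by auto
  qed
qed

theorem theorem1p4:
  shows "carpet_critical_exponent \<in>
    {ereal (ln (8 * (7/6)) / ln 3) .. ereal (ln (8 * (3/2)) / ln 3)}"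
proof -
  have less_iff: "3 powr \<beta> < b \<longleftrightarrow> \<beta> < ln b / ln 3" "b < 3 powr \<beta> \<longleftrightarrow> ln b / ln 3 < \<beta>" if "0 < b" for b \<beta> :: real
    using that ln_less_cancel_iff[of "3 powr \<beta>" b] ln_less_cancel_iff[of b "3 powr \<beta>"]
    by (auto simp: ln_powr pos_less_divide_eq pos_divide_less_eq)
  have "carpet_critical_exponent \<le> ereal (ln (8 * (3/2)) / ln 3)"
    unfolding carpet_critical_exponent_def
  proof (rule Sup_least, clarify)
    fix \<beta> :: real
    assume "0 < \<beta>" "regular_dirichlet_form carpet_measure (carpet_form \<beta>) (carpet_domain \<beta>)"
    then have "3 powr \<beta> \<le> 12" by (rule regular_carpet_form_upper)
    then show "ereal \<beta> \<le> ereal (ln (8 * (3/2)) / ln 3)"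
      using less_iff(2)[of 12 \<beta>] by simp
  qed
  moreover have "ereal (ln (8 * (7/6)) / ln 3) \<le> carpet_critical_exponent"
  proof (rule dense_le)
    fix x :: ereal assume "x < ereal (ln (8 * (7/6)) / ln 3)"
    then obtain t where t: "x < ereal t" "t < ln (28 / 3) / ln 3"
      using ereal_dense2[of x "ereal (ln (28 / 3) / ln 3)"] by auto
    \<comment> \<open>28/3 = 8 * 7/6 exceeds 8, so there are exponents arbitrarily close to the end
      point that lie above ln 8 / ln 3, where continuous versions exist; the maximum with
      \<open>t\<close> selects one beyond \<open>x\<close>.\<close>
    have "ln 8 / ln 3 < ln (28 / 3) / ln (3 :: real)" by (intro divide_strict_right_mono) auto
    then obtain \<beta> where \<beta>: "max t (ln 8 / ln 3) < \<beta>" "\<beta> < ln (28 / 3) / ln 3"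
      using dense[of "max t (ln 8 / ln 3)" "ln (28 / 3) / ln 3"] t by auto
    have "0 < ln 8 / ln (3 :: real)" by simp
    moreover have "ln 8 / ln 3 < \<beta>" using \<beta>(1) by simp
    ultimately have "0 < \<beta>" by linarith
    moreover have "8 < 3 powr \<beta>"
      using \<open>ln 8 / ln 3 < \<beta>\<close> by (subst less_iff(2)) auto
    moreover have "3 powr \<beta> < 28 / 3"
      using \<beta>(2) by (subst less_iff(1)) auto
    ultimately have "regular_dirichlet_form carpet_measure (carpet_form \<beta>) (carpet_domain \<beta>)"
      by (rule regular_carpet_form_lower)
    with \<open>0 < \<beta>\<close> have "ereal \<beta> \<le> carpet_critical_exponent"
      unfolding carpet_critical_exponent_def by (intro Sup_upper) auto
    moreover have "x < ereal \<beta>" using t(1) \<beta>(1) by (auto intro: less_trans)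
    ultimately show "x \<le> carpet_critical_exponent" by simp
  qed
  ultimately show ?thesis by simp
qed

end
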